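(* Let $L,g,\mu,m,H_{\max}>0$ be constants, let $h^*:=m/L$, and assume $h^*<H_{\max}$. For every $r\in[0,R)$ and for every $\sigma,q,k,\gamma,\beta>0$, $\lambda\in[0,1]$ with $$\frac{2g}{\mu L}>\sigma>\frac{8k}{q},\qquad \frac{2\pi^2\mu\,G^{-1}(-cr)}{mL^2\,G^{-1}(cr)}>\beta+4\sigma>8\sigma,$$ (where $R,c,G$ are the constants and the function defined in the context) there exist constants $M,\varphi>0$ with the following property. Every classical solution $(\xi,w,h,v,\hat\xi,\hat w,z)$ of the closed-loop system consisting of the tank-liquid model $$\dot\xi=w,\quad \dot w=-f,\qquad h_t+(hv)_x=0\ \ (t>0,\ x\in[0,L]),$$ $$(hv)_t+\left(hv^2+\tfrac12 gh^2\right)_x=\mu(hv_x)_x+hf\ \ (t>0,\ x\in(0,L)),$$ $$v(t,0)=v(t,L)=0\ \ (t\ge0),\qquad \int_0^L h(t,x)\,dx=m\ \ (t\ge 0),$$ the full-order observer $$\frac{d\hat\xi}{dt}=\hat w-2\gamma(\hat\xi-\xi),\qquad \frac{d\hat w}{dt}=-f-\left(\tfrac12+\gamma^2\right)(\hat\xi-\xi),$$ the filter $$\dot z(t)=mf(t)-\frac g2\left(h^2(t,L)-h^2(t,0)\right)-\beta\left(z(t)-\mu(h(t,L)-h(t,0))\right),\quad t>0,$$ and the feedback law $$f=-\sigma\left(2\lambda z+(1-2\lambda)\mu(h(t,L)-h(t,0))-q(\hat w+k\xi)+q\gamma(\hat\xi-\xi)\right),\quad t>0,$$ with $\Phi(\xi(0),w(0),h[0],v[0],\hat\xi(0),\hat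 w(0),z(0))\le r$, where $\Phi:X\times\mathbb R^3\to[0,+\infty)$ is the functional $$\Phi(\xi,w,h,v,\hat\xi,\hat w,z):=V(\xi,w,h,v)+\frac{\sigma q^2}{2\gamma}(\hat\xi-\xi)^2+\frac{\sigma q^2}{\gamma}\left(\hat w-w-\gamma(\hat\xi-\xi)\right)^2+\frac\lambda2\left(z-\int_0^L h(x)v(x)\,dx-\mu(h(L)-h(0))\right)^2,$$ satisfies $(\xi(t),w(t),h[t],v[t])\in X$ and the following estimate for all $t\ge0$: $$\begin{aligned}&\left\|(\xi(t),w(t),h[t]-h^*\chi_{[0,L]},v[t])\right\|_X+|\hat\xi(t)-\xi(t)|+|\hat w(t)-w(t)|\\&\quad+\sqrt\lambda\left|z(t)-\int_0^L h(t,x)v(t,x)\,dx-\mu(h(t,L)-h(t,0))\right|\\&\le M e^{-\varphi t}\Big(\left\|(\xi(0),w(0),h[0]-h^*\chi_{[0,L]},v[0])\right\|_X+|\hat\xi(0)-\xi(0)|+|\hat w(0)-w(0)|\\&\quad+\sqrt\lambda\left|z(0)-\int_0^L h(0,x)v(0,x)\,dx-\mu(h(0,L)-h(0,0))\right|\Big).\end{aligned}$$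
   Context: Notation: $u[t]$ denotes the profile $x\mapsto u(t,x)$; subscripts $t,x$ denote partial derivatives; $\chi_{[0,L]}$ is the characteristic function of $[0,L]$; $\|\cdot\|_2$ is the $L^2(0,L)$ norm. Constants and functions: $c:=\frac1{\mu\sqrt g}$ and $R:=\frac{2\mu\sqrt g}{3}\left(2h^*\sqrt{h^*}+\sqrt{H_{\max}}\,\min(H_{\max}-3h^*,0)\right)$. The function $G:(0,+\infty)\to\left(-\frac43h^*\sqrt{h^*},+\infty\right)$, $G(h):=\frac23\,\mathrm{sgn}(h-h^* )\left(h\sqrt h-3h^*\sqrt h+2h^*\sqrt{h^*}\right)$, is an increasing $C^1$ bijection and $G^{-1}$ is its inverse. State space: $S$ is the set of all $(\xi,w,h,v)$ with $(\xi,w)\in\mathbb R^2$, $h\in C^0([0,L];(0,+\infty))\cap H^1(0,L)$, $v\in C^0([0,L])$, $v(0)=v(L)=0$, $\int_0^L h(x)\,dx=m$. The functional $V:S\to[0,+\infty)$ is $$V(\xi,w,h,v):=W(h,v)+E(h,v)+\frac{qk^2}2\xi^2+\frac q2(w+k\xi)^2,$$ $$E(h,v):=\frac12\int_0^L h v^2\,dx+\frac g2\int_0^L(h-h^* )^2dx,\qquad W(h,v):=\frac12\int_0^L h^{-1}\left(hv+\mu h_x\right)^2dx+\frac g2\int_0^L(h-h^* )^2dx.$$ Put $X:=\{(\xi,w,h,v)\in S: V(\xi,w,h,v)<R\}$ and $\|(\xi,w,h,v)\|_X:=\left(\xi^2+w^2+\|h\|_2^2+\|h'\|_2^2+\|v\|_2^2\right)^{1/2}$.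 Classical solution: $\xi\in C^1([0,\infty))\cap C^2((0,\infty))$, $w\in C^0([0,\infty))\cap C^1((0,\infty))$, $v\in C^0([0,\infty)\times[0,L])\cap C^1((0,\infty)\times[0,L])$, $h\in C^1([0,\infty)\times[0,L];(0,\infty))\cap C^2((0,\infty)\times(0,L))$, $v[t]\in C^2((0,L))$ for each $t>0$, $f\in C^0([0,\infty))$, and $\hat\xi,\hat w,z\in C^0([0,\infty))\cap C^1((0,\infty))$, satisfying all the equations. The constants $M,\varphi$ may depend on $r,\sigma,q,k,\gamma,\beta,\lambda,L,g,\mu,m,H_{\max}$ but not on the solution. *)

theory Defs
  imports "HOL-Analysis.Analysis"
begin

text \<open>Profiles on \<open>[0,L]\<close> are represented by functions \<open>real \<Rightarrow> real\<close> of which only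
  the values on \<open>{0..L}\<close> matter; similarly for functions of time on \<open>{0..}\<close>. All derivatives at
  boundary points are therefore one-sided (taken within the set).\<close>

definition C1_on :: "real set \<Rightarrow> (real \<Rightarrow> real) \<Rightarrow> bool" where
  "C1_on I f \<longleftrightarrow> (\<exists>f'. (\<forall>t\<in>I. (f has_real_derivative f' t) (at t within I)) \<and> continuous_on I f')"

definition C2_on :: "real set \<Rightarrow> (real \<Rightarrow> real) \<Rightarrow> bool" where
  "C2_on I f \<longleftrightarrow> (\<exists>f'. (\<forall>t\<in>I. (f has_real_derivative f' t) (at t within I)) \<and> C1_on I f')"

definition C0_rect :: "real set \<Rightarrow> real set \<Rightarrow> (real \<Rightarrow> real \<Rightarrow> real) \<Rightarrow> bool" where
  "C0_rect T X u \<longleftrightarrow> continuous_on (T \<times> X) (\<lambda>(t, x). u t x)"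

definition partials_on ::
  "real set \<Rightarrow> real set \<Rightarrow> (real \<Rightarrow> real \<Rightarrow> real) \<Rightarrow> (real \<Rightarrow> real \<Rightarrow> real) \<Rightarrow> (real \<Rightarrow> real \<Rightarrow> real) \<Rightarrow> bool" where
  "partials_on T X u ut ux \<longleftrightarrow>
     (\<forall>t\<in>T. \<forall>x\<in>X. ((\<lambda>s. u s x) has_real_derivative ut t x) (at t within T) \<and>
                   ((\<lambda>y. u t y) has_real_derivative ux t x) (at x within X))"

definition C1_rect :: "real set \<Rightarrow> real set \<Rightarrow> (real \<Rightarrow> real \<Rightarrow> real) \<Rightarrow> bool" where
  "C1_rect T X u \<longleftrightarrow> (\<exists>ut ux. partials_on T X u ut ux \<and> C0_rect T X ut \<and> C0_rect T X ux)"

definition C2_rect :: "real set \<Rightarrow> real set \<Rightarrow> (real \<Rightarrow> real \<Rightarrow> real) \<Rightarrow> bool" where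
  "C2_rect T X u \<longleftrightarrow> (\<exists>ut ux. partials_on T X u ut ux \<and> C1_rect T X ut \<and> C1_rect T X ux)"

definition Dt :: "(real \<Rightarrow> real \<Rightarrow> real) \<Rightarrow> real \<Rightarrow> real \<Rightarrow> real" where
  "Dt u t x = vector_derivative (\<lambda>s. u s x) (at t within {0..})"

definition Dx :: "real \<Rightarrow> (real \<Rightarrow> real \<Rightarrow> real) \<Rightarrow> real \<Rightarrow> real \<Rightarrow> real" where
  "Dx L u t x = vector_derivative (\<lambda>y. u t y) (at x within {0..L})"

definition in_L2 :: "real \<Rightarrow> (real \<Rightarrow> real) \<Rightarrow> bool" where
  "in_L2 L u \<longleftrightarrow> u \<in> borel_measurable (lebesgue_on {0..L}) \<and>
                 integrable (lebesgue_on {0..L}) (\<lambda>x. (u x)\<^sup>2)"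

definition L2_norm :: "real \<Rightarrow> (real \<Rightarrow> real) \<Rightarrow> real" where
  "L2_norm L u = sqrt (LINT x|lebesgue_on {0..L}. (u x)\<^sup>2)"

definition test_fun :: "real \<Rightarrow> (real \<Rightarrow> real) \<Rightarrow> bool" where
  "test_fun L \<phi> \<longleftrightarrow> C1_on UNIV \<phi> \<and> (\<exists>K. compact K \<and> K \<subseteq> {0<..<L} \<and> (\<forall>x. x \<notin> K \<longrightarrow> \<phi> x = 0))"

text \<open>Weak derivatives are tested against \<open>C\<^sub>c\<^sup>1(0,L)\<close>, as in Brezis' definition of
  \<open>W\<^sup>1\<^sup>,\<^sup>p\<close> on an interval.\<close>

definition has_weak_derivative :: "real \<Rightarrow> (real \<Rightarrow> real) \<Rightarrow> (real \<Rightarrow> real) \<Rightarrow> bool" where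
  "has_weak_derivative L u u' \<longleftrightarrow> in_L2 L u' \<and>
     (\<forall>\<phi>. test_fun L \<phi> \<longrightarrow>
        (LINT x|lebesgue_on {0..L}. u x * deriv \<phi> x) = - (LINT x|lebesgue_on {0..L}. u' x * \<phi> x))"

definition in_H1 :: "real \<Rightarrow> (real \<Rightarrow> real) \<Rightarrow> bool" where
  "in_H1 L u \<longleftrightarrow> in_L2 L u \<and> (\<exists>u'. has_weak_derivative L u u')"

text \<open>The weak derivative is unique up to a null set; the choice below only occurs under integrals.\<close>

definition weak_deriv :: "real \<Rightarrow> (real \<Rightarrow> real) \<Rightarrow> real \<Rightarrow> real" where
  "weak_deriv L u = (SOME u'. has_weak_derivative L u u')"

definition G_fun :: "real \<Rightarrow> real \<Rightarrow> real" where
  "G_fun hs h = 2 / 3 * sgn (h - hs) * (h * sqrt h - 3 * hs * sqrt h + 2 * hs * sqrt hs)"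

definition G_inv :: "real \<Rightarrow> real \<Rightarrow> real" where
  "G_inv hs = the_inv_into {0<..} (G_fun hs)"

definition c_const :: "real \<Rightarrow> real \<Rightarrow> real" where
  "c_const g \<mu> = 1 / (\<mu> * sqrt g)"

definition R_const :: "real \<Rightarrow> real \<Rightarrow> real \<Rightarrow> real \<Rightarrow> real" where
  "R_const g \<mu> hs Hmax =
     2 * \<mu> * sqrt g / 3 * (2 * hs * sqrt hs + sqrt Hmax * min (Hmax - 3 * hs) 0)"

type_synonym state = "real \<times> real \<times> (real \<Rightarrow> real) \<times> (real \<Rightarrow> real)"

definition state_space :: "real \<Rightarrow> real \<Rightarrow> state set" where
  "state_space L m = {(\<xi>, w, h, v).
     continuous_on {0..L} h \<and> (\<forall>x\<in>{0..L}. h x > 0) \<and> in_H1 L h \<and>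
     continuous_on {0..L} v \<and> v 0 = 0 \<and> v L = 0 \<and>
     (LINT x|lebesgue_on {0..L}. h x) = m}"

definition E_fun :: "real \<Rightarrow> real \<Rightarrow> real \<Rightarrow> (real \<Rightarrow> real) \<Rightarrow> (real \<Rightarrow> real) \<Rightarrow> real" where
  "E_fun L g hs h v =
     1 / 2 * (LINT x|lebesgue_on {0..L}. h x * (v x)\<^sup>2) +
     g / 2 * (LINT x|lebesgue_on {0..L}. (h x - hs)\<^sup>2)"

definition W_fun :: "real \<Rightarrow> real \<Rightarrow> real \<Rightarrow> real \<Rightarrow> (real \<Rightarrow> real) \<Rightarrow> (real \<Rightarrow> real) \<Rightarrow> real" where
  "W_fun L g \<mu> hs h v =
     1 / 2 * (LINT x|lebesgue_on {0..L}. inverse (h x) * (h x * v x + \<mu> * weak_deriv L h x)\<^sup>2) +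
     g / 2 * (LINT x|lebesgue_on {0..L}. (h x - hs)\<^sup>2)"

definition V_fun :: "real \<Rightarrow> real \<Rightarrow> real \<Rightarrow> real \<Rightarrow> real \<Rightarrow> real \<Rightarrow> state \<Rightarrow> real" where
  "V_fun L g \<mu> hs q k = (\<lambda>(\<xi>, w, h, v).
     W_fun L g \<mu> hs h v + E_fun L g hs h v + q * k\<^sup>2 / 2 * \<xi>\<^sup>2 + q / 2 * (w + k * \<xi>)\<^sup>2)"

definition X_set :: "real \<Rightarrow> real \<Rightarrow> real \<Rightarrow> real \<Rightarrow> real \<Rightarrow> real \<Rightarrow> real \<Rightarrow> state set" where
  "X_set L g \<mu> m Hmax q k =
     {s \<in> state_space L m. V_fun L g \<mu> (m / L) q k s < R_const g \<mu> (m / L) Hmax}"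

definition X_norm :: "real \<Rightarrow> state \<Rightarrow> real" where
  "X_norm L = (\<lambda>(\<xi>, w, h, v).
     sqrt (\<xi>\<^sup>2 + w\<^sup>2 + (L2_norm L h)\<^sup>2 + (L2_norm L (weak_deriv L h))\<^sup>2 + (L2_norm L v)\<^sup>2))"

definition filter_error :: "real \<Rightarrow> real \<Rightarrow> (real \<Rightarrow> real) \<Rightarrow> (real \<Rightarrow> real) \<Rightarrow> real \<Rightarrow> real" where
  "filter_error L \<mu> h v z = z - (LINT x|lebesgue_on {0..L}. h x * v x) - \<mu> * (h L - h 0)"

definition Phi_fun ::
  "real \<Rightarrow> real \<Rightarrow> real \<Rightarrow> real \<Rightarrow> real \<Rightarrow> real \<Rightarrow> real \<Rightarrow> real \<Rightarrow> real \<Rightarrow>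
   state \<Rightarrow> real \<Rightarrow> real \<Rightarrow> real \<Rightarrow> real" where
  "Phi_fun L g \<mu> hs \<sigma> q k \<gamma> lam = (\<lambda>(\<xi>, w, h, v) \<xi>h wh z.
     V_fun L g \<mu> hs q k (\<xi>, w, h, v)
     + \<sigma> * q\<^sup>2 / (2 * \<gamma>) * (\<xi>h - \<xi>)\<^sup>2
     + \<sigma> * q\<^sup>2 / \<gamma> * (wh - w - \<gamma> * (\<xi>h - \<xi>))\<^sup>2
     + lam / 2 * (filter_error L \<mu> h v z)\<^sup>2)"

definition total_deviation ::
  "real \<Rightarrow> real \<Rightarrow> real \<Rightarrow> real \<Rightarrow> state \<Rightarrow> real \<Rightarrow> real \<Rightarrow> real \<Rightarrow> real" where
  "total_deviation L \<mu> hs lam = (\<lambda>(\<xi>, w, h, v) \<xi>h wh z.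
     X_norm L (\<xi>, w, (\<lambda>x. h x - hs * indicat_real {0..L} x), v)
     + \<bar>\<xi>h - \<xi>\<bar> + \<bar>wh - w\<bar> + sqrt lam * \<bar>filter_error L \<mu> h v z\<bar>)"

definition classical_regularity ::
  "real \<Rightarrow> (real \<Rightarrow> real) \<Rightarrow> (real \<Rightarrow> real) \<Rightarrow> (real \<Rightarrow> real \<Rightarrow> real) \<Rightarrow> (real \<Rightarrow> real \<Rightarrow> real) \<Rightarrow>
   (real \<Rightarrow> real) \<Rightarrow> (real \<Rightarrow> real) \<Rightarrow> (real \<Rightarrow> real) \<Rightarrow> (real \<Rightarrow> real) \<Rightarrow> bool" where
  "classical_regularity L \<xi> w h v f \<xi>h wh z \<longleftrightarrow>
     C1_on {0..} \<xi> \<and> C2_on {0<..} \<xi> \<and>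
     continuous_on {0..} w \<and> C1_on {0<..} w \<and>
     C0_rect {0..} {0..L} v \<and> C1_rect {0<..} {0..L} v \<and>
     C1_rect {0..} {0..L} h \<and> (\<forall>t\<ge>0. \<forall>x\<in>{0..L}. h t x > 0) \<and> C2_rect {0<..} {0<..<L} h \<and>
     (\<forall>t>0. C2_on {0<..<L} (v t)) \<and>
     continuous_on {0..} f \<and>
     continuous_on {0..} \<xi>h \<and> C1_on {0<..} \<xi>h \<and>
     continuous_on {0..} wh \<and> C1_on {0<..} wh \<and>
     continuous_on {0..} z \<and> C1_on {0<..} z"

definition tank_liquid_model ::
  "real \<Rightarrow> real \<Rightarrow> real \<Rightarrow> real \<Rightarrow> (real \<Rightarrow> real) \<Rightarrow> (real \<Rightarrow> real) \<Rightarrow>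
   (real \<Rightarrow> real \<Rightarrow> real) \<Rightarrow> (real \<Rightarrow> real \<Rightarrow> real) \<Rightarrow> (real \<Rightarrow> real) \<Rightarrow> bool" where
  "tank_liquid_model L g \<mu> m \<xi> w h v f \<longleftrightarrow>
     (\<forall>t>0. (\<xi> has_real_derivative w t) (at t)) \<and>
     (\<forall>t>0. (w has_real_derivative - f t) (at t)) \<and>
     (\<forall>t>0. \<forall>x\<in>{0..L}. Dt h t x + Dx L (\<lambda>t x. h t x * v t x) t x = 0) \<and>
     (\<forall>t>0. \<forall>x\<in>{0<..<L}.
        Dt (\<lambda>t x. h t x * v t x) t x
        + Dx L (\<lambda>t x. h t x * (v t x)\<^sup>2 + 1 / 2 * g * (h t x)\<^sup>2) t x
        = \<mu> * Dx L (\<lambda>t x. h t x * Dx L v t x) t x + h t x * f t) \<and>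
     (\<forall>t\<ge>0. v t 0 = 0 \<and> v t L = 0) \<and>
     (\<forall>t\<ge>0. (LINT x|lebesgue_on {0..L}. h t x) = m)"

definition observer ::
  "real \<Rightarrow> (real \<Rightarrow> real) \<Rightarrow> (real \<Rightarrow> real) \<Rightarrow> (real \<Rightarrow> real) \<Rightarrow> (real \<Rightarrow> real) \<Rightarrow> bool" where
  "observer \<gamma> \<xi> f \<xi>h wh \<longleftrightarrow>
     (\<forall>t>0. (\<xi>h has_real_derivative wh t - 2 * \<gamma> * (\<xi>h t - \<xi> t)) (at t)) \<and>
     (\<forall>t>0. (wh has_real_derivative - f t - (1 / 2 + \<gamma>\<^sup>2) * (\<xi>h t - \<xi> t)) (at t))"

definition momentum_filter ::
  "real \<Rightarrow> real \<Rightarrow> real \<Rightarrow> real \<Rightarrow> real \<Rightarrow> (real \<Rightarrow> real \<Rightarrow> real) \<Rightarrow> (real \<Rightarrow> real) \<Rightarrow> (real \<Rightarrow> real) \<Rightarrow> bool" where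
  "momentum_filter L g \<mu> m \<beta> h f z \<longleftrightarrow>
     (\<forall>t>0. (z has_real_derivative
        m * f t - g / 2 * ((h t L)\<^sup>2 - (h t 0)\<^sup>2) - \<beta> * (z t - \<mu> * (h t L - h t 0))) (at t))"

definition feedback_law ::
  "real \<Rightarrow> real \<Rightarrow> real \<Rightarrow> real \<Rightarrow> real \<Rightarrow> real \<Rightarrow> real \<Rightarrow> (real \<Rightarrow> real) \<Rightarrow> (real \<Rightarrow> real \<Rightarrow> real) \<Rightarrow>
   (real \<Rightarrow> real) \<Rightarrow> (real \<Rightarrow> real) \<Rightarrow> (real \<Rightarrow> real) \<Rightarrow> (real \<Rightarrow> real) \<Rightarrow> bool" where
  "feedback_law L \<mu> \<sigma> q k \<gamma> lam \<xi> h f \<xi>h wh z \<longleftrightarrow>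
     (\<forall>t>0. f t = - \<sigma> * (2 * lam * z t + (1 - 2 * lam) * \<mu> * (h t L - h t 0)
                         - q * (wh t + k * \<xi> t) + q * \<gamma> * (\<xi>h t - \<xi> t)))"

definition closed_loop_solution ::
  "real \<Rightarrow> real \<Rightarrow> real \<Rightarrow> real \<Rightarrow> real \<Rightarrow> real \<Rightarrow> real \<Rightarrow> real \<Rightarrow> real \<Rightarrow> real \<Rightarrow>
   (real \<Rightarrow> real) \<Rightarrow> (real \<Rightarrow> real) \<Rightarrow> (real \<Rightarrow> real \<Rightarrow> real) \<Rightarrow> (real \<Rightarrow> real \<Rightarrow> real) \<Rightarrow>
   (real \<Rightarrow> real) \<Rightarrow> (real \<Rightarrow> real) \<Rightarrow> (real \<Rightarrow> real) \<Rightarrow> (real \<Rightarrow> real) \<Rightarrow> bool" where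
  "closed_loop_solution L g \<mu> m \<sigma> q k \<gamma> \<beta> lam \<xi> w h v f \<xi>h wh z \<longleftrightarrow>
     classical_regularity L \<xi> w h v f \<xi>h wh z \<and>
     tank_liquid_model L g \<mu> m \<xi> w h v f \<and>
     observer \<gamma> \<xi> f \<xi>h wh \<and>
     momentum_filter L g \<mu> m \<beta> h f z \<and>
     feedback_law L \<mu> \<sigma> q k \<gamma> lam \<xi> h f \<xi>h wh z"

end

theory Submission
  imports Defs
begin

text \<open>The functional \<open>\<Phi>\<close> is a strict Lyapunov function. The mechanical energy \<open>E\<close> and the
  Bresch-Desjardins type energy \<open>W\<close>, built on the effective velocity \<open>v + \<mu> h\<^sub>x / h\<close>, dissipate
  \<open>\<mu> \<integral> h v\<^sub>x\<^sup>2\<close> and \<open>\<mu> g \<integral> h\<^sub>x\<^sup>2\<close>; the feedback enters both only through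
  \<open>f (2 \<integral> h v + \<mu> (h(L) - h(0)))\<close>. The sharp Dirichlet-Poincare inequality, the Cauchy-Schwarz
  inequality and the two gain conditions reduce \<open>d\<Phi>/dt < 0\<close> to the positivity of a quadratic form in
  finitely many scalars. This requires \<open>lo \<le> h \<le> hi\<close>, which follows from \<open>\<Phi>\<close> itself:
  the energy dominates \<open>\<mu> \<surd>g \<integral> \<bar>(G \<circ> h)\<^sub>x\<bar>\<close>, so that \<open>\<bar>G(h)\<bar> \<le> c \<Phi>\<close>, and
  \<open>h = h\<^sup>*\<close> somewhere by conservation of mass. A continuity argument on a slightly larger sublevel
  set closes the loop.\<close>

section \<open>Integral inequalities\<close>

text \<open>The obstacle that shapes the development is regularity. The profile \<open>v t\<close>
  is twice differentiable only for each fixed t, so \<open>vxx\<close> carries no joint continuity,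
  and \<open>htx\<close> is continuous only in the open interval. Time derivatives are therefore
  written with \<open>vt\<close> and \<open>htx\<close>, fluxes with \<open>vx\<close> and
  \<open>hx\<close>, and the two equations enter as pointwise identities at interior points. In
  addition, \<open>W_fun\<close> and \<open>X_norm\<close> use a weak derivative picked by choice,
  which must be identified almost everywhere with the classical one. Constants that occur in a gain
  condition have to be sharp: pi^2 in the Poincare inequality for v, and the factor
  \<open>m * hi\<close> in the bound for the momentum. Constants that influence only the decay rate
  may be crude. The level r is raised because an exit-time argument needs decay at values of the
  functional slightly above r; the strictness of the condition on \<open>G_inv\<close> provides the
  room.\<close>

lemma integral_power2_linear_combination:
  fixes f g :: "real \<Rightarrow> real"
  assumes "continuous_on {a..b} f" "continuous_on {a..b} g"
  shows "integral {a..b} (\<lambda>x. (s * f x + t * g x)\<^sup>2)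
    = s\<^sup>2 * integral {a..b} (\<lambda>x. (f x)\<^sup>2) + 2 * s * t * integral {a..b} (\<lambda>x. f x * g x)
      + t\<^sup>2 * integral {a..b} (\<lambda>x. (g x)\<^sup>2)"
proof -
  have i: "(\<lambda>x. (f x)\<^sup>2) integrable_on {a..b}" "(\<lambda>x. f x * g x) integrable_on {a..b}"
    "(\<lambda>x. (g x)\<^sup>2) integrable_on {a..b}"
    using assms by (auto intro!: integrable_continuous_real continuous_intros)
  have "((\<lambda>x. s\<^sup>2 * (f x)\<^sup>2 + 2 * s * t * (f x * g x) + t\<^sup>2 * (g x)\<^sup>2) has_integral
     s\<^sup>2 * integral {a..b} (\<lambda>x. (f x)\<^sup>2) + 2 * s * t * integral {a..b} (\<lambda>x. f x * g x)
      + t\<^sup>2 * integral {a..b} (\<lambda>x. (g x)\<^sup>2)) {a..b}"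
    by (intro has_integral_add has_integral_mult_right integrable_integral i)
  moreover have "(\<lambda>x. s\<^sup>2 * (f x)\<^sup>2 + 2 * s * t * (f x * g x) + t\<^sup>2 * (g x)\<^sup>2)
    = (\<lambda>x. (s * f x + t * g x)\<^sup>2)"
    by (auto simp: power2_eq_square algebra_simps)
  ultimately show ?thesis by (simp add: integral_unique)
qed

lemma integral_Cauchy_Schwarz:
  fixes f g :: "real \<Rightarrow> real"
  assumes "continuous_on {a..b} f" "continuous_on {a..b} g"
  shows "(integral {a..b} (\<lambda>x. f x * g x))\<^sup>2
    \<le> integral {a..b} (\<lambda>x. (f x)\<^sup>2) * integral {a..b} (\<lambda>x. (g x)\<^sup>2)"
proof -
  define P Q C where "P = integral {a..b} (\<lambda>x. (f x)\<^sup>2)" and "Q = integral {a..b} (\<lambda>x. (g x)\<^sup>2)"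
    and "C = integral {a..b} (\<lambda>x. f x * g x)"
  have nn: "s\<^sup>2 * P + 2 * s * t * C + t\<^sup>2 * Q \<ge> 0" for s t
    unfolding P_def Q_def C_def integral_power2_linear_combination[OF assms, symmetric]
    by (intro integral_nonneg integrable_continuous_real continuous_intros assms) auto
  have "P \<ge> 0" "Q \<ge> 0" using nn[of 1 0] nn[of 0 1] by auto
  have "C\<^sup>2 \<le> P * Q"
  proof (cases "Q = 0")
    case True
    have "C = 0"
    proof (rule ccontr)
      assume "C \<noteq> 0"
      \<comment> \<open>For Q = 0 the form is affine in t, and this t is the point where it takes
        the value -1.\<close>
      then have "1\<^sup>2 * P + 2 * 1 * (- (P + 1) / (2 * C)) * C + (- (P + 1) / (2 * C))\<^sup>2 * Q = -1"
        using True by (simp add: field_simps)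
      then show False using nn[of 1 "- (P + 1) / (2 * C)"] by simp
    qed
    then show ?thesis using True by simp
  next
    case False
    \<comment> \<open>The form evaluated at (Q, -C), its minimizing direction.\<close>
    have "Q * (P * Q - C\<^sup>2) \<ge> 0"
      using nn[of Q "-C"] by (simp add: power2_eq_square algebra_simps)
    then show ?thesis using False \<open>Q \<ge> 0\<close> by (simp add: zero_le_mult_iff)
  qed
  then show ?thesis unfolding P_def Q_def C_def .
qed

text \<open>Going from the zero of u to any other point, Cauchy-Schwarz bounds the square of u by L
  times the integral of the squared derivative. The constant is not sharp, but it serves only
  \<open>h - hs\<close>, where it affects the decay rate and no gain condition.\<close>

lemma Poincare_vanishing_somewhere:
  fixes u u' :: "real \<Rightarrow> real"
  assumes "L > 0" and der: "\<And>x. x \<in> {0..L} \<Longrightarrow> (u has_real_derivative u' x) (at x within {0..L})"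
    and cont: "continuous_on {0..L} u'" and "x0 \<in> {0..L}" "u x0 = 0"
  shows "integral {0..L} (\<lambda>x. (u x)\<^sup>2) \<le> L\<^sup>2 * integral {0..L} (\<lambda>x. (u' x)\<^sup>2)"
proof -
  let ?D = "integral {0..L} (\<lambda>x. (u' x)\<^sup>2)"
  have contu: "continuous_on {0..L} u"
    using der by (meson DERIV_continuous_on)
  have iu: "(\<lambda>x. (u' x)\<^sup>2) integrable_on {c..d}" if "c \<ge> 0" "d \<le> L" for c d
    using that by (intro integrable_continuous_real continuous_intros continuous_on_subset[OF cont]) auto
  have aux: "(u d - u c)\<^sup>2 \<le> L * ?D" if "0 \<le> c" "c \<le> d" "d \<le> L" for c d
  proof -
    have sub: "{c..d} \<subseteq> {0..L}" using that by auto
    have "(u' has_integral (u d - u c)) {c..d}"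
      using that sub der
      by (intro fundamental_theorem_of_calculus)
        (auto simp flip: has_real_derivative_iff_has_vector_derivative intro!: DERIV_subset[OF der])
    then have "u d - u c = integral {c..d} (\<lambda>x. u' x * 1)" by (simp add: integral_unique)
    also have "\<dots>\<^sup>2 \<le> integral {c..d} (\<lambda>x. (u' x)\<^sup>2) * integral {c..d} (\<lambda>x. 1\<^sup>2)"
      by (intro integral_Cauchy_Schwarz continuous_on_subset[OF cont sub] continuous_intros)
    also have "\<dots> \<le> ?D * L"
      using that by (intro mult_mono integral_subset_le iu integral_nonneg) auto
    finally show ?thesis by (simp add: mult.commute)
  qed
  have "(u x)\<^sup>2 \<le> L * ?D" if "x \<in> {0..L}" for x
    using aux[of x x0] aux[of x0 x] that assms(4,5) by (cases "x \<le> x0") auto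
  then have "integral {0..L} (\<lambda>x. (u x)\<^sup>2) \<le> integral {0..L} (\<lambda>x. L * ?D)"
    by (intro integral_le integrable_continuous_real continuous_intros contu) auto
  then show ?thesis using \<open>L > 0\<close> by (simp add: power2_eq_square mult.assoc)
qed

text \<open>A square is completed with the logarithmic derivative of a cosine, close to the first
  Dirichlet eigenfunction: \<open>(v' x + v x * \<omega> * tan (\<theta> x))\<^sup>2\<close> differs
  from \<open>(v' x)\<^sup>2 - \<omega>\<^sup>2 * (v x)\<^sup>2\<close> by the exact derivative
  \<open>\<psi>'\<close>, which integrates to 0 since v vanishes at both ends.\<close>

lemma Poincare_Dirichlet:
  fixes v v' :: "real \<Rightarrow> real"
  assumes "L > 0" and der: "\<And>x. x \<in> {0..L} \<Longrightarrow> (v has_real_derivative v' x) (at x within {0..L})"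
    and cont: "continuous_on {0..L} v'" and "v 0 = 0" "v L = 0"
  shows "pi\<^sup>2 * integral {0..L} (\<lambda>x. (v x)\<^sup>2) \<le> L\<^sup>2 * integral {0..L} (\<lambda>x. (v' x)\<^sup>2)"
proof -
  let ?I = "integral {0..L} (\<lambda>x. (v x)\<^sup>2)" and ?D = "integral {0..L} (\<lambda>x. (v' x)\<^sup>2)"
  have contv: "continuous_on {0..L} v"
    using der by (meson DERIV_continuous_on)
  have *: "\<omega>\<^sup>2 * ?I \<le> ?D" if \<omega>: "0 < \<omega>" "\<omega> < pi / L" for \<omega>
  proof -
    \<comment> \<open>Centring at L/2 and keeping \<omega> strictly below pi / L leaves the cosine
      positive on the closed interval, so the tangent has no pole. The limit \<omega> to pi / L is
      taken only in the final inequality.\<close>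
    define \<theta> where "\<theta> = (\<lambda>x. \<omega> * (x - L / 2))"
    have cosp: "cos (\<theta> x) > 0" if "x \<in> {0..L}" for x
    proof (rule cos_gt_zero_pi)
      have "\<omega> * L < pi" using \<omega> \<open>L > 0\<close> by (simp add: field_simps)
      moreover have "\<bar>\<theta> x\<bar> \<le> \<omega> * (L / 2)"
        unfolding \<theta>_def using that \<omega> by (auto simp: abs_mult intro!: mult_left_mono) (auto simp: abs_le_iff field_simps)
      ultimately show "- (pi / 2) < \<theta> x" "\<theta> x < pi / 2" by auto
    qed
    have conttan: "continuous_on {0..L} (\<lambda>x. tan (\<theta> x))"
      unfolding \<theta>_def using cosp unfolding \<theta>_def
      by (intro continuous_intros) (metis less_irrefl)
    define \<psi> where "\<psi> = (\<lambda>x. (v x)\<^sup>2 * \<omega> * tan (\<theta> x))"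
    define \<psi>' where "\<psi>' = (\<lambda>x. 2 * v x * v' x * \<omega> * tan (\<theta> x) + (v x)\<^sup>2 * \<omega>\<^sup>2 * (1 + (tan (\<theta> x))\<^sup>2))"
    have "(\<psi> has_real_derivative \<psi>' x) (at x within {0..L})" if "x \<in> {0..L}" for x
    proof -
      have "cos (\<theta> x) \<noteq> 0" using cosp[OF that] by simp
      then have "(1 + (tan (\<theta> x))\<^sup>2) = inverse ((cos (\<theta> x))\<^sup>2)"
        using tan_sec[of "\<theta> x"] by (simp add: power_inverse)
      then show ?thesis
        unfolding \<psi>_def \<psi>'_def using cosp[OF that] unfolding \<theta>_def
        by (auto intro!: derivative_eq_intros der that simp: power2_eq_square algebra_simps)
    qed
    then have "(\<psi>' has_integral (\<psi> L - \<psi> 0)) {0..L}"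
      using \<open>L > 0\<close>
      by (intro fundamental_theorem_of_calculus)
        (auto simp flip: has_real_derivative_iff_has_vector_derivative)
    then have "(\<psi>' has_integral 0) {0..L}" using assms(4,5) by (simp add: \<psi>_def)
    moreover have "((\<lambda>x. (v' x)\<^sup>2) has_integral ?D) {0..L}" "((\<lambda>x. \<omega>\<^sup>2 * (v x)\<^sup>2) has_integral \<omega>\<^sup>2 * ?I) {0..L}"
      by (intro has_integral_mult_right integrable_integral integrable_continuous_real
          continuous_intros cont contv)+
    ultimately have "((\<lambda>x. (v' x)\<^sup>2 + \<psi>' x - \<omega>\<^sup>2 * (v x)\<^sup>2) has_integral ?D + 0 - \<omega>\<^sup>2 * ?I) {0..L}"
      by (intro has_integral_add has_integral_diff)
    moreover have "(\<lambda>x. (v' x)\<^sup>2 + \<psi>' x - \<omega>\<^sup>2 * (v x)\<^sup>2) = (\<lambda>x. (v' x + v x * \<omega> * tan (\<theta> x))\<^sup>2)"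
      by (auto simp: \<psi>'_def power2_eq_square algebra_simps)
    ultimately have "((\<lambda>x. (v' x + v x * \<omega> * tan (\<theta> x))\<^sup>2) has_integral ?D + 0 - \<omega>\<^sup>2 * ?I) {0..L}"
      by simp
    from has_integral_nonneg[OF this] show ?thesis by simp
  qed
  have "((\<lambda>\<omega>. \<omega>\<^sup>2 * ?I) \<longlongrightarrow> (pi / L)\<^sup>2 * ?I) (at_left (pi / L))"
    by (intro tendsto_intros)
  moreover have "eventually (\<lambda>\<omega>. \<omega>\<^sup>2 * ?I \<le> ?D) (at_left (pi / L))"
    using eventually_at_left_real[of 0 "pi / L"] \<open>L > 0\<close> * by (auto elim!: eventually_mono)
  ultimately have "(pi / L)\<^sup>2 * ?I \<le> ?D"
    by (intro tendsto_upperbound[where F = "at_left (pi / L)"]) auto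
  then show ?thesis using \<open>L > 0\<close> by (simp add: power_divide field_simps)
qed

section \<open>Balance laws\<close>

lemma C0_rect_compose:
  assumes "C0_rect T X u" "continuous_on A a" "continuous_on A b"
    and "\<And>p. p \<in> A \<Longrightarrow> a p \<in> T" "\<And>p. p \<in> A \<Longrightarrow> b p \<in> X"
  shows "continuous_on A (\<lambda>p. u (a p) (b p))"
proof -
  have "continuous_on A ((\<lambda>p. u (fst p) (snd p)) \<circ> (\<lambda>p. (a p, b p)))"
    using assms
    by (intro continuous_on_compose continuous_on_Pair)
      (auto simp: C0_rect_def case_prod_unfold elim!: continuous_on_subset)
  then show ?thesis by (simp add: o_def)
qed

lemma C0_rect_slice_x: "C0_rect T X u \<Longrightarrow> t \<in> T \<Longrightarrow> X' \<subseteq> X \<Longrightarrow> continuous_on X' (u t)"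
  using C0_rect_compose[of T X u X' "\<lambda>x. t" "\<lambda>x. x"] by (auto simp: continuous_on_const continuous_on_id)

lemma C0_rect_slice_t: "C0_rect T X u \<Longrightarrow> x \<in> X \<Longrightarrow> T' \<subseteq> T \<Longrightarrow> continuous_on T' (\<lambda>t. u t x)"
  using C0_rect_compose[of T X u T' "\<lambda>t. t" "\<lambda>t. x"] by (auto simp: continuous_on_const continuous_on_id)

lemma C0_rect_subset: "C0_rect T X u \<Longrightarrow> T' \<subseteq> T \<Longrightarrow> X' \<subseteq> X \<Longrightarrow> C0_rect T' X' u"
  unfolding C0_rect_def by (erule continuous_on_subset) auto

lemma C0_rect_swap:
  assumes "C0_rect T X u" "T' \<subseteq> T" "X' \<subseteq> X"
  shows "continuous_on (X' \<times> T') (\<lambda>(x, t). u t x)"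
  unfolding case_prod_unfold
  by (rule C0_rect_compose[OF assms(1)]) (use assms(2,3) in \<open>auto intro!: continuous_intros\<close>)

lemma leibniz_rule_C0_rect:
  fixes u :: "real \<Rightarrow> real \<Rightarrow> real"
  assumes "open X" "convex X" "x \<in> X"
    and der: "\<And>t x. t \<in> {t1..t2} \<Longrightarrow> x \<in> X \<Longrightarrow> (u t has_real_derivative u' t x) (at x)"
    and "C0_rect {t1..t2} X u" "C0_rect {t1..t2} X u'"
  shows "((\<lambda>x. integral {t1..t2} (\<lambda>t. u t x)) has_real_derivative
    integral {t1..t2} (\<lambda>t. u' t x)) (at x)"
proof -
  have "((\<lambda>x. integral (cbox t1 t2) (\<lambda>t. u t x)) has_real_derivative
    integral (cbox t1 t2) (\<lambda>t. u' t x)) (at x within X)"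
  proof (rule leibniz_rule_field_derivative)
    show "continuous_on (X \<times> cbox t1 t2) (\<lambda>(x, t). u' t x)"
      using C0_rect_swap[OF assms(6) order_refl order_refl] by simp
  qed (use assms in \<open>auto intro!: has_field_derivative_at_within[OF der] integrable_continuous_real
      C0_rect_slice_t[OF assms(5)]\<close>)
  then show ?thesis using assms(1,3) by (simp add: at_within_open_NO_MATCH)
qed

text \<open>The flux \<open>B\<close> and the source \<open>S\<close> are continuous up to the boundary, whereas \<open>F\<^sub>t\<close> and
  \<open>B\<^sub>x\<close> need not be; hence the Leibniz rule does not apply directly. Instead the balance is
  integrated over \<open>[t\<^sub>1,t\<^sub>2] \<times> [0,x]\<close>: the resulting function \<open>H\<close> of \<open>x\<close> is continuous
  on \<open>[0,L]\<close> and has zero derivative inside.\<close>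

lemma balance_law_integrated:
  fixes F B S Ft :: "real \<Rightarrow> real \<Rightarrow> real"
  assumes "L > 0" "0 < t1" "t1 \<le> t2"
    and cF: "\<And>t. t > 0 \<Longrightarrow> continuous_on {0..L} (F t)"
    and cB: "C0_rect {0<..} {0..L} B"
    and cS: "C0_rect {0<..} {0..L} S"
    and cFt: "C0_rect {0<..} {0<..<L} Ft"
    and dF: "\<And>t x. t > 0 \<Longrightarrow> x \<in> {0<..<L} \<Longrightarrow> ((\<lambda>s. F s x) has_real_derivative Ft t x) (at t)"
    and dB: "\<And>t x. t > 0 \<Longrightarrow> x \<in> {0<..<L} \<Longrightarrow> (B t has_real_derivative S t x - Ft t x) (at x)"
  shows "integral {0..L} (F t2) - integral {0..L} (F t1)
    = integral {t1..t2} (\<lambda>t. integral {0..L} (S t) - (B t L - B t 0))"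
proof -
  have tpos: "t > 0" if "t \<in> {t1..t2}" for t using that assms(2) by auto
  have sub: "{t1..t2} \<subseteq> {0<..}" using assms(2) by auto
  define \<tau> where "\<tau> = (\<lambda>x. integral {t1..t2} (\<lambda>t. S t x))"
  have c\<tau>: "continuous_on {0..L} \<tau>"
    unfolding \<tau>_def using integral_continuous_on_param[of "{0..L}" t1 t2 "\<lambda>x t. S t x"] C0_rect_swap[OF cS sub order_refl]
    by (simp add: case_prod_unfold)
  define b where "b = (\<lambda>x. integral {t1..t2} (\<lambda>t. B t x))"
  have cb: "continuous_on {0..L} b"
    unfolding b_def using integral_continuous_on_param[of "{0..L}" t1 t2 "\<lambda>x t. B t x"] C0_rect_swap[OF cB sub order_refl]
    by (simp add: case_prod_unfold)
  define K where "K = (\<lambda>y. F t2 y - F t1 y - \<tau> y)"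
  have cK: "continuous_on {0..L} K"
    unfolding K_def using assms(2,3) by (intro continuous_intros cF c\<tau>) auto
  define H where "H = (\<lambda>x. integral {0..x} K + b x)"
  have "H L = H 0"
  proof (rule DERIV_isconst_end[OF \<open>L > 0\<close>])
    show "continuous_on {0..L} H"
      unfolding H_def by (intro continuous_intros cb indefinite_integral_continuous_1 integrable_continuous_real cK)
  next
    fix x assume x: "0 < x" "x < L"
    have at: "at x within {0..L} = at x" using x by (simp add: at_within_Icc_at)
    have d1: "((\<lambda>u. integral {0..u} K) has_real_derivative K x) (at x)"
      using integral_has_real_derivative[OF cK, of x] x at by simp
    \<comment> \<open>At interior points the integrand \<open>S - Ft\<close> is continuous on the
      compact time interval, so differentiation under the integral is legitimate here.\<close>
    have d2: "(b has_real_derivative integral {t1..t2} (\<lambda>t. S t x - Ft t x)) (at x)"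
    proof -
      have cS': "C0_rect {0<..} {0<..<L} (\<lambda>t x. S t x - Ft t x)"
        using cS cFt unfolding C0_rect_def case_prod_unfold
        by (intro continuous_intros) (auto elim: continuous_on_subset)
      show ?thesis
        unfolding b_def
        by (rule leibniz_rule_C0_rect[where X = "{0<..<L}"])
          (use assms(2) dB tpos x in \<open>auto intro!: C0_rect_subset[OF cS' sub] C0_rect_subset[OF cB sub]\<close>)
    qed
    have "(\<lambda>t. Ft t x) integrable_on {t1..t2}" "(\<lambda>t. S t x) integrable_on {t1..t2}"
      using x assms(2) by (auto intro!: integrable_continuous_real C0_rect_slice_t[OF cFt] C0_rect_slice_t[OF cS])
    then have "integral {t1..t2} (\<lambda>t. S t x - Ft t x) = \<tau> x - integral {t1..t2} (\<lambda>t. Ft t x)"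
      unfolding \<tau>_def by (simp add: Henstock_Kurzweil_Integration.integral_diff)
    moreover have "((\<lambda>t. Ft t x) has_integral F t2 x - F t1 x) {t1..t2}"
      using assms(3) dF tpos x
      by (intro fundamental_theorem_of_calculus)
        (auto simp flip: has_real_derivative_iff_has_vector_derivative intro: has_field_derivative_at_within)
    ultimately have "K x + integral {t1..t2} (\<lambda>t. S t x - Ft t x) = 0"
      by (simp add: K_def integral_unique)
    then show "(H has_real_derivative 0) (at x)"
      unfolding H_def using DERIV_add[OF d1 d2] by simp
  qed
  then have "integral {0..L} K + b L - b 0 = 0" by (simp add: H_def)
  moreover have "integral {0..L} K = integral {0..L} (F t2) - integral {0..L} (F t1) - integral {0..L} \<tau>"
    unfolding K_def using assms(2,3)
    by (simp add: Henstock_Kurzweil_Integration.integral_diff integrable_continuous_real cF c\<tau>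
        integrable_diff)
  moreover have "integral {0..L} \<tau> = integral {t1..t2} (\<lambda>t. integral {0..L} (S t))"
    unfolding \<tau>_def
    using integral_swap_continuous[of 0 t1 L t2 "\<lambda>x t. S t x"] C0_rect_swap[OF cS sub order_refl]
    by (simp add: cbox_Pair_eq)
  moreover have "integral {t1..t2} (\<lambda>t. integral {0..L} (S t) - (B t L - B t 0))
     = integral {t1..t2} (\<lambda>t. integral {0..L} (S t)) - (b L - b 0)"
  proof -
    have "continuous_on {t1..t2} (\<lambda>t. integral {0..L} (S t))"
      using integral_continuous_on_param[of "{t1..t2}" 0 L S] C0_rect_subset[OF cS sub order_refl]
      by (simp add: C0_rect_def)
    then show ?thesis unfolding b_def using \<open>L > 0\<close>
      by (simp add: Henstock_Kurzweil_Integration.integral_diff integrable_continuous_real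
          integrable_diff C0_rect_slice_t[OF cB _ sub])
  qed
  ultimately show ?thesis by linarith
qed

text \<open>The right-hand side of the integrated balance is continuous in time, so the fundamental
  theorem of calculus turns the identity back into a derivative. Starting the time interval at t/2
  keeps it away from 0, where no regularity is assumed.\<close>

lemma balance_law:
  fixes F B S Ft :: "real \<Rightarrow> real \<Rightarrow> real"
  assumes "L > 0" "t > 0"
    and cF: "\<And>t. t > 0 \<Longrightarrow> continuous_on {0..L} (F t)"
    and cB: "C0_rect {0<..} {0..L} B"
    and cS: "C0_rect {0<..} {0..L} S"
    and cFt: "C0_rect {0<..} {0<..<L} Ft"
    and dF: "\<And>t x. t > 0 \<Longrightarrow> x \<in> {0<..<L} \<Longrightarrow> ((\<lambda>s. F s x) has_real_derivative Ft t x) (at t)"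
    and dB: "\<And>t x. t > 0 \<Longrightarrow> x \<in> {0<..<L} \<Longrightarrow> (B t has_real_derivative S t x - Ft t x) (at x)"
  shows "((\<lambda>t. integral {0..L} (F t)) has_real_derivative
    integral {0..L} (S t) - (B t L - B t 0)) (at t)"
proof -
  let ?D = "\<lambda>t. integral {0..L} (S t) - (B t L - B t 0)"
  have cD: "continuous_on {0<..} ?D"
    using integral_continuous_on_param[of "{0<..}" 0 L S] cS \<open>L > 0\<close>
    by (intro continuous_intros C0_rect_slice_t[OF cB]) (auto simp: C0_rect_def)
  have "((\<lambda>u. integral {t/2..u} ?D) has_real_derivative ?D t) (at t within {t/2..2*t})"
    using \<open>t > 0\<close> by (intro integral_has_real_derivative continuous_on_subset[OF cD]) auto
  then have "((\<lambda>u. integral {0..L} (F (t/2)) + integral {t/2..u} ?D) has_real_derivative ?D t) (at t)"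
    using \<open>t > 0\<close> by (auto intro!: derivative_eq_intros simp: at_within_Icc_at)
  moreover have "integral {0..L} (F u) = integral {0..L} (F (t/2)) + integral {t/2..u} ?D"
    if "u \<in> {t/2<..}" for u
    using balance_law_integrated[OF \<open>L > 0\<close> _ _ cF cB cS cFt dF dB, of "t/2" u] \<open>t > 0\<close> that by auto
  ultimately show ?thesis
    using \<open>t > 0\<close>
    by (auto intro: has_field_derivative_transform_within_open[of _ _ _ "{t/2<..}"])
qed

text \<open>The mass equation yields the x-derivative of \<open>ht\<close>, whereas the energy
  requires the t-derivative of \<open>hx\<close>. Integrating \<open>utx\<close> in time and
  differentiating the result in x expresses \<open>ux\<close> as a time integral of a continuous
  function.\<close>

lemma mixed_partials:
  fixes u :: "real \<Rightarrow> real \<Rightarrow> real"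
  assumes ut: "\<And>t x. t > 0 \<Longrightarrow> x \<in> {a<..<b} \<Longrightarrow> ((\<lambda>s. u s x) has_real_derivative ut t x) (at t)"
    and ux: "\<And>t x. t > 0 \<Longrightarrow> x \<in> {a<..<b} \<Longrightarrow> (u t has_real_derivative ux t x) (at x)"
    and utx: "\<And>t x. t > 0 \<Longrightarrow> x \<in> {a<..<b} \<Longrightarrow> (ut t has_real_derivative utx t x) (at x)"
    and cut: "C0_rect {0<..} {a<..<b} ut" and cutx: "C0_rect {0<..} {a<..<b} utx"
    and "t > 0" "x \<in> {a<..<b}"
  shows "((\<lambda>s. ux s x) has_real_derivative utx t x) (at t)"
proof -
  have pos: "s > 0" if "s \<in> {t/2..r}" for s r using that \<open>t > 0\<close> by auto
  have eq: "ux r x = ux (t/2) x + integral {t/2..r} (\<lambda>s. utx s x)" if "r > t/2" for r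
  proof -
    have d1: "((\<lambda>y. integral {t/2..r} (\<lambda>s. ut s y)) has_real_derivative integral {t/2..r} (\<lambda>s. utx s x)) (at x)"
      by (rule leibniz_rule_C0_rect[where X = "{a<..<b}"])
        (use utx pos[of _ r] assms(7) in \<open>auto intro!: C0_rect_subset[OF cut] C0_rect_subset[OF cutx]\<close>)
    have "integral {t/2..r} (\<lambda>s. ut s y) = u r y - u (t/2) y" if "y \<in> {a<..<b}" for y
      by (rule integral_unique, rule fundamental_theorem_of_calculus)
        (use \<open>r > t/2\<close> that pos in \<open>auto simp flip: has_real_derivative_iff_has_vector_derivative intro!: has_field_derivative_at_within[OF ut]\<close>)
    then have "((\<lambda>y. u r y - u (t/2) y) has_real_derivative integral {t/2..r} (\<lambda>s. utx s x)) (at x)"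
      by (intro has_field_derivative_transform_within_open[OF d1, of "{a<..<b}"]) (use assms(7) in auto)
    moreover have "((\<lambda>y. u r y - u (t/2) y) has_real_derivative ux r x - ux (t/2) x) (at x)"
      using \<open>r > t/2\<close> \<open>t > 0\<close> assms(7) by (intro derivative_intros ux) auto
    ultimately show ?thesis using DERIV_unique by fastforce
  qed
  have "((\<lambda>r. integral {t/2..r} (\<lambda>s. utx s x)) has_real_derivative utx t x) (at t within {t/2..2*t})"
    using \<open>t > 0\<close> assms(7) by (intro integral_has_real_derivative C0_rect_slice_t[OF cutx]) auto
  then have "((\<lambda>r. ux (t/2) x + integral {t/2..r} (\<lambda>s. utx s x)) has_real_derivative utx t x) (at t)"
    using \<open>t > 0\<close> by (auto intro!: derivative_eq_intros simp: at_within_Icc_at)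
  then show ?thesis
    by (rule has_field_derivative_transform_within_open[of _ _ _ "{t/2<..}"]) (use \<open>t > 0\<close> eq in auto)
qed

section \<open>Weak derivatives of continuously differentiable functions\<close>

lemma in_L2_continuous: "continuous_on {0..L} u \<Longrightarrow> in_L2 L u"
  unfolding in_L2_def
  by (auto intro!: borel_measurable_integrable continuous_imp_integrable_real continuous_intros)

lemma LINT_continuous:
  fixes u :: "real \<Rightarrow> real"
  shows "continuous_on {a..b} u \<Longrightarrow> (LINT x|lebesgue_on {a..b}. u x) = integral {a..b} u"
  by (simp add: lebesgue_integral_eq_integral continuous_imp_integrable_real)

lemma test_fun_continuous:
  assumes "test_fun L \<phi>"
  shows "continuous_on A \<phi>" "continuous_on A (deriv \<phi>)" "(\<phi> has_real_derivative deriv \<phi> x) (at x)"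
proof -
  obtain \<phi>' where d: "\<And>x. (\<phi> has_real_derivative \<phi>' x) (at x)" and c: "continuous_on UNIV \<phi>'"
    using assms by (auto simp: test_fun_def C1_on_def)
  have "deriv \<phi> = \<phi>'" using d by (auto intro: DERIV_imp_deriv)
  then show "continuous_on A (deriv \<phi>)" "(\<phi> has_real_derivative deriv \<phi> x) (at x)"
    using c d by (auto elim: continuous_on_subset)
  show "continuous_on A \<phi>" using d by (meson DERIV_isCont continuous_at_imp_continuous_on)
qed

lemma classical_imp_weak_derivative:
  assumes "L > 0" and der: "\<And>x. x \<in> {0..L} \<Longrightarrow> (u has_real_derivative u' x) (at x within {0..L})"
    and cont: "continuous_on {0..L} u'"
  shows "has_weak_derivative L u u'"
  unfolding has_weak_derivative_def
proof (intro conjI allI impI)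
  show "in_L2 L u'" by (rule in_L2_continuous[OF cont])
next
  fix \<phi> assume \<phi>: "test_fun L \<phi>"
  have cu: "continuous_on {0..L} u" using der by (meson DERIV_continuous_on)
  obtain K where "compact K" "K \<subseteq> {0<..<L}" and K: "\<And>x. x \<notin> K \<Longrightarrow> \<phi> x = 0"
    using \<phi> by (auto simp: test_fun_def)
  then have "\<phi> 0 = 0" "\<phi> L = 0" by (metis greaterThanLessThan_iff less_irrefl subsetD)+
  moreover have "((\<lambda>x. u x * deriv \<phi> x + u' x * \<phi> x) has_integral u L * \<phi> L - u 0 * \<phi> 0) {0..L}"
  proof (rule fundamental_theorem_of_calculus)
    fix x assume "x \<in> {0..L}"
    then have "((\<lambda>x. u x * \<phi> x) has_real_derivative u x * deriv \<phi> x + u' x * \<phi> x) (at x within {0..L})"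
      by (auto intro!: derivative_eq_intros der has_field_derivative_at_within[OF test_fun_continuous(3)[OF \<phi>]])
    then show "((\<lambda>x. u x * \<phi> x) has_vector_derivative u x * deriv \<phi> x + u' x * \<phi> x) (at x within {0..L})"
      by (simp add: has_real_derivative_iff_has_vector_derivative)
  qed (use \<open>L > 0\<close> in simp)
  moreover have "(\<lambda>x. u x * deriv \<phi> x) integrable_on {0..L}" "(\<lambda>x. u' x * \<phi> x) integrable_on {0..L}"
    by (intro integrable_continuous_real continuous_intros cu cont test_fun_continuous[OF \<phi>])+
  ultimately have "integral {0..L} (\<lambda>x. u x * deriv \<phi> x) + integral {0..L} (\<lambda>x. u' x * \<phi> x) = 0"
    by (simp add: integral_unique Henstock_Kurzweil_Integration.integral_add[symmetric])
  then show "(LINT x|lebesgue_on {0..L}. u x * deriv \<phi> x) = - (LINT x|lebesgue_on {0..L}. u' x * \<phi> x)"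
    by (simp add: LINT_continuous cu cont test_fun_continuous[OF \<phi>] continuous_intros)
qed

text \<open>With \<open>p x = (max 0 ((x - a) * (b - x)))\<^sup>2\<close> the functions \<open>n p / (1 + n p)\<close> are
  continuously differentiable and increase to the indicator of \<open>(a,b)\<close>.\<close>

lemma integral_inner_interval_eq_0:
  fixes d :: "real \<Rightarrow> real"
  assumes "integrable (lebesgue_on {0..L}) d"
    and test: "\<And>\<phi>. test_fun L \<phi> \<Longrightarrow> (LINT x|lebesgue_on {0..L}. d x * \<phi> x) = 0"
    and ab: "0 < a" "a \<le> b" "b < L"
  shows "integral {a..b} d = 0"
proof -
  define s s' where "s = (\<lambda>y::real. (max 0 y)\<^sup>2)" and "s' = (\<lambda>y::real. 2 * max 0 y)"
  have ds: "(s has_real_derivative s' y) (at y)" for y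
  proof (cases y "0::real" rule: linorder_cases)
    case less
    have "((\<lambda>y. 0) has_real_derivative s' y) (at y)" using less by (simp add: s'_def)
    then show ?thesis
      by (rule has_field_derivative_transform_within_open[of _ _ _ "{..<0}"]) (use less in \<open>auto simp: s_def\<close>)
  next
    case greater
    have "((\<lambda>y. y\<^sup>2) has_real_derivative s' y) (at y)"
      using greater by (auto simp: s'_def intro!: derivative_eq_intros)
    then show ?thesis
      by (rule has_field_derivative_transform_within_open[of _ _ _ "{0<..}"]) (use greater in \<open>auto simp: s_def\<close>)
  next
    case equal
    have "(\<lambda>h::real. (s (0 + h) - s 0) / h) \<midarrow>0\<rightarrow> 0"
    proof (rule tendsto_sandwich[of "\<lambda>h. - \<bar>h\<bar>" _ _ "\<lambda>h. \<bar>h\<bar>"])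
      show "\<forall>\<^sub>F h in at 0. - \<bar>h\<bar> \<le> (s (0 + h) - s 0) / h" "\<forall>\<^sub>F h in at 0. (s (0 + h) - s 0) / h \<le> \<bar>h\<bar>"
        by (auto simp: s_def max_def power2_eq_square)
    qed (auto intro!: tendsto_eq_intros)
    then show ?thesis using equal by (simp add: DERIV_def s'_def)
  qed
  have cs: "continuous_on A s" "continuous_on A s'" for A
    unfolding s_def s'_def by (intro continuous_intros)+
  define \<phi> where "\<phi> = (\<lambda>(n::nat) x. n * s ((x - a) * (b - x)) / (1 + n * s ((x - a) * (b - x))))"
  have pos: "1 + real n * s y > 0" for n y by (simp add: s_def add_pos_nonneg)
  have "test_fun L (\<phi> n)" for n
    unfolding test_fun_def
  proof (intro conjI exI[of _ "{a..b}"])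
    define \<phi>' where "\<phi>' = (\<lambda>x. n * s' ((x - a) * (b - x)) * ((b - x) - (x - a)) / (1 + n * s ((x - a) * (b - x)))\<^sup>2)"
    have "(\<phi> n has_real_derivative \<phi>' x) (at x)" for x
    proof -
      have ne: "1 + real n * s ((x - a) * (b - x)) \<noteq> 0"
        using pos[of n "(x - a) * (b - x)"] by linarith
      show ?thesis
        unfolding \<phi>_def \<phi>'_def using ne
        by (auto intro!: derivative_eq_intros DERIV_chain'[OF _ ds] simp: field_simps power2_eq_square)
    qed
    moreover have "continuous_on UNIV \<phi>'"
      unfolding \<phi>'_def using pos
      by (intro continuous_intros continuous_on_compose2[OF cs(1)[of UNIV]] continuous_on_compose2[OF cs(2)[of UNIV]])
        (auto simp: less_imp_neq[THEN not_sym])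
    ultimately show "C1_on UNIV (\<phi> n)" unfolding C1_on_def by auto
    show "\<forall>x. x \<notin> {a..b} \<longrightarrow> \<phi> n x = 0"
      using ab(2) by (auto simp: \<phi>_def s_def max_def mult_less_0_iff not_le zero_le_mult_iff)
  qed (use ab in auto)
  then have z: "(LINT x|lebesgue_on {0..L}. d x * \<phi> n x) = 0" for n by (rule test)
  have "(\<lambda>n. LINT x|lebesgue_on {0..L}. d x * \<phi> n x) \<longlonglongrightarrow> (LINT x|lebesgue_on {0..L}. d x * indicat_real {a<..<b} x)"
  proof (rule integral_dominated_convergence[where w = "\<lambda>x. \<bar>d x\<bar>"])
    have dm: "d \<in> borel_measurable (lebesgue_on {0..L})" using assms(1) by auto
    have "\<phi> n \<in> borel_measurable (lebesgue_on {0..L})" for n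
      using test_fun_continuous(1)[OF \<open>test_fun L (\<phi> n)\<close>]
      by (intro borel_measurable_integrable continuous_imp_integrable_real)
    then show "(\<lambda>x. d x * \<phi> i x) \<in> borel_measurable (lebesgue_on {0..L})" for i
      using dm by (intro borel_measurable_times)
    have "indicat_real {a<..<b} \<in> borel_measurable (lebesgue_on {0..L})"
      using ab by (intro borel_measurable_indicator) (auto simp: sets_restrict_space_iff)
    then show "(\<lambda>x. d x * indicat_real {a<..<b} x) \<in> borel_measurable (lebesgue_on {0..L})"
      using dm by (intro borel_measurable_times)
    show "integrable (lebesgue_on {0..L}) (\<lambda>x. \<bar>d x\<bar>)" using assms(1) by simp
    have "(\<lambda>n. \<phi> n x) \<longlonglongrightarrow> indicat_real {a<..<b} x" for x
    proof (cases "x \<in> {a<..<b}")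
      case True
      define p where "p = s ((x - a) * (b - x))"
      have "p > 0" using True by (simp add: p_def s_def)
      then have "(\<lambda>n. real n * p / (1 + real n * p)) \<longlonglongrightarrow> 1"
        by real_asymp
      then show ?thesis using True by (simp add: \<phi>_def p_def)
    next
      case False
      then have "s ((x - a) * (b - x)) = 0"
        using ab(2) by (auto simp: s_def max_def zero_le_mult_iff not_less)
      then show ?thesis using False by (simp add: \<phi>_def)
    qed
    then show "AE x in lebesgue_on {0..L}. (\<lambda>i. d x * \<phi> i x) \<longlonglongrightarrow> d x * indicat_real {a<..<b} x"
      by (auto intro!: tendsto_intros)
    have "\<bar>\<phi> n x\<bar> \<le> 1" for n x
    proof -
      have "s ((x - a) * (b - x)) \<ge> 0" by (simp add: s_def)
      then show ?thesis using pos[of n "(x - a) * (b - x)"]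
        unfolding \<phi>_def by (simp add: abs_divide)
    qed
    then show "AE x in lebesgue_on {0..L}. norm (d x * \<phi> i x) \<le> \<bar>d x\<bar>" for i
      by (auto simp: abs_mult intro!: mult_right_le_one_le)
  qed
  then have "(LINT x|lebesgue_on {0..L}. d x * indicat_real {a<..<b} x) = 0"
    by (simp add: z LIMSEQ_const_iff)
  moreover have "integrable (lebesgue_on {0..L}) (\<lambda>x. d x * indicat_real {a<..<b} x)"
    using ab assms(1)
    by (intro integrable_real_mult_indicator) (auto simp: sets_restrict_space_iff)
  ultimately have "integral {0..L} (\<lambda>x. d x * indicat_real {a<..<b} x) = 0"
    by (simp add: lebesgue_integral_eq_integral)
  also have "(\<lambda>x. d x * indicat_real {a<..<b} x) = (\<lambda>x. if x \<in> {a<..<b} then d x else 0)"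
    by (auto simp: indicator_def)
  also have "integral {0..L} \<dots> = integral ({0..L} \<inter> {a<..<b}) d"
    using integral_restrict_Int[of "{0..L}" "{a<..<b}" d] by (simp add: Int_commute)
  also have "{0..L} \<inter> {a<..<b} = {a<..<b}" using ab by auto
  also have "integral {a<..<b} d = integral {a..b} d"
    using integral_open_interval[of a b d] by simp
  finally show ?thesis .
qed

text \<open>The fundamental lemma of the calculus of variations. All averages of d over small inner
  intervals vanish, and by Lebesgue differentiation they converge to d almost everywhere.\<close>

lemma AE_eq_0_if_test_fun_integrals_eq_0:
  fixes d :: "real \<Rightarrow> real"
  assumes int: "integrable (lebesgue_on {0..L}) d"
    and test: "\<And>\<phi>. test_fun L \<phi> \<Longrightarrow> (LINT x|lebesgue_on {0..L}. d x * \<phi> x) = 0"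
  shows "AE x in lebesgue_on {0..L}. d x = 0"
proof -
  \<comment> \<open>Extension by 0, because the differentiation theorem is applied to a function on
    the whole line.\<close>
  define f where "f = (\<lambda>x. if x \<in> {0..L} then d x else 0)"
  have "(d has_integral (LINT x|lebesgue_on {0..L}. d x)) {0..L}"
    using int by (intro has_integral_integral_lebesgue_on) auto
  then have "(f has_integral (LINT x|lebesgue_on {0..L}. d x)) UNIV"
    unfolding f_def by (subst has_integral_restrict_UNIV)
  then have "f integrable_on cbox a b" for a b
    by (meson has_integral_iff integrable_on_subcbox subset_UNIV)
  then obtain N where N: "negligible N"
    and lim: "\<And>x e. \<lbrakk>x \<notin> N; 0 < e\<rbrakk> \<Longrightarrow>
      \<exists>\<delta>>0. \<forall>h. 0 < h \<and> h < \<delta> \<longrightarrow> norm (integral (cbox x (x + h *\<^sub>R One)) f /\<^sub>R h ^ DIM(real) - f x) < e"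
    using integrable_ccontinuous_explicit[of f] by metis
  have f0: "d x = 0" if x: "x \<notin> N" "0 < x" "x < L" for x
  proof (rule ccontr)
    assume "d x \<noteq> 0"
    then obtain \<delta> where "\<delta> > 0" and \<delta>': "\<And>h. 0 < h \<Longrightarrow> h < \<delta> \<Longrightarrow>
        norm (integral (cbox x (x + h *\<^sub>R One)) f /\<^sub>R h ^ DIM(real) - f x) < \<bar>d x\<bar>"
      using lim[OF x(1), of "\<bar>d x\<bar>"] by auto
    then have \<delta>: "\<bar>integral {x..x + h} f / h - d x\<bar> < \<bar>d x\<bar>" if "0 < h" "h < \<delta>" for h
      using \<delta>'[OF that] \<open>0 < x\<close> \<open>x < L\<close> by (simp add: f_def divide_inverse mult.commute)
    define h where "h = min (\<delta> / 2) ((L - x) / 2)"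
    have h: "0 < h" "h < \<delta>" "x + h < L" using \<open>\<delta> > 0\<close> that by (auto simp: h_def min_def field_simps)
    have "integral {x..x + h} f = integral {x..x + h} d"
      using h that by (intro integral_cong) (auto simp: f_def)
    also have "\<dots> = 0"
      using h that by (intro integral_inner_interval_eq_0[OF int test]) auto
    finally show False using \<delta>[of h] h by simp
  qed
  have "negligible (N \<union> {0, L})" using N by auto
  then have "AE x in lebesgue. x \<notin> N \<union> {0, L}"
    unfolding negligible_iff_null_sets by (rule AE_not_in)
  then show ?thesis
    by (subst AE_restrict_space_iff) (simp, erule eventually_mono, use f0 in force)
qed

text \<open>The chosen weak derivative and the classical one give the same integral against every
  test function, so the fundamental lemma applies to their difference. This permits replacing one by
  the other under integrals.\<close>

lemma weak_deriv_classical: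
  assumes "L > 0" and der: "\<And>x. x \<in> {0..L} \<Longrightarrow> (u has_real_derivative u' x) (at x within {0..L})"
    and cont: "continuous_on {0..L} u'"
  shows "weak_deriv L u \<in> borel_measurable (lebesgue_on {0..L})"
    and "AE x in lebesgue_on {0..L}. weak_deriv L u x = u' x"
proof -
  have "has_weak_derivative L u (weak_deriv L u)"
    unfolding weak_deriv_def by (rule someI[of "has_weak_derivative L u" u']) (rule classical_imp_weak_derivative[OF assms])
  note w = this classical_imp_weak_derivative[OF assms]
  show m: "weak_deriv L u \<in> borel_measurable (lebesgue_on {0..L})"
    using w(1) by (simp add: has_weak_derivative_def in_L2_def)
  have fin: "integrable (lebesgue_on {0..L}) (\<lambda>x. c)" for c :: real
    by (intro continuous_imp_integrable_real continuous_intros)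
  \<comment> \<open>Square integrability implies integrability on a bounded interval, by
    \<bar>y\<bar> \<le> 1 + y^2.\<close>
  have int: "integrable (lebesgue_on {0..L}) y" if "in_L2 L y" for y
  proof (rule Bochner_Integration.integrable_bound[of _ "\<lambda>x. 1 + (y x)\<^sup>2"])
    show "AE x in lebesgue_on {0..L}. norm (y x) \<le> norm (1 + (y x)\<^sup>2)"
    proof (intro AE_I2)
      fix x show "norm (y x) \<le> norm (1 + (y x)\<^sup>2)"
        using zero_le_power2[of "y x - 1"] zero_le_power2[of "y x + 1"]
        by (simp add: power2_eq_square algebra_simps abs_le_iff)
    qed
  qed (use that fin[of 1] in \<open>auto simp: in_L2_def\<close>)
  have iw: "integrable (lebesgue_on {0..L}) (weak_deriv L u)" "integrable (lebesgue_on {0..L}) u'"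
    using w int by (auto simp: has_weak_derivative_def)
  have "AE x in lebesgue_on {0..L}. weak_deriv L u x - u' x = 0"
  proof (rule AE_eq_0_if_test_fun_integrals_eq_0)
    show "integrable (lebesgue_on {0..L}) (\<lambda>x. weak_deriv L u x - u' x)" using iw by auto
  next
    fix \<phi> assume \<phi>: "test_fun L \<phi>"
    have "bounded (\<phi> ` {0..L})"
      by (intro compact_imp_bounded compact_continuous_image test_fun_continuous(1)[OF \<phi>]) auto
    then obtain C where C: "\<And>x. x \<in> {0..L} \<Longrightarrow> \<bar>\<phi> x\<bar> \<le> C" by (fastforce simp: bounded_iff)
    have \<phi>m: "\<phi> \<in> borel_measurable (lebesgue_on {0..L})"
      by (intro borel_measurable_integrable continuous_imp_integrable_real test_fun_continuous(1)[OF \<phi>])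
    have i: "integrable (lebesgue_on {0..L}) (\<lambda>x. y x * \<phi> x)" if "integrable (lebesgue_on {0..L}) y" for y
    proof (rule Bochner_Integration.integrable_bound[of _ "\<lambda>x. C * y x"])
      show "integrable (lebesgue_on {0..L}) (\<lambda>x. C * y x)" using that by simp
      show "(\<lambda>x. y x * \<phi> x) \<in> borel_measurable (lebesgue_on {0..L})"
        using that \<phi>m by (intro borel_measurable_times) auto
      show "AE x in lebesgue_on {0..L}. norm (y x * \<phi> x) \<le> norm (C * y x)"
      proof (intro AE_I2)
        fix x assume "x \<in> space (lebesgue_on {0..L})"
        then have "\<bar>\<phi> x\<bar> \<le> \<bar>C\<bar>" using C by fastforce
        then show "norm (y x * \<phi> x) \<le> norm (C * y x)"
          by (simp add: abs_mult mult.commute mult_right_mono)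
      qed
    qed
    have "(LINT x|lebesgue_on {0..L}. (weak_deriv L u x - u' x) * \<phi> x)
      = (LINT x|lebesgue_on {0..L}. weak_deriv L u x * \<phi> x) - (LINT x|lebesgue_on {0..L}. u' x * \<phi> x)"
      using i[OF iw(1)] i[OF iw(2)] by (simp add: left_diff_distrib)
    also have "\<dots> = 0" using w \<phi> unfolding has_weak_derivative_def by force
    finally show "(LINT x|lebesgue_on {0..L}. (weak_deriv L u x - u' x) * \<phi> x) = 0" .
  qed
  then show "AE x in lebesgue_on {0..L}. weak_deriv L u x = u' x" by simp
qed

section \<open>The function G\<close>

text \<open>\<open>G_fun\<close> without its sign factor: the antiderivative of
  \<open>(h - hs) / sqrt h\<close> that vanishes at \<open>hs\<close>. It has the same absolute
  value as \<open>G_fun\<close>, and the chain rule for it needs no case distinction at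
  \<open>h = hs\<close>.\<close>

definition P_fun :: "real \<Rightarrow> real \<Rightarrow> real" where
  "P_fun hs h = 2 / 3 * (h * sqrt h - 3 * hs * sqrt h + 2 * hs * sqrt hs)"

lemma G_fun_eq: "G_fun hs h = sgn (h - hs) * P_fun hs h"
  by (simp add: G_fun_def P_fun_def)

lemma P_fun_self [simp]: "P_fun hs hs = 0"
  by (simp add: P_fun_def)

lemma abs_G_fun: "\<bar>G_fun hs h\<bar> = \<bar>P_fun hs h\<bar>"
  by (cases "h = hs") (auto simp: G_fun_eq abs_mult abs_sgn_eq)

lemma DERIV_P_fun: "h > 0 \<Longrightarrow> (P_fun hs has_real_derivative (h - hs) / sqrt h) (at h)"
proof -
  assume "h > 0"
  then have "sqrt h * (sqrt h * y) = h * y" for y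
    by (simp flip: mult.assoc)
  then show ?thesis
    using \<open>h > 0\<close> unfolding P_fun_def[abs_def]
    by (auto intro!: derivative_eq_intros simp: divide_simps)
qed

lemma continuous_on_P_fun: "continuous_on A (P_fun hs)"
  unfolding P_fun_def[abs_def] by (intro continuous_intros)

text \<open>\<open>P_fun\<close> decreases below \<open>hs\<close> and increases above it; the sign
  factor reflects the lower branch.\<close>

lemma G_fun_strict_mono:
  assumes "0 < x" "x < y" "hs > 0"
  shows "G_fun hs x < G_fun hs y"
proof -
  have above: "P_fun hs x < P_fun hs y" if "hs \<le> x" "x < y" for x y
  proof (rule DERIV_pos_imp_increasing_open[OF that(2)])
    fix z assume "x < z" "z < y"
    then show "\<exists>d. (P_fun hs has_real_derivative d) (at z) \<and> d > 0"
      using that \<open>hs > 0\<close> by (intro exI[of _ "(z - hs) / sqrt z"]) (auto intro!: DERIV_P_fun)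
  qed (rule continuous_on_P_fun)
  have below: "P_fun hs x > P_fun hs y" if "0 < x" "x < y" "y \<le> hs" for x y
  proof (rule DERIV_neg_imp_decreasing_open[OF that(2)])
    fix z assume "x < z" "z < y"
    then show "\<exists>d. (P_fun hs has_real_derivative d) (at z) \<and> d < 0"
      using that by (intro exI[of _ "(z - hs) / sqrt z"]) (auto intro!: DERIV_P_fun simp: divide_neg_pos)
  qed (rule continuous_on_P_fun)
  have pos: "G_fun hs z > 0" if "z > hs" for z
    using above[OF order_refl that] that by (simp add: G_fun_eq)
  have neg: "G_fun hs z < 0" if "z < hs" "0 < z" for z
    using below[OF that(2,1) order_refl] that by (simp add: G_fun_eq)
  consider "hs \<le> x" | "y \<le> hs" | "x < hs" "hs < y" by linarith
  then show ?thesis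
  proof cases
    case 1
    then show ?thesis
      using above[of x y] assms pos[of y] by (cases "x = hs") (auto simp: G_fun_eq)
  next
    case 2
    then show ?thesis
      using below[of x y] assms neg[of x] by (cases "y = hs") (auto simp: G_fun_eq)
  next
    case 3
    then show ?thesis using pos[of y] neg[of x] assms by linarith
  qed
qed

lemma G_fun_surj:
  assumes "hs > 0" "y > - (4 / 3 * hs * sqrt hs)"
  obtains h where "h > 0" "G_fun hs h = y"
proof (cases y "0::real" rule: linorder_cases)
  case equal
  then show ?thesis using that[of hs] assms by (simp add: G_fun_eq)
next
  case less
  \<comment> \<open>At the left end \<open>P_fun hs 0\<close> equals
    \<open>4 / 3 * hs * sqrt hs\<close>; the strict bound on y then excludes the solution h =
    0.\<close>
  have "\<exists>h\<ge>0. h \<le> hs \<and> P_fun hs h = - y"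
    by (rule IVT2') (use assms less in \<open>auto simp: continuous_on_P_fun\<close>, simp add: P_fun_def)
  then obtain h where h: "0 \<le> h" "h \<le> hs" "P_fun hs h = - y" by auto
  moreover have "h \<noteq> 0" using h(3) assms(2) by (auto simp: P_fun_def)
  moreover have "h \<noteq> hs" using h(3) less by auto
  ultimately show ?thesis using that[of h] by (simp add: G_fun_eq)
next
  case greater
  \<comment> \<open>Chosen so that \<open>b - 3 * hs\<close> is \<open>1 + 3 / 2 * y\<close> and
    \<open>sqrt b\<close> is at least 1, which makes \<open>P_fun hs b\<close> exceed y.\<close>
  define b where "b = 3 * hs + 1 + 3 / 2 * y"
  have "b \<ge> 1" using assms greater by (simp add: b_def)
  have "1 + 3 / 2 * y \<le> (b - 3 * hs) * sqrt b"
    using mult_left_mono[of 1 "sqrt b" "1 + 3 / 2 * y"] \<open>b \<ge> 1\<close> greater by (simp add: b_def)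
  then have "y \<le> P_fun hs b"
    using mult_nonneg_nonneg[of hs "sqrt hs"] assms(1) by (simp add: P_fun_def algebra_simps del: mult_nonneg_nonneg zero_le_mult_iff)
  have "\<exists>h\<ge>hs. h \<le> b \<and> P_fun hs h = y"
    by (rule IVT') (use assms greater \<open>y \<le> P_fun hs b\<close> in \<open>auto simp: continuous_on_P_fun b_def\<close>)
  then obtain h where h: "hs \<le> h" "P_fun hs h = y" by auto
  moreover have "h \<noteq> hs" using h(2) greater by auto
  ultimately show ?thesis using that[of h] assms(1) by (simp add: G_fun_eq)
qed

lemma G_inv:
  assumes "hs > 0" "y > - (4 / 3 * hs * sqrt hs)"
  shows "G_inv hs y > 0" "G_fun hs (G_inv hs y) = y"
proof -
  obtain h where h: "h > 0" "G_fun hs h = y" using G_fun_surj[OF assms] .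
  have "inj_on (G_fun hs) {0<..}"
    by (rule linorder_inj_onI) (use G_fun_strict_mono assms(1) in \<open>fastforce+\<close>)
  then have "G_inv hs y = h"
    unfolding G_inv_def by (rule the_inv_into_f_eq) (use h in auto)
  then show "G_inv hs y > 0" "G_fun hs (G_inv hs y) = y" using h by auto
qed

text \<open>Strict monotonicity of \<open>G\<close> lets the level \<open>a\<close> be raised a little, without any
  appeal to continuity of \<open>G_inv\<close>.\<close>

lemma G_inv_relax:
  assumes "hs > 0" "0 \<le> a" "a < 4 / 3 * hs * sqrt hs" "G_inv hs (- a) / G_inv hs a > D"
  obtains lo hi a' where "0 < lo" "lo \<le> hi" "a < a'" "lo / hi > D"
    "\<And>h. h > 0 \<Longrightarrow> \<bar>G_fun hs h\<bar> \<le> a' \<Longrightarrow> lo \<le> h \<and> h \<le> hi"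
proof -
  define x y where "x = G_inv hs (- a)" and "y = G_inv hs a"
  have "a > - (4 / 3 * hs * sqrt hs)" using assms by linarith
  then have xy: "x > 0" "G_fun hs x = - a" "y > 0" "G_fun hs y = a"
    using G_inv[OF assms(1)] assms(3) by (auto simp: x_def y_def)
  have "x \<le> y"
    using G_fun_strict_mono[OF xy(3) _ assms(1), of x] xy(2,4) assms(2) by (cases "x \<le> y") auto
  \<comment> \<open>The bounds themselves are widened by s; for small s the quotient still exceeds D
    because it depends continuously on s.\<close>
  have "((\<lambda>s. (x - s) / (y + s)) \<longlongrightarrow> (x - 0) / (y + 0)) (at_right 0)"
    using xy by (intro tendsto_intros) auto
  then have "\<forall>\<^sub>F s in at_right 0. (x - s) / (y + s) > D"
    by (rule order_tendstoD) (use assms(4) in \<open>simp add: x_def y_def\<close>)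
  moreover have "\<forall>\<^sub>F s in at_right 0. s \<in> {0<..<x}"
    using xy(1) by (rule eventually_at_right_real)
  ultimately have "\<forall>\<^sub>F s in at_right 0. (x - s) / (y + s) > D \<and> s \<in> {0<..<x}"
    by (rule eventually_conj)
  then obtain s where s: "(x - s) / (y + s) > D" "0 < s" "s < x"
    using eventually_happens'[of "at_right (0::real)"] by force
  \<comment> \<open>The largest level whose sublevel set of \<bar>G\<bar> stays between the widened
    bounds.\<close>
  define a' where "a' = min (- G_fun hs (x - s)) (G_fun hs (y + s))"
  have "a < - G_fun hs (x - s)" "a < G_fun hs (y + s)"
    using G_fun_strict_mono[of "x - s" x hs] G_fun_strict_mono[of y "y + s" hs] s xy assms(1) by auto
  then have "a < a'" by (simp add: a'_def)
  show ?thesis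
  proof (rule that[of "x - s" "y + s" a'])
    fix h :: real assume h: "h > 0" "\<bar>G_fun hs h\<bar> \<le> a'"
    have "\<not> h < x - s"
      using G_fun_strict_mono[of h "x - s" hs] h assms(1) by (auto simp: a'_def)
    moreover have "\<not> y + s < h"
      using G_fun_strict_mono[of "y + s" h hs] h assms(1) s xy by (auto simp: a'_def)
    ultimately show "x - s \<le> h \<and> h \<le> y + s" by linarith
  qed (use s \<open>a < a'\<close> \<open>x \<le> y\<close> in auto)
qed

section \<open>Lyapunov decay\<close>

text \<open>The differential inequality is available only where \<Phi> \<le> r', so boundedness must
  come first. Up to the first time at which a value c between r and r' is reached, \<Phi> is
  nonincreasing, hence it cannot have climbed from at most r to c. Afterwards
  \<open>exp (k * u) * \<Phi> u\<close> is nonincreasing for all times.\<close>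

lemma exponential_decay_below_level:
  fixes \<Phi> \<Phi>' :: "real \<Rightarrow> real"
  assumes cont: "continuous_on {0..} \<Phi>"
    and der: "\<And>t. t > 0 \<Longrightarrow> (\<Phi> has_real_derivative \<Phi>' t) (at t)"
    and nonneg: "\<And>t. t \<ge> 0 \<Longrightarrow> \<Phi> t \<ge> 0"
    and "\<Phi> 0 \<le> r" "r < r'" "k > 0"
    and decr: "\<And>t. t > 0 \<Longrightarrow> \<Phi> t \<le> r' \<Longrightarrow> \<Phi>' t \<le> - k * \<Phi> t"
    and "t \<ge> 0"
  shows "\<Phi> t \<le> r" "\<Phi> t \<le> exp (- k * t) * \<Phi> 0"
proof -
  have cont': "continuous_on {0..s} \<Phi>" for s
    by (rule continuous_on_subset[OF cont]) auto
  have le: "\<Phi> t \<le> r" if "t \<ge> 0" for t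
  proof (rule ccontr)
    assume "\<not> \<Phi> t \<le> r"
    then have "r < \<Phi> t" by simp
    \<comment> \<open>Capped by r' so that the decay hypothesis covers all values up to c, and by
      \<Phi> t so that c is attained before t.\<close>
    define c where "c = min r' (\<Phi> t)"
    have c: "r < c" "c \<le> r'" "c \<le> \<Phi> t" using \<open>r < \<Phi> t\<close> \<open>r < r'\<close> by (auto simp: c_def)
    define T where "T = {0..t} \<inter> \<Phi> -` {c}"
    have "compact T"
      unfolding T_def compact_eq_bounded_closed
      by (auto intro: continuous_closed_preimage[OF cont'] bounded_subset[OF bounded_closed_interval[of 0 t]])
    moreover obtain s where "0 \<le> s" "s \<le> t" "\<Phi> s = c"
      using IVT'[of \<Phi> 0 c t] cont' \<open>t \<ge> 0\<close> c \<open>\<Phi> 0 \<le> r\<close> by force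
    then have "T \<noteq> {}" by (auto simp: T_def)
    \<comment> \<open>The first hitting time of c; it exists because the level set in [0,t] is
      compact and nonempty.\<close>
    ultimately obtain s where s: "s \<in> T" "\<And>u. u \<in> T \<Longrightarrow> s \<le> u"
      using compact_attains_inf by metis
    have s': "0 \<le> s" "s \<le> t" "\<Phi> s = c" using s by (auto simp: T_def)
    have below: "\<Phi> u \<le> c" if u: "0 \<le> u" "u \<le> s" for u
    proof (rule ccontr)
      assume "\<not> \<Phi> u \<le> c"
      then obtain z where "0 \<le> z" "z \<le> u" "\<Phi> z = c"
        using IVT'[of \<Phi> 0 c u] cont' c \<open>\<Phi> 0 \<le> r\<close> u by force
      then have "z \<in> T" using u s' by (auto simp: T_def)
      then have "u = s" using s(2)[of z] \<open>z \<le> u\<close> u by simp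
      then show False using s'(3) \<open>\<not> \<Phi> u \<le> c\<close> by simp
    qed
    have "\<Phi> 0 \<ge> \<Phi> s"
    proof (rule DERIV_nonpos_imp_decreasing_open[OF s'(1) _ cont'])
      fix u assume u: "0 < u" "u < s"
      then have "\<Phi>' u \<le> - k * \<Phi> u" using below[of u] c by (intro decr) auto
      also have "\<dots> \<le> 0" using nonneg[of u] u \<open>k > 0\<close> by (simp add: mult_nonneg_nonneg)
      finally show "\<exists>y. (\<Phi> has_real_derivative y) (at u) \<and> y \<le> 0" using der[of u] u by auto
    qed
    then show False using s' c \<open>\<Phi> 0 \<le> r\<close> by simp
  qed
  show "\<Phi> t \<le> r" using le \<open>t \<ge> 0\<close> by simp
  have "exp (k * 0) * \<Phi> 0 \<ge> exp (k * t) * \<Phi> t"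
  proof (rule DERIV_nonpos_imp_decreasing_open[OF \<open>t \<ge> 0\<close>])
    fix u assume u: "0 < u" "u < t"
    have "((\<lambda>u. exp (k * u) * \<Phi> u) has_real_derivative exp (k * u) * (k * \<Phi> u + \<Phi>' u)) (at u)"
      using u by (auto intro!: derivative_eq_intros der simp: algebra_simps)
    moreover have "exp (k * u) * (k * \<Phi> u + \<Phi>' u) \<le> 0"
      using decr[of u] le[of u] u \<open>r < r'\<close> by (intro mult_nonneg_nonpos) auto
    ultimately show "\<exists>y. ((\<lambda>u. exp (k * u) * \<Phi> u) has_real_derivative y) (at u) \<and> y \<le> 0" by auto
  qed (intro continuous_intros cont')
  then have "exp (- k * t) * (exp (k * t) * \<Phi> t) \<le> exp (- k * t) * \<Phi> 0"
    by (intro mult_left_mono) auto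
  then show "\<Phi> t \<le> exp (- k * t) * \<Phi> 0" by (simp flip: mult.assoc exp_add)
qed

text \<open>With \<open>\<beta> = 4 \<sigma>\<close> the form, divided by \<open>\<sigma>\<close>, is affine in \<open>lam\<close>, so it suffices to consider
  \<open>lam = 0\<close> and \<open>lam = 1\<close>.\<close>

lemma core_quadratic_form_nonneg:
  fixes p y A e \<epsilon> l :: real
  assumes "0 \<le> l" "l \<le> 1"
  shows "0 \<le> p\<^sup>2 / 2 - (p + 2 * y - A)\<^sup>2 / 8 + A\<^sup>2 + 4 * y\<^sup>2 - A * (2 * (1 - l) * y - 2 * l * \<epsilon> + e)
    + e\<^sup>2 + 4 * l * \<epsilon>\<^sup>2 + 4 * l * \<epsilon> * y"
proof -
  define Q where "Q = (\<lambda>l. p\<^sup>2 / 2 - (p + 2 * y - A)\<^sup>2 / 8 + A\<^sup>2 + 4 * y\<^sup>2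
    - A * (2 * (1 - l) * y - 2 * l * \<epsilon> + e) + e\<^sup>2 + 4 * l * \<epsilon>\<^sup>2 + 4 * l * \<epsilon> * y)"
  \<comment> \<open>Successive completion of squares; the remaining coefficient of A^2 is still
    positive.\<close>
  have "Q 0 = 3 / 8 * (p - (2 * y - A) / 3)\<^sup>2 + (e - A / 2)\<^sup>2 + 10 / 3 * (y - A / 5)\<^sup>2 + 9 / 20 * A\<^sup>2"
    by (simp add: Q_def power2_eq_square field_simps)
  then have 0: "Q 0 \<ge> 0" by simp
  have "Q 1 = 3 / 8 * (p - (2 * y - A) / 3)\<^sup>2 + (e - A / 2)\<^sup>2 + 4 * (\<epsilon> + y / 2 + A / 4)\<^sup>2
      + 7 / 3 * (y - A / 14)\<^sup>2 + 9 / 28 * A\<^sup>2"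
    by (simp add: Q_def power2_eq_square field_simps)
  then have 1: "Q 1 \<ge> 0" by simp
  have "Q l = (1 - l) * Q 0 + l * Q 1" by (simp add: Q_def field_simps)
  then have "Q l \<ge> 0" using 0 1 assms by simp
  then show ?thesis by (simp add: Q_def)
qed

text \<open>Here p is the level jump, y the momentum, s the combined velocity
  \<open>w + k * \<xi>\<close>, e1 and e are the observer errors and \<epsilon> is the filter error.
  The y^2 and p^2 terms on the right are paid for by viscosity and by the gradient of h; the
  negative s^2 term has to beat the \<open>q * k\<close> term of the cart.\<close>

lemma dissipation_quadratic_form:
  fixes p y s e e1 \<epsilon> l :: real
  assumes "0 \<le> l" "l \<le> 1" "\<sigma> > 0" "\<beta> \<ge> 4 * \<sigma>"
    and A: "A = p + 2 * y - q * s"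
    and f: "f = - \<sigma> * (p + 2 * l * y + 2 * l * \<epsilon> - q * s - q * e)"
  shows "f * A - \<sigma> * q\<^sup>2 * (e1\<^sup>2 + 2 * e\<^sup>2) - l * \<beta> * \<epsilon>\<^sup>2 - l * \<beta> * \<epsilon> * y
    \<le> (\<beta> / 2 + 2 * \<sigma>) * y\<^sup>2 + \<sigma> / 2 * p\<^sup>2 - \<sigma> * q\<^sup>2 / 8 * s\<^sup>2
      - \<sigma> * q\<^sup>2 * (e1\<^sup>2 + e\<^sup>2) - (\<beta> - 4 * \<sigma>) / 4 * (l * \<epsilon>\<^sup>2)"
proof -
  have "0 \<le> \<sigma> * (p\<^sup>2 / 2 - (p + 2 * y - A)\<^sup>2 / 8 + A\<^sup>2 + 4 * y\<^sup>2 - A * (2 * (1 - l) * y - 2 * l * \<epsilon> + q * e)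
    + (q * e)\<^sup>2 + 4 * l * \<epsilon>\<^sup>2 + 4 * l * \<epsilon> * y)" (is "0 \<le> \<sigma> * ?Q")
    using core_quadratic_form_nonneg[OF assms(1,2), of p y A \<epsilon> "q * e"] assms(3) by simp
  \<comment> \<open>The form for \<beta> = 4 \<sigma> is settled above. What remains is linear in
    the excess \<beta> - 4 \<sigma>, with a coefficient that is a sum of squares.\<close>
  moreover have "0 \<le> (\<beta> - 4 * \<sigma>) * (l * (3 / 4 * (\<epsilon> + 2 / 3 * y)\<^sup>2 + y\<^sup>2 / 6) + (1 - l) * y\<^sup>2 / 2)"
    using assms by (intro mult_nonneg_nonneg add_nonneg_nonneg) auto
  moreover have "((\<beta> / 2 + 2 * \<sigma>) * y\<^sup>2 + \<sigma> / 2 * p\<^sup>2 - \<sigma> * q\<^sup>2 / 8 * s\<^sup>2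
      - \<sigma> * q\<^sup>2 * (e1\<^sup>2 + e\<^sup>2) - (\<beta> - 4 * \<sigma>) / 4 * (l * \<epsilon>\<^sup>2))
      - (f * A - \<sigma> * q\<^sup>2 * (e1\<^sup>2 + 2 * e\<^sup>2) - l * \<beta> * \<epsilon>\<^sup>2 - l * \<beta> * \<epsilon> * y)
    = \<sigma> * ?Q + (\<beta> - 4 * \<sigma>) * (l * (3 / 4 * (\<epsilon> + 2 / 3 * y)\<^sup>2 + y\<^sup>2 / 6) + (1 - l) * y\<^sup>2 / 2)"
    unfolding f A by (simp add: power2_eq_square field_simps)
  ultimately show ?thesis by linarith
qed

section \<open>Smooth tank flows\<close>

lemma C0_rectI: "continuous_on (T \<times> X) (\<lambda>p. u (fst p) (snd p)) \<Longrightarrow> C0_rect T X u"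
  by (simp add: C0_rect_def case_prod_unfold)

text \<open>The partial derivatives are fixed as functions, each with exactly the continuity a
  classical solution offers: up to the walls for \<open>h\<close>, \<open>v\<close> and their first
  derivatives, in the interior for \<open>htx\<close>, and none for \<open>vxx\<close> and
  \<open>hxx\<close>.\<close>

locale tank_flow =
  fixes L g \<mu> m hs :: real and h v ht hx vt vx htx hxx vxx :: "real \<Rightarrow> real \<Rightarrow> real"
    and f :: "real \<Rightarrow> real"
  assumes pos: "L > 0" "g > 0" "\<mu> > 0" "m > 0"
    and h_pos: "t \<ge> 0 \<Longrightarrow> x \<in> {0..L} \<Longrightarrow> h t x > 0"
    and C0_h: "C0_rect {0..} {0..L} h" and C0_hx: "C0_rect {0..} {0..L} hx"
    and C0_ht: "C0_rect {0..} {0..L} ht" and C0_v: "C0_rect {0..} {0..L} v"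
    and C0_vt: "C0_rect {0<..} {0..L} vt" and C0_vx: "C0_rect {0<..} {0..L} vx"
    and C0_htx: "C0_rect {0<..} {0<..<L} htx"
    and f_cont: "continuous_on {0..} f"
    and h_t: "t > 0 \<Longrightarrow> x \<in> {0..L} \<Longrightarrow> ((\<lambda>s. h s x) has_real_derivative ht t x) (at t)"
    and h_x: "t \<ge> 0 \<Longrightarrow> x \<in> {0..L} \<Longrightarrow> (h t has_real_derivative hx t x) (at x within {0..L})"
    and v_t: "t > 0 \<Longrightarrow> x \<in> {0..L} \<Longrightarrow> ((\<lambda>s. v s x) has_real_derivative vt t x) (at t)"
    and v_x: "t > 0 \<Longrightarrow> x \<in> {0..L} \<Longrightarrow> (v t has_real_derivative vx t x) (at x within {0..L})"
    and ht_x: "t > 0 \<Longrightarrow> x \<in> {0<..<L} \<Longrightarrow> (ht t has_real_derivative htx t x) (at x)"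
    and hx_x: "t > 0 \<Longrightarrow> x \<in> {0<..<L} \<Longrightarrow> (hx t has_real_derivative hxx t x) (at x)"
    and vx_x: "t > 0 \<Longrightarrow> x \<in> {0<..<L} \<Longrightarrow> (vx t has_real_derivative vxx t x) (at x)"
    and mass: "t > 0 \<Longrightarrow> x \<in> {0..L} \<Longrightarrow> ht t x = - (hx t x * v t x + h t x * vx t x)"
    and momentum: "t > 0 \<Longrightarrow> x \<in> {0<..<L} \<Longrightarrow>
      ht t x * v t x + h t x * vt t x + hx t x * (v t x)\<^sup>2 + 2 * h t x * v t x * vx t x + g * h t x * hx t x
      = \<mu> * (hx t x * vx t x + h t x * vxx t x) + h t x * f t"
    and no_flow: "t \<ge> 0 \<Longrightarrow> v t 0 = 0" "t \<ge> 0 \<Longrightarrow> v t L = 0"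
    and total_mass: "t \<ge> 0 \<Longrightarrow> integral {0..L} (h t) = m"
begin

lemma h_x_interior: "t \<ge> 0 \<Longrightarrow> x \<in> {0<..<L} \<Longrightarrow> (h t has_real_derivative hx t x) (at x)"
  using h_x[of t x] by (simp add: at_within_Icc_at)

lemma v_x_interior: "t > 0 \<Longrightarrow> x \<in> {0<..<L} \<Longrightarrow> (v t has_real_derivative vx t x) (at x)"
  using v_x[of t x] by (simp add: at_within_Icc_at)

lemma hx_t: "t > 0 \<Longrightarrow> x \<in> {0<..<L} \<Longrightarrow> ((\<lambda>s. hx s x) has_real_derivative htx t x) (at t)"
proof (rule mixed_partials[where u = h and ut = ht and utx = htx and a = 0 and b = L])
  show "C0_rect {0<..} {0<..<L} ht"
    using C0_ht by (rule C0_rect_subset) auto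
qed (use h_t h_x_interior ht_x C0_htx in auto)

lemma htx_eq:
  assumes "t > 0" "x \<in> {0<..<L}"
  shows "htx t x = - (hxx t x * v t x + 2 * hx t x * vx t x + h t x * vxx t x)"
proof (rule DERIV_unique[OF ht_x[OF assms]])
  have "((\<lambda>x. - (hx t x * v t x + h t x * vx t x)) has_real_derivative
    - (hxx t x * v t x + 2 * hx t x * vx t x + h t x * vxx t x)) (at x)"
    using assms
    by (auto intro!: derivative_eq_intros hx_x h_x_interior v_x_interior vx_x simp: algebra_simps)
  then show "(ht t has_real_derivative - (hxx t x * v t x + 2 * hx t x * vx t x + h t x * vxx t x)) (at x)"
    by (rule has_field_derivative_transform_within_open[of _ _ _ "{0<..<L}"])
      (use assms mass in auto)
qed

lemma vt_eq:
  assumes "t > 0" "x \<in> {0<..<L}"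
  shows "vt t x = (\<mu> * (hx t x * vx t x + h t x * vxx t x)) / h t x + f t - v t x * vx t x - g * hx t x"
proof -
  have "h t x > 0" "ht t x = - (hx t x * v t x + h t x * vx t x)"
    using h_pos[of t x] mass[of t x] assms by auto
  then show ?thesis
    using momentum[OF assms] unfolding \<open>ht t x = _\<close> by (simp add: field_simps power2_eq_square)
qed

lemmas continuous_fields =
  C0_rect_compose[OF C0_h] C0_rect_compose[OF C0_hx] C0_rect_compose[OF C0_ht] C0_rect_compose[OF C0_v]
  C0_rect_compose[OF C0_vt] C0_rect_compose[OF C0_vx] C0_rect_compose[OF C0_htx]
  continuous_on_compose2[OF f_cont]

lemma continuous_slice:
  assumes "t \<ge> 0"
  shows "continuous_on {0..L} (h t)" "continuous_on {0..L} (hx t)" "continuous_on {0..L} (v t)"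
  using assms C0_rect_slice_x[OF C0_h] C0_rect_slice_x[OF C0_hx] C0_rect_slice_x[OF C0_v] by auto

lemma continuous_slice_vx: "t > 0 \<Longrightarrow> continuous_on {0..L} (vx t)"
  using C0_rect_slice_x[OF C0_vx] by auto

definition momentum_int :: "real \<Rightarrow> real" where
  "momentum_int t = integral {0..L} (\<lambda>x. h t x * v t x)"

lemma momentum_balance:
  assumes "t > 0"
  shows "(momentum_int has_real_derivative
    m * f t - (g / 2 * ((h t L)\<^sup>2 - (h t 0)\<^sup>2) - \<mu> * (h t L * vx t L - h t 0 * vx t 0))) (at t)"
proof -
  have "((\<lambda>t. integral {0..L} (\<lambda>x. h t x * v t x)) has_real_derivative
      integral {0..L} (\<lambda>x. h t x * f t)
      - ((\<lambda>t x. h t x * (v t x)\<^sup>2 + g / 2 * (h t x)\<^sup>2 - \<mu> * (h t x * vx t x)) t L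
       - (\<lambda>t x. h t x * (v t x)\<^sup>2 + g / 2 * (h t x)\<^sup>2 - \<mu> * (h t x * vx t x)) t 0)) (at t)"
  proof (rule balance_law[where S = "\<lambda>t x. h t x * f t" and Ft = "\<lambda>t x. ht t x * v t x + h t x * vt t x"
        and B = "\<lambda>t x. h t x * (v t x)\<^sup>2 + g / 2 * (h t x)\<^sup>2 - \<mu> * (h t x * vx t x)"])
    show "continuous_on {0..L} (\<lambda>x. h t x * v t x)" if "t > 0" for t :: real
      using that by (intro continuous_intros continuous_slice) auto
    show "C0_rect {0<..} {0..L} (\<lambda>t x. h t x * (v t x)\<^sup>2 + g / 2 * (h t x)\<^sup>2 - \<mu> * (h t x * vx t x))"
      "C0_rect {0<..} {0..L} (\<lambda>t x. h t x * f t)"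
      "C0_rect {0<..} {0<..<L} (\<lambda>t x. ht t x * v t x + h t x * vt t x)"
      by (intro C0_rectI continuous_intros continuous_fields; force)+
  next
    fix t x :: real assume tx: "t > 0" "x \<in> {0<..<L}"
    then have x: "x \<in> {0..L}" by auto
    show "((\<lambda>s. h s x * v s x) has_real_derivative ht t x * v t x + h t x * vt t x) (at t)"
      using tx x by (auto intro!: derivative_eq_intros h_t v_t)
    have "h t x > 0" using h_pos[of t x] tx x by auto
    then show "((\<lambda>x. h t x * (v t x)\<^sup>2 + g / 2 * (h t x)\<^sup>2 - \<mu> * (h t x * vx t x)) has_real_derivative
        h t x * f t - (ht t x * v t x + h t x * vt t x)) (at x)"
      using tx momentum[OF tx]
      by (auto intro!: derivative_eq_intros h_x_interior v_x_interior vx_x simp: algebra_simps power2_eq_square)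
  qed (use pos assms in auto)
  moreover have "integral {0..L} (\<lambda>x. h t x * f t) = m * f t"
    using total_mass[of t] assms by simp
  ultimately show ?thesis
    using no_flow[of t] assms total_mass[of t] unfolding momentum_int_def[abs_def]
    by (simp add: algebra_simps)
qed

definition level_jump :: "real \<Rightarrow> real" where
  "level_jump t = \<mu> * (h t L - h t 0)"

text \<open>At the walls v = 0, so the mass equation reduces to h_t = - h v_x. The jump thus changes
  at exactly the negative of the viscous wall flux in \<open>momentum_balance\<close>.\<close>

lemma level_jump_deriv:
  assumes "t > 0"
  shows "(level_jump has_real_derivative - \<mu> * (h t L * vx t L - h t 0 * vx t 0)) (at t)"
proof -
  have "((\<lambda>t. \<mu> * (h t L - h t 0)) has_real_derivative \<mu> * (ht t L - ht t 0)) (at t)"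
    using assms pos by (intro DERIV_cmult DERIV_diff h_t) auto
  then show ?thesis
    using mass[of t 0] mass[of t L] no_flow[of t] assms pos
    unfolding level_jump_def[abs_def] by (simp add: algebra_simps)
qed

lemma integral_hx: "t \<ge> 0 \<Longrightarrow> integral {0..L} (hx t) = h t L - h t 0"
  using fundamental_theorem_of_calculus[of 0 L "h t" "hx t"] pos h_x
  by (auto simp: has_real_derivative_iff_has_vector_derivative intro: integral_unique)

text \<open>The integrand of E + W, with the two halves of the potential energy merged and the weak
  derivative replaced by \<open>hx\<close>.\<close>

definition energy_density :: "real \<Rightarrow> real \<Rightarrow> real" where
  "energy_density t x = h t x * (v t x)\<^sup>2 / 2 + (h t x * v t x + \<mu> * hx t x)\<^sup>2 / (2 * h t x)
     + g * (h t x - hs)\<^sup>2"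

definition energy :: "real \<Rightarrow> real" where
  "energy t = integral {0..L} (energy_density t)"

lemma C0_energy_density: "C0_rect {0..} {0..L} energy_density"
proof -
  have "h (fst p) (snd p) \<noteq> 0" if "p \<in> {0..} \<times> {0..L}" for p
    using that h_pos[of "fst p" "snd p"] by auto
  then show ?thesis
    unfolding energy_density_def
    by (intro C0_rectI continuous_intros continuous_fields) force+
qed

lemma energy_continuous: "continuous_on {0..} energy"
  using integral_continuous_on_param[of "{0..}" 0 L energy_density] C0_energy_density
  by (simp add: energy_def[abs_def] C0_rect_def)

lemma energy_balance:
  assumes "t > 0"
  shows "(energy has_real_derivative
    - \<mu> * integral {0..L} (\<lambda>x. h t x * (vx t x)\<^sup>2) - \<mu> * g * integral {0..L} (\<lambda>x. (hx t x)\<^sup>2)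
    + f t * (2 * momentum_int t + level_jump t)) (at t)"
proof -
  define S where "S = (\<lambda>t x. - \<mu> * (h t x * (vx t x)\<^sup>2) - \<mu> * g * (hx t x)\<^sup>2
    + f t * (2 * (h t x * v t x) + \<mu> * hx t x))"
  \<comment> \<open>The flux collects all exact x-derivatives. Each of its terms carries a factor v,
    so it vanishes at both walls.\<close>
  define B where "B = (\<lambda>t x. h t x * (v t x)^3 / 2 - \<mu> * h t x * v t x * vx t x
    + v t x * (h t x * v t x + \<mu> * hx t x)\<^sup>2 / (2 * h t x) + 2 * g * (h t x - hs) * h t x * v t x)"
  \<comment> \<open>Kept in terms of \<open>vt\<close> and \<open>htx\<close>: these are continuous
    in the interior, whereas substituting the equations would bring in \<open>vxx\<close> and
    \<open>hxx\<close>.\<close>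
  define Ft where "Ft = (\<lambda>t x. ht t x * (v t x)\<^sup>2 / 2 + h t x * v t x * vt t x
    + (h t x * v t x + \<mu> * hx t x) * (ht t x * v t x + h t x * vt t x + \<mu> * htx t x) / h t x
    - (h t x * v t x + \<mu> * hx t x)\<^sup>2 * ht t x / (2 * (h t x)\<^sup>2) + 2 * g * (h t x - hs) * ht t x)"
  have ne: "h (fst p) (snd p) \<noteq> 0" if "p \<in> {0<..} \<times> {0..L}" for p
    using that h_pos[of "fst p" "snd p"] by auto
  have ne': "h (fst p) (snd p) \<noteq> 0" if "p \<in> {0<..} \<times> {0<..<L}" for p
    using that h_pos[of "fst p" "snd p"] by auto
  have "((\<lambda>t. integral {0..L} (energy_density t)) has_real_derivative
      integral {0..L} (S t) - (B t L - B t 0)) (at t)"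
  proof (rule balance_law[where Ft = Ft])
    show "continuous_on {0..L} (energy_density t)" if "t > 0" for t :: real
      using that C0_rect_slice_x[OF C0_energy_density, of t] by auto
    show "C0_rect {0<..} {0..L} B"
      unfolding B_def using ne by (intro C0_rectI continuous_intros continuous_fields) force+
    show "C0_rect {0<..} {0..L} S"
      unfolding S_def using ne by (intro C0_rectI continuous_intros continuous_fields) force+
    show "C0_rect {0<..} {0<..<L} Ft"
      unfolding Ft_def using ne' by (intro C0_rectI continuous_intros continuous_fields) force+
  next
    fix t x :: real assume tx: "t > 0" "x \<in> {0<..<L}"
    then have x: "x \<in> {0..L}" by auto
    have h: "h t x > 0" using h_pos[of t x] tx x by auto
    show "((\<lambda>s. energy_density s x) has_real_derivative Ft t x) (at t)"
      using tx x h unfolding energy_density_def Ft_def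
      by (auto intro!: derivative_eq_intros h_t v_t hx_t simp: field_simps power2_eq_square)
    define D where "D = hx t x * (v t x)^3 / 2 + 3 * h t x * (v t x)\<^sup>2 * vx t x / 2
      - \<mu> * (hx t x * v t x * vx t x + h t x * (vx t x)\<^sup>2 + h t x * v t x * vxx t x)
      + vx t x * (h t x * v t x + \<mu> * hx t x)\<^sup>2 / (2 * h t x)
      + v t x * (h t x * v t x + \<mu> * hx t x) * (hx t x * v t x + h t x * vx t x + \<mu> * hxx t x) / h t x
      - v t x * (h t x * v t x + \<mu> * hx t x)\<^sup>2 * hx t x / (2 * (h t x)\<^sup>2)
      + 2 * g * hx t x * h t x * v t x + 2 * g * (h t x - hs) * (hx t x * v t x + h t x * vx t x)"
    have "(B t has_real_derivative D) (at x)"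
      unfolding B_def D_def using tx h
      by (auto intro!: derivative_eq_intros h_x_interior v_x_interior vx_x hx_x
          simp: field_simps power2_eq_square power3_eq_cube)
    \<comment> \<open>The mass and momentum equations and the differentiated mass equation are
      inserted pointwise; the second derivatives of v and h cancel.\<close>
    moreover have "D = S t x - Ft t x"
      unfolding D_def S_def Ft_def vt_eq[OF tx] htx_eq[OF tx] mass[OF tx(1) x] using h
      by (simp add: field_simps power2_eq_square power3_eq_cube)
    ultimately show "(B t has_real_derivative S t x - Ft t x) (at x)" by simp
  qed (use pos assms in auto)
  moreover have "B t L - B t 0 = 0" using no_flow[of t] assms by (simp add: B_def)
  moreover have "integral {0..L} (S t) = - \<mu> * integral {0..L} (\<lambda>x. h t x * (vx t x)\<^sup>2)
      - \<mu> * g * integral {0..L} (\<lambda>x. (hx t x)\<^sup>2) + f t * (2 * momentum_int t + level_jump t)"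
  proof (rule integral_unique)
    have t: "t \<ge> 0" using assms by simp
    note c = continuous_slice[OF t] continuous_slice_vx[OF assms]
    show "(S t has_integral - \<mu> * integral {0..L} (\<lambda>x. h t x * (vx t x)\<^sup>2)
      - \<mu> * g * integral {0..L} (\<lambda>x. (hx t x)\<^sup>2) + f t * (2 * momentum_int t + level_jump t)) {0..L}"
      unfolding S_def momentum_int_def level_jump_def integral_hx[OF t, symmetric]
      by (intro has_integral_add has_integral_diff has_integral_mult_right integrable_integral
          integrable_continuous_real continuous_intros c)
  qed
  ultimately show ?thesis unfolding energy_def[abs_def] by simp
qed

end

section \<open>Energy bounds and the range of the liquid level\<close>

context tank_flow
begin

definition v_sq :: "real \<Rightarrow> real" where "v_sq t = integral {0..L} (\<lambda>x. (v t x)\<^sup>2)"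
definition h_sq :: "real \<Rightarrow> real" where "h_sq t = integral {0..L} (\<lambda>x. (h t x - hs)\<^sup>2)"
definition hx_sq :: "real \<Rightarrow> real" where "hx_sq t = integral {0..L} (\<lambda>x. (hx t x)\<^sup>2)"
definition dissipation :: "real \<Rightarrow> real" where "dissipation t = integral {0..L} (\<lambda>x. h t x * (vx t x)\<^sup>2)"

lemma sq_nonneg:
  assumes "t \<ge> 0"
  shows "v_sq t \<ge> 0" "h_sq t \<ge> 0" "hx_sq t \<ge> 0"
  using continuous_slice[OF assms] unfolding v_sq_def h_sq_def hx_sq_def
  by (auto intro!: integral_nonneg integrable_continuous_real continuous_intros)

lemma dissipation_nonneg: "t > 0 \<Longrightarrow> dissipation t \<ge> 0"
  unfolding dissipation_def
  by (intro integral_nonneg integrable_continuous_real continuous_intros continuous_slice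
      continuous_slice_vx mult_nonneg_nonneg less_imp_le[OF h_pos]) auto

text \<open>The first bound is the minimum over v of the two kinetic terms, attained at
  \<open>v = - \<mu> * hx / (2 * h)\<close>; the second drops the square of the effective
  momentum.\<close>

lemma energy_density_ge:
  assumes "t \<ge> 0" "x \<in> {0..L}"
  shows "\<mu>\<^sup>2 * (hx t x)\<^sup>2 / (4 * h t x) + g * (h t x - hs)\<^sup>2 \<le> energy_density t x"
    and "h t x * (v t x)\<^sup>2 / 2 + g * (h t x - hs)\<^sup>2 \<le> energy_density t x"
proof -
  have h: "h t x > 0" using h_pos assms by auto
  have "energy_density t x - (\<mu>\<^sup>2 * (hx t x)\<^sup>2 / (4 * h t x) + g * (h t x - hs)\<^sup>2)
      = (2 * h t x * v t x + \<mu> * hx t x)\<^sup>2 / (4 * h t x)"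
    using h by (simp add: energy_density_def field_simps power2_eq_square)
  also have "\<dots> \<ge> 0" using h by simp
  finally show "\<mu>\<^sup>2 * (hx t x)\<^sup>2 / (4 * h t x) + g * (h t x - hs)\<^sup>2 \<le> energy_density t x" by simp
  show "h t x * (v t x)\<^sup>2 / 2 + g * (h t x - hs)\<^sup>2 \<le> energy_density t x"
    using h by (simp add: energy_density_def)
qed

lemma energy_density_continuous: "t \<ge> 0 \<Longrightarrow> continuous_on {0..L} (energy_density t)"
  using C0_rect_slice_x[OF C0_energy_density] by auto

text \<open>The average of the two pointwise lower bounds, which controls \<open>hx\<close> and
  \<open>v\<close> at the same time.\<close>

lemma energy_ge:
  assumes "t \<ge> 0" and le: "\<And>x. x \<in> {0..L} \<Longrightarrow> lo \<le> h t x \<and> h t x \<le> hi" and "lo > 0"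
  shows "\<mu>\<^sup>2 / (8 * hi) * hx_sq t + lo / 4 * v_sq t + g * h_sq t \<le> energy t"
proof -
  note c = continuous_slice[OF assms(1)]
  have "((\<lambda>x. \<mu>\<^sup>2 / (8 * hi) * (hx t x)\<^sup>2 + lo / 4 * (v t x)\<^sup>2 + g * (h t x - hs)\<^sup>2) has_integral
     \<mu>\<^sup>2 / (8 * hi) * hx_sq t + lo / 4 * v_sq t + g * h_sq t) {0..L}"
    unfolding hx_sq_def v_sq_def h_sq_def
    by (intro has_integral_add has_integral_mult_right integrable_integral
          integrable_continuous_real continuous_intros c)
  moreover have "(energy_density t has_integral energy t) {0..L}"
    unfolding energy_def
    by (intro integrable_integral integrable_continuous_real energy_density_continuous assms(1))
  moreover have "\<mu>\<^sup>2 / (8 * hi) * (hx t x)\<^sup>2 + lo / 4 * (v t x)\<^sup>2 + g * (h t x - hs)\<^sup>2 \<le> energy_density t x"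
    if x: "x \<in> {0..L}" for x
  proof -
    have h: "lo \<le> h t x" "h t x \<le> hi" "0 < h t x" using le[OF x] h_pos[OF assms(1) x] by auto
    have "\<mu>\<^sup>2 * (hx t x)\<^sup>2 / (4 * hi) \<le> \<mu>\<^sup>2 * (hx t x)\<^sup>2 / (4 * h t x)"
      using h by (intro divide_left_mono) auto
    moreover have "lo * (v t x)\<^sup>2 \<le> h t x * (v t x)\<^sup>2"
      using h by (intro mult_right_mono) auto
    ultimately show ?thesis using energy_density_ge[OF assms(1) x] by (simp add: field_simps)
  qed
  ultimately show ?thesis by (rule has_integral_le)
qed

lemma energy_le:
  assumes "t \<ge> 0" and le: "\<And>x. x \<in> {0..L} \<Longrightarrow> lo \<le> h t x \<and> h t x \<le> hi" and "lo > 0"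
  shows "energy t \<le> 3 / 2 * hi * v_sq t + \<mu>\<^sup>2 / lo * hx_sq t + g * h_sq t"
proof -
  note c = continuous_slice[OF assms(1)]
  have I: "((\<lambda>x. 3 / 2 * hi * (v t x)\<^sup>2 + \<mu>\<^sup>2 / lo * (hx t x)\<^sup>2 + g * (h t x - hs)\<^sup>2) has_integral
     3 / 2 * hi * v_sq t + \<mu>\<^sup>2 / lo * hx_sq t + g * h_sq t) {0..L}"
    unfolding hx_sq_def v_sq_def h_sq_def
    by (intro has_integral_add has_integral_mult_right integrable_integral
          integrable_continuous_real continuous_intros c)
  have I': "(energy_density t has_integral energy t) {0..L}"
    unfolding energy_def
    by (intro integrable_integral integrable_continuous_real energy_density_continuous assms(1))
  have le': "energy_density t x \<le> 3 / 2 * hi * (v t x)\<^sup>2 + \<mu>\<^sup>2 / lo * (hx t x)\<^sup>2 + g * (h t x - hs)\<^sup>2"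
    if x: "x \<in> {0..L}" for x
  proof -
    have h: "lo \<le> h t x" "h t x \<le> hi" "0 < h t x" using le[OF x] h_pos[OF assms(1) x] by auto
    have "3 / 2 * h t x * (v t x)\<^sup>2 + \<mu>\<^sup>2 * (hx t x)\<^sup>2 / h t x + g * (h t x - hs)\<^sup>2 - energy_density t x
      = (h t x * v t x - \<mu> * hx t x)\<^sup>2 / (2 * h t x)"
      using h by (simp add: energy_density_def field_simps power2_eq_square)
    also have "\<dots> \<ge> 0" using h by simp
    finally have "energy_density t x \<le> 3 / 2 * h t x * (v t x)\<^sup>2 + \<mu>\<^sup>2 * (hx t x)\<^sup>2 / h t x + g * (h t x - hs)\<^sup>2"
      by simp
    moreover have "\<mu>\<^sup>2 * (hx t x)\<^sup>2 / h t x \<le> \<mu>\<^sup>2 * (hx t x)\<^sup>2 / lo"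
      using h \<open>lo > 0\<close> by (intro divide_left_mono) auto
    moreover have "h t x * (v t x)\<^sup>2 \<le> hi * (v t x)\<^sup>2"
      using h by (intro mult_right_mono) auto
    ultimately show ?thesis by (simp add: field_simps)
  qed
  show ?thesis by (rule has_integral_le[OF I' I le'])
qed

lemma energy_nonneg:
  assumes "t \<ge> 0"
  shows "energy t \<ge> 0"
  unfolding energy_def
proof (intro integral_nonneg integrable_continuous_real energy_density_continuous assms)
  fix x assume x: "x \<in> {0..L}"
  have "0 \<le> h t x * (v t x)\<^sup>2 / 2 + g * (h t x - hs)\<^sup>2"
    using h_pos[OF assms x] pos by simp
  then show "0 \<le> energy_density t x" using energy_density_ge(2)[OF assms x] by linarith
qed

lemma v_sq_le:
  assumes "t > 0" and le: "\<And>x. x \<in> {0..L} \<Longrightarrow> lo \<le> h t x" and "lo > 0"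
  shows "v_sq t \<le> L\<^sup>2 / (pi\<^sup>2 * lo) * dissipation t"
proof -
  note c = continuous_slice[of t] continuous_slice_vx[OF assms(1)]
  have "pi\<^sup>2 * v_sq t \<le> L\<^sup>2 * integral {0..L} (\<lambda>x. (vx t x)\<^sup>2)"
    unfolding v_sq_def using assms(1) pos no_flow[of t]
    by (intro Poincare_Dirichlet v_x c) auto
  also have "\<dots> = L\<^sup>2 / lo * integral {0..L} (\<lambda>x. lo * (vx t x)\<^sup>2)"
    using \<open>lo > 0\<close> by simp
  also have "\<dots> \<le> L\<^sup>2 / lo * dissipation t"
    unfolding dissipation_def using le assms(1,3) c
    by (intro mult_left_mono integral_le integrable_continuous_real continuous_intros mult_right_mono) auto
  finally show ?thesis using \<open>lo > 0\<close> by (simp add: field_simps)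
qed

text \<open>Splitting h v into \<open>sqrt h\<close> times \<open>sqrt h * v\<close> before
  Cauchy-Schwarz produces the exact mass m and only one factor \<open>hi\<close>, as the gain
  condition demands.\<close>

lemma momentum_int_sq_le:
  assumes "t \<ge> 0" and le: "\<And>x. x \<in> {0..L} \<Longrightarrow> h t x \<le> hi"
  shows "(momentum_int t)\<^sup>2 \<le> m * hi * v_sq t"
proof -
  note c = continuous_slice[OF assms(1)]
  have nn: "h t x \<ge> 0" if "x \<in> {0..L}" for x using h_pos[OF assms(1) that] by simp
  have "momentum_int t = integral {0..L} (\<lambda>x. sqrt (h t x) * (sqrt (h t x) * v t x))"
    unfolding momentum_int_def using nn by (intro integral_cong) (simp flip: mult.assoc)
  also have "\<dots>\<^sup>2 \<le> integral {0..L} (\<lambda>x. (sqrt (h t x))\<^sup>2) * integral {0..L} (\<lambda>x. (sqrt (h t x) * v t x)\<^sup>2)"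
    by (intro integral_Cauchy_Schwarz continuous_intros c)
  also have "integral {0..L} (\<lambda>x. (sqrt (h t x))\<^sup>2) = m"
    unfolding total_mass[OF assms(1), symmetric] using nn by (intro integral_cong) simp
  also have "integral {0..L} (\<lambda>x. (sqrt (h t x) * v t x)\<^sup>2) \<le> integral {0..L} (\<lambda>x. hi * (v t x)\<^sup>2)"
    using le nn
    by (intro integral_le integrable_continuous_real continuous_intros c)
      (auto simp: power_mult_distrib intro!: mult_right_mono)
  finally show ?thesis using pos by (simp add: v_sq_def)
qed

lemma level_jump_sq_le:
  assumes "t \<ge> 0"
  shows "(level_jump t)\<^sup>2 \<le> \<mu>\<^sup>2 * L * hx_sq t"
proof -
  have "(integral {0..L} (\<lambda>x. hx t x * 1))\<^sup>2 \<le> integral {0..L} (\<lambda>x. (hx t x)\<^sup>2) * integral {0..L} (\<lambda>x. 1\<^sup>2)"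
    by (intro integral_Cauchy_Schwarz continuous_slice assms continuous_intros)
  then show ?thesis
    using pos unfolding level_jump_def integral_hx[OF assms, symmetric] hx_sq_def
    by (simp add: power_mult_distrib mult.commute mult.left_commute)
qed

lemma mean_level_attained:
  assumes "t \<ge> 0" "hs = m / L"
  obtains x0 where "x0 \<in> {0..L}" "h t x0 = hs"
proof -
  note c = continuous_slice(1)[OF assms(1)]
  have int: "integral {0..L} (\<lambda>x. h t x - hs) = 0"
    using total_mass[OF assms(1)] pos assms(2)
    by (subst Henstock_Kurzweil_Integration.integral_diff) (auto intro: integrable_continuous_real c)
  have "\<exists>x\<in>{0..L}. h t x \<le> hs"
  proof (rule ccontr)
    assume "\<not> ?thesis"
    then have *: "\<And>x. x \<in> {0..L} \<Longrightarrow> h t x - hs > 0" by force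
    have "\<forall>x\<in>{0..L}. h t x - hs = 0"
      by (rule iffD1[OF integral_eq_0_iff int])
        (use pos * in \<open>auto intro!: continuous_intros c less_imp_le\<close>)
    then show False using *[of 0] pos by auto
  qed
  then obtain a where a: "a \<in> {0..L}" "h t a \<le> hs" by auto
  have "\<exists>x\<in>{0..L}. h t x \<ge> hs"
  proof (rule ccontr)
    assume "\<not> ?thesis"
    then have *: "\<And>x. x \<in> {0..L} \<Longrightarrow> hs - h t x > 0" by force
    have "integral {0..L} (\<lambda>x. hs - h t x) = - integral {0..L} (\<lambda>x. h t x - hs)"
      by (simp flip: Henstock_Kurzweil_Integration.integral_neg)
    then have int': "integral {0..L} (\<lambda>x. hs - h t x) = 0" using int by simp
    have "\<forall>x\<in>{0..L}. hs - h t x = 0"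
      by (rule iffD1[OF integral_eq_0_iff int'])
        (use pos * in \<open>auto intro!: continuous_intros c less_imp_le\<close>)
    then show False using *[of 0] pos by auto
  qed
  then obtain b where b: "b \<in> {0..L}" "h t b \<ge> hs" by auto
  have "connected (h t ` {0..L})" by (intro connected_continuous_image c) auto
  then have "hs \<in> h t ` {0..L}"
    using a b unfolding connected_iff_interval by (meson imageI)
  then show ?thesis using that by auto
qed

lemma h_sq_le:
  assumes "t \<ge> 0" "hs = m / L"
  shows "h_sq t \<le> L\<^sup>2 * hx_sq t"
proof -
  obtain x0 where "x0 \<in> {0..L}" "h t x0 = hs" using mean_level_attained[OF assms] .
  then show ?thesis
    unfolding h_sq_def hx_sq_def using pos assms(1)
    by (intro Poincare_vanishing_somewhere continuous_slice) (auto intro!: derivative_eq_intros h_x)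
qed

lemma G_fun_le_energy:
  assumes "t \<ge> 0" "hs = m / L" "x \<in> {0..L}"
  shows "\<bar>G_fun hs (h t x)\<bar> \<le> c_const g \<mu> * energy t"
proof -
  note c = continuous_slice[OF assms(1)]
  have hp: "h t y > 0" if "y \<in> {0..L}" for y using h_pos[OF assms(1) that] .
  define D where "D = (\<lambda>y. (h t y - hs) / sqrt (h t y) * hx t y)"
  have cD: "continuous_on {0..L} D"
    unfolding D_def using hp by (intro continuous_intros c) force
  have D: "\<mu> * sqrt g * \<bar>D y\<bar> \<le> energy_density t y" if y: "y \<in> {0..L}" for y
  proof -
    \<comment> \<open>Both factors are chosen so that \<open>2 * a * b\<close> is
      \<open>\<mu> * sqrt g * \<bar>D y\<bar>\<close> while a^2 + b^2 is the first lower bound of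
      the energy density. This is the origin of the constant \<open>c_const\<close>.\<close>
    define a b where "a = \<mu> * \<bar>hx t y\<bar> / (2 * sqrt (h t y))" and "b = sqrt g * \<bar>h t y - hs\<bar>"
    have "\<mu> * sqrt g * \<bar>D y\<bar> = 2 * a * b"
      using hp[OF y] by (simp add: D_def a_def b_def abs_mult)
    also have "\<dots> \<le> a\<^sup>2 + b\<^sup>2" using zero_le_power2[of "a - b"] by (simp add: power2_diff)
    also have "\<dots> = \<mu>\<^sup>2 * (hx t y)\<^sup>2 / (4 * h t y) + g * (h t y - hs)\<^sup>2"
      using hp[OF y] pos by (simp add: a_def b_def power_mult_distrib power_divide)
    also have "\<dots> \<le> energy_density t y" by (rule energy_density_ge[OF assms(1) y])
    finally show ?thesis .
  qed
  have "(\<lambda>y. \<bar>D y\<bar>) integrable_on {0..L}"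
    by (intro integrable_continuous_real continuous_intros cD)
  then have "\<mu> * sqrt g * integral {0..L} (\<lambda>y. \<bar>D y\<bar>) \<le> energy t"
    unfolding energy_def integral_mult_right[symmetric]
    by (intro integral_le D integrable_continuous_real continuous_intros cD energy_density_continuous assms(1))
  then have int: "integral {0..L} (\<lambda>y. \<bar>D y\<bar>) \<le> c_const g \<mu> * energy t"
    using pos by (simp add: c_const_def field_simps)
  have incr: "\<bar>P_fun hs (h t b) - P_fun hs (h t a)\<bar> \<le> integral {0..L} (\<lambda>y. \<bar>D y\<bar>)"
    if ab: "0 \<le> a" "a \<le> b" "b \<le> L" for a b
  proof -
    have sub: "{a..b} \<subseteq> {0..L}" using ab by auto
    have "(D has_integral P_fun hs (h t b) - P_fun hs (h t a)) {a..b}"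
    proof (rule fundamental_theorem_of_calculus[OF ab(2)])
      fix y assume y: "y \<in> {a..b}"
      then have "y \<in> {0..L}" using sub by auto
      then have "((\<lambda>y. P_fun hs (h t y)) has_real_derivative D y) (at y within {0..L})"
        unfolding D_def by (intro DERIV_chain2[OF DERIV_P_fun] h_x hp assms(1))
      then show "((\<lambda>y. P_fun hs (h t y)) has_vector_derivative D y) (at y within {a..b})"
        using sub by (simp add: DERIV_subset flip: has_real_derivative_iff_has_vector_derivative)
    qed
    then have "\<bar>P_fun hs (h t b) - P_fun hs (h t a)\<bar> = norm (integral {a..b} D)"
      by (simp add: integral_unique)
    also have "\<dots> \<le> integral {a..b} (\<lambda>y. \<bar>D y\<bar>)"
      by (intro integral_norm_bound_integral integrable_continuous_real continuous_intros
          continuous_on_subset[OF cD sub]) auto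
    also have "\<dots> \<le> integral {0..L} (\<lambda>y. \<bar>D y\<bar>)"
      by (intro integral_subset_le sub integrable_continuous_real continuous_intros
          continuous_on_subset[OF cD sub] cD) auto
    finally show ?thesis .
  qed
  obtain x0 where "x0 \<in> {0..L}" "h t x0 = hs" using mean_level_attained[OF assms(1,2)] .
  then have "\<bar>P_fun hs (h t x)\<bar> \<le> integral {0..L} (\<lambda>y. \<bar>D y\<bar>)"
    using incr[of x0 x] incr[of x x0] assms(3) by (cases "x \<le> x0") auto
  then show ?thesis using int by (simp add: abs_G_fun)
qed

end

section \<open>The closed loop\<close>

locale closed_loop = tank_flow +
  fixes \<xi> w \<xi>h wh z :: "real \<Rightarrow> real" and \<sigma> q k \<gamma> \<beta> lam :: real
  assumes hs_eq: "hs = m / L"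
    and gains: "\<sigma> > 0" "q > 0" "k > 0" "\<gamma> > 0" "\<beta> > 0" "0 \<le> lam" "lam \<le> 1"
    and ode_continuous: "continuous_on {0..} \<xi>" "continuous_on {0..} w" "continuous_on {0..} \<xi>h"
      "continuous_on {0..} wh" "continuous_on {0..} z"
    and \<xi>_t: "t > 0 \<Longrightarrow> (\<xi> has_real_derivative w t) (at t)"
    and w_t: "t > 0 \<Longrightarrow> (w has_real_derivative - f t) (at t)"
    and \<xi>h_t: "t > 0 \<Longrightarrow> (\<xi>h has_real_derivative wh t - 2 * \<gamma> * (\<xi>h t - \<xi> t)) (at t)"
    and wh_t: "t > 0 \<Longrightarrow> (wh has_real_derivative - f t - (1 / 2 + \<gamma>\<^sup>2) * (\<xi>h t - \<xi> t)) (at t)"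
    and z_t: "t > 0 \<Longrightarrow> (z has_real_derivative
      m * f t - g / 2 * ((h t L)\<^sup>2 - (h t 0)\<^sup>2) - \<beta> * (z t - \<mu> * (h t L - h t 0))) (at t)"
    and f_eq: "t > 0 \<Longrightarrow> f t = - \<sigma> * (2 * lam * z t + (1 - 2 * lam) * \<mu> * (h t L - h t 0)
      - q * (wh t + k * \<xi> t) + q * \<gamma> * (\<xi>h t - \<xi> t))"
begin

definition comb_vel :: "real \<Rightarrow> real" where "comb_vel t = w t + k * \<xi> t"
definition pos_err :: "real \<Rightarrow> real" where "pos_err t = \<xi>h t - \<xi> t"
definition vel_err :: "real \<Rightarrow> real" where "vel_err t = wh t - w t - \<gamma> * (\<xi>h t - \<xi> t)"
definition filt_err :: "real \<Rightarrow> real" where "filt_err t = z t - momentum_int t - level_jump t"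

definition Lyap :: "real \<Rightarrow> real" where
  "Lyap t = energy t + q * k\<^sup>2 / 2 * (\<xi> t)\<^sup>2 + q / 2 * (comb_vel t)\<^sup>2
     + \<sigma> * q\<^sup>2 / (2 * \<gamma>) * (pos_err t)\<^sup>2 + \<sigma> * q\<^sup>2 / \<gamma> * (vel_err t)\<^sup>2 + lam / 2 * (filt_err t)\<^sup>2"

text \<open>The filter copies the momentum balance without the viscous wall flux, and that flux is
  cancelled by the rate of the level jump. Hence no wall derivative of v survives.\<close>

lemma filt_err_deriv:
  assumes "t > 0"
  shows "(filt_err has_real_derivative - \<beta> * (filt_err t + momentum_int t)) (at t)"
  unfolding filt_err_def[abs_def]
  by (rule derivative_eq_intros z_t momentum_balance level_jump_deriv assms refl)+
    (simp add: level_jump_def algebra_simps)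

text \<open>Substituting the error variables shows how the measured feedback deviates from one using
  the true momentum and velocity: only the filter error, weighted by \<open>lam\<close>, and
  \<open>vel_err\<close> enter.\<close>

lemma f_eq':
  assumes "t > 0"
  shows "f t = - \<sigma> * (level_jump t + 2 * lam * momentum_int t + 2 * lam * filt_err t - q * comb_vel t - q * vel_err t)"
  unfolding f_eq[OF assms] filt_err_def comb_vel_def vel_err_def level_jump_def by (simp add: algebra_simps)

definition Lyap' :: "real \<Rightarrow> real" where
  "Lyap' t = - \<mu> * dissipation t - \<mu> * g * hx_sq t - q * k ^ 3 * (\<xi> t)\<^sup>2 + q * k * (comb_vel t)\<^sup>2
     + f t * (level_jump t + 2 * momentum_int t - q * comb_vel t)
     - \<sigma> * q\<^sup>2 * ((pos_err t)\<^sup>2 + 2 * (vel_err t)\<^sup>2) - lam * \<beta> * (filt_err t)\<^sup>2 - lam * \<beta> * filt_err t * momentum_int t"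

lemma Lyap_deriv:
  assumes "t > 0"
  shows "(Lyap has_real_derivative Lyap' t) (at t)"
proof -
  have s': "(comb_vel has_real_derivative - f t + k * w t) (at t)"
    unfolding comb_vel_def[abs_def] using assms by (auto intro!: derivative_eq_intros \<xi>_t w_t)
  have e1': "(pos_err has_real_derivative vel_err t - \<gamma> * pos_err t) (at t)"
    unfolding pos_err_def[abs_def] vel_err_def using assms
    by (auto intro!: derivative_eq_intros \<xi>_t \<xi>h_t simp: algebra_simps)
  \<comment> \<open>In these coordinates the observer error is a rotation with damping \<gamma>. The
    weights 1/2 and 1 on the two squares in \<open>Lyap\<close> cancel the mixed term, and the
    factor \<open>\<sigma> * q\<^sup>2 / \<gamma>\<close> removes \<gamma> from the
    dissipation.\<close>
  have e2': "(vel_err has_real_derivative - pos_err t / 2 - \<gamma> * vel_err t) (at t)"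
    unfolding pos_err_def vel_err_def[abs_def] using assms
    by (auto intro!: derivative_eq_intros \<xi>_t \<xi>h_t w_t wh_t simp: field_simps power2_eq_square)
  \<comment> \<open>With \<xi>' = s - k \<xi> for the combined velocity s, the products of s and
    \<xi> from the two cart terms cancel.\<close>
  have w: "w t = comb_vel t - k * \<xi> t" by (simp add: comb_vel_def)
  show ?thesis
    unfolding Lyap_def[abs_def]
    by (rule derivative_eq_intros energy_balance s' e1' e2' filt_err_deriv \<xi>_t assms refl)+
      (use gains in \<open>simp add: Lyap'_def w dissipation_def hx_sq_def field_simps power2_eq_square power3_eq_cube\<close>)
qed

lemma Lyap_continuous: "continuous_on {0..} Lyap"
proof -
  have "continuous_on {0..} momentum_int"
    using integral_continuous_on_param[of "{0..}" 0 L "\<lambda>t x. h t x * v t x"]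
      continuous_on_mult[OF C0_h[unfolded C0_rect_def case_prod_unfold] C0_v[unfolded C0_rect_def case_prod_unfold]]
    by (simp add: momentum_int_def[abs_def] case_prod_unfold)
  moreover have "continuous_on {0..} level_jump"
    unfolding level_jump_def[abs_def] using pos
    by (intro continuous_intros C0_rect_slice_t[OF C0_h]) auto
  ultimately show ?thesis
    unfolding Lyap_def[abs_def] comb_vel_def pos_err_def vel_err_def filt_err_def
    by (intro continuous_intros energy_continuous ode_continuous)
qed

lemma Lyap_nonneg: "t \<ge> 0 \<Longrightarrow> Lyap t \<ge> 0"
  using energy_nonneg[of t] gains unfolding Lyap_def by (auto intro!: add_nonneg_nonneg)

text \<open>Each bracket is the slack of one gain condition: the bound on \<open>lo / hi\<close> for
  the viscous dissipation, \<sigma> < 2 g / (\<mu> L) for the gradient of h, \<sigma> > 8 k / q for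
  the combined velocity, and \<beta> > 4 \<sigma> for the filter error.\<close>

lemma Lyap'_le:
  assumes "t > 0" and le: "\<And>x. x \<in> {0..L} \<Longrightarrow> lo \<le> h t x \<and> h t x \<le> hi"
    and "lo > 0" "hi > 0" "\<beta> \<ge> 4 * \<sigma>"
  shows "Lyap' t \<le> - (\<mu> - m * hi * L\<^sup>2 / (pi\<^sup>2 * lo) * (\<beta> / 2 + 2 * \<sigma>)) * dissipation t
    - (\<mu> * g - \<sigma> * \<mu>\<^sup>2 * L / 2) * hx_sq t - q * k ^ 3 * (\<xi> t)\<^sup>2 - (\<sigma> * q\<^sup>2 / 8 - q * k) * (comb_vel t)\<^sup>2
    - \<sigma> * q\<^sup>2 * ((pos_err t)\<^sup>2 + (vel_err t)\<^sup>2) - (\<beta> - 4 * \<sigma>) / 4 * (lam * (filt_err t)\<^sup>2)"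
proof -
  have t: "t \<ge> 0" using assms(1) by simp
  have "(momentum_int t)\<^sup>2 \<le> m * hi * (L\<^sup>2 / (pi\<^sup>2 * lo) * dissipation t)"
    using momentum_int_sq_le[OF t, of hi] v_sq_le[OF assms(1), of lo] le assms pos
    by (meson mult_left_mono mult_nonneg_nonneg less_imp_le order_trans)
  then have "(\<beta> / 2 + 2 * \<sigma>) * (momentum_int t)\<^sup>2
      \<le> (\<beta> / 2 + 2 * \<sigma>) * (m * hi * (L\<^sup>2 / (pi\<^sup>2 * lo) * dissipation t))"
    using gains by (intro mult_left_mono) auto
  moreover have "\<sigma> / 2 * (level_jump t)\<^sup>2 \<le> \<sigma> / 2 * (\<mu>\<^sup>2 * L * hx_sq t)"
    using gains level_jump_sq_le[OF t] by (intro mult_left_mono) auto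
  moreover note dissipation_quadratic_form[OF gains(6,7,1) assms(5) refl f_eq'[OF assms(1)], of "pos_err t"]
  ultimately show ?thesis unfolding Lyap'_def by (simp add: algebra_simps)
qed

lemma Lyap_le:
  assumes "t \<ge> 0" and le: "\<And>x. x \<in> {0..L} \<Longrightarrow> lo \<le> h t x \<and> h t x \<le> hi" and "lo > 0" "hi > 0"
  shows "Lyap t \<le> 3 / 2 * hi * v_sq t + \<mu>\<^sup>2 / lo * hx_sq t + g * h_sq t + q * k\<^sup>2 / 2 * (\<xi> t)\<^sup>2 + q / 2 * (comb_vel t)\<^sup>2
     + \<sigma> * q\<^sup>2 / (2 * \<gamma>) * (pos_err t)\<^sup>2 + \<sigma> * q\<^sup>2 / \<gamma> * (vel_err t)\<^sup>2 + lam / 2 * (filt_err t)\<^sup>2"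
  using energy_le[OF assms(1) le assms(3)] unfolding Lyap_def by simp

lemma Lyap_ge:
  assumes "t \<ge> 0" and le: "\<And>x. x \<in> {0..L} \<Longrightarrow> lo \<le> h t x \<and> h t x \<le> hi" and "lo > 0"
  shows "\<mu>\<^sup>2 / (8 * hi) * hx_sq t + lo / 4 * v_sq t + g * h_sq t + q * k\<^sup>2 / 2 * (\<xi> t)\<^sup>2 + q / 2 * (comb_vel t)\<^sup>2
     + \<sigma> * q\<^sup>2 / (2 * \<gamma>) * (pos_err t)\<^sup>2 + \<sigma> * q\<^sup>2 / \<gamma> * (vel_err t)\<^sup>2 + lam / 2 * (filt_err t)\<^sup>2 \<le> Lyap t"
  using energy_ge[OF assms(1) le assms(3)] unfolding Lyap_def by simp

lemma energy_le_Lyap: "energy t \<le> Lyap t"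
  using gains unfolding Lyap_def by (auto intro!: add_nonneg_nonneg simp: add.assoc)

end

section \<open>Passage from classical solutions to the abstract closed loop\<close>

text \<open>\<open>C1_rect\<close> provides continuous partial derivatives but does not state
  continuity of the function itself; it follows from total differentiability.\<close>

lemma C0_rect_if_partials:
  assumes p: "partials_on T X u ut ux" and c: "C0_rect T X ux" and "convex X"
  shows "C0_rect T X u"
  unfolding C0_rect_def
proof (rule continuous_on_eq_continuous_within[THEN iffD2], intro ballI)
  fix p assume "p \<in> T \<times> X"
  then obtain t x where tx: "p = (t, x)" "t \<in> T" "x \<in> X" by auto
  have "((\<lambda>(t, x). u t x) has_derivative (\<lambda>(s, y). ut t x * s + blinfun_mult_right (ux t x) y))
      (at (t, x) within T \<times> X)"
  proof (rule has_derivative_partialsI[where fy = "\<lambda>t x. blinfun_mult_right (ux t x)"])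
    show "((\<lambda>t. u t x) has_derivative (*) (ut t x)) (at t within T)"
      using p tx by (auto simp: partials_on_def has_field_derivative_def)
    show "(u t has_derivative blinfun_apply (blinfun_mult_right (ux t x))) (at x within X)"
      if "t \<in> T" "x \<in> X" for t x
      using p that by (simp add: partials_on_def has_field_derivative_def)
    have "continuous_on (T \<times> X) (\<lambda>(t, x). blinfun_mult_right (ux t x))"
      using c unfolding C0_rect_def case_prod_unfold
      by (rule bounded_linear.continuous_on[OF bounded_linear_blinfun_mult_right])
    then show "continuous (at (t, x) within T \<times> X) (\<lambda>(t, x). blinfun_mult_right (ux t x))"
      using tx by (auto simp: continuous_on_eq_continuous_within)
  qed (use tx \<open>convex X\<close> in auto)
  then show "continuous (at p within T \<times> X) (\<lambda>(t, x). u t x)"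
    unfolding tx by (rule has_derivative_continuous)
qed

lemma at_within_Ici_pos: "t > 0 \<Longrightarrow> at t within {0..} = at (t::real)"
  by (rule at_within_interior) simp

lemma Dt_eq: "t > 0 \<Longrightarrow> ((\<lambda>s. u s x) has_real_derivative d) (at t) \<Longrightarrow> Dt u t x = d"
  unfolding Dt_def
  by (simp add: at_within_Ici_pos has_real_derivative_iff_has_vector_derivative vector_derivative_at)

lemma Dx_eq:
  "L > 0 \<Longrightarrow> x \<in> {0..L} \<Longrightarrow> (u t has_real_derivative d) (at x within {0..L}) \<Longrightarrow> Dx L u t x = d"
  unfolding Dx_def
  by (rule vector_derivative_within_closed_interval)
    (auto simp: has_real_derivative_iff_has_vector_derivative)

lemma closed_loop_solution_imp_closed_loop:
  assumes sol: "closed_loop_solution L g \<mu> m \<sigma> q k \<gamma> \<beta> lam \<xi> w h v f \<xi>h wh z"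
    and pos: "L > 0" "g > 0" "\<mu> > 0" "m > 0" and hs: "hs = m / L"
    and gains: "\<sigma> > 0" "q > 0" "k > 0" "\<gamma> > 0" "\<beta> > 0" "0 \<le> lam" "lam \<le> 1"
  shows "\<exists>ht hx vt vx htx hxx vxx.
    closed_loop L g \<mu> m hs h v ht hx vt vx htx hxx vxx f \<xi> w \<xi>h wh z \<sigma> q k \<gamma> \<beta> lam"
proof -
  have model: "tank_liquid_model L g \<mu> m \<xi> w h v f"
    and odes: "observer \<gamma> \<xi> f \<xi>h wh" "momentum_filter L g \<mu> m \<beta> h f z"
      "feedback_law L \<mu> \<sigma> q k \<gamma> lam \<xi> h f \<xi>h wh z"
    and regularity: "classical_regularity L \<xi> w h v f \<xi>h wh z"
    using sol by (auto simp: closed_loop_solution_def)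
  have reg: "C1_rect {0..} {0..L} h" "C1_rect {0<..} {0..L} v" "C2_rect {0<..} {0<..<L} h"
    "C0_rect {0..} {0..L} v" "continuous_on {0..} f"
    "\<And>t x. t \<ge> 0 \<Longrightarrow> x \<in> {0..L} \<Longrightarrow> h t x > 0" "\<And>t. t > 0 \<Longrightarrow> C2_on {0<..<L} (v t)"
    and ode_cont: "continuous_on {0..} \<xi>" "continuous_on {0..} w" "continuous_on {0..} \<xi>h"
      "continuous_on {0..} wh" "continuous_on {0..} z"
    using regularity DERIV_continuous_on by (auto simp: classical_regularity_def C1_on_def)
  obtain ht hx where h: "partials_on {0..} {0..L} h ht hx" and
    cont_h: "C0_rect {0..} {0..L} ht" "C0_rect {0..} {0..L} hx"
    using reg(1) unfolding C1_rect_def by metis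
  obtain vt vx where v: "partials_on {0<..} {0..L} v vt vx" and
    cont_v: "C0_rect {0<..} {0..L} vt" "C0_rect {0<..} {0..L} vx"
    using reg(2) unfolding C1_rect_def by metis
  have h_t: "((\<lambda>s. h s x) has_real_derivative ht t x) (at t)" if "t > 0" "x \<in> {0..L}" for t x
  proof -
    have "((\<lambda>s. h s x) has_real_derivative ht t x) (at t within {0..})"
      using h that by (auto simp: partials_on_def)
    then show ?thesis unfolding at_within_Ici_pos[OF that(1)] .
  qed
  have h_x: "(h t has_real_derivative hx t x) (at x within {0..L})" if "t \<ge> 0" "x \<in> {0..L}" for t x
    using h that by (auto simp: partials_on_def)
  have v_t: "((\<lambda>s. v s x) has_real_derivative vt t x) (at t)" if "t > 0" "x \<in> {0..L}" for t x
    using v that by (auto simp: partials_on_def at_within_open_NO_MATCH)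
  have v_x: "(v t has_real_derivative vx t x) (at x within {0..L})" if "t > 0" "x \<in> {0..L}" for t x
    using v that by (auto simp: partials_on_def)
  obtain ht' hx' where h2: "partials_on {0<..} {0<..<L} h ht' hx'"
    "C1_rect {0<..} {0<..<L} ht'" "C1_rect {0<..} {0<..<L} hx'"
    using reg(3) unfolding C2_rect_def by metis
  obtain htt htx where h2t: "partials_on {0<..} {0<..<L} ht' htt htx" "C0_rect {0<..} {0<..<L} htx"
    using h2(2) unfolding C1_rect_def by metis
  obtain hxt hxx where h2x: "partials_on {0<..} {0<..<L} hx' hxt hxx"
    using h2(3) unfolding C1_rect_def by metis
  \<comment> \<open>The derivative witnesses on the open rectangle are a priori unrelated to those
    on the closed one; uniqueness of derivatives identifies them.\<close>
  have inner: "ht' t x = ht t x" "hx' t x = hx t x" if "t > 0" "x \<in> {0<..<L}" for t x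
  proof -
    have "((\<lambda>s. h s x) has_real_derivative ht' t x) (at t)" "(h t has_real_derivative hx' t x) (at x)"
      using h2(1) that by (auto simp: partials_on_def at_within_open_NO_MATCH)
    then show "ht' t x = ht t x" "hx' t x = hx t x"
      using h_t[of t x] h_x[of t x] that DERIV_unique by (auto simp: at_within_Icc_at)
  qed
  have ht_x: "(ht t has_real_derivative htx t x) (at x)"
    and hx_x: "(hx t has_real_derivative hxx t x) (at x)" if tx: "t > 0" "x \<in> {0<..<L}" for t x
  proof -
    have "(ht' t has_real_derivative htx t x) (at x)" "(hx' t has_real_derivative hxx t x) (at x)"
      using h2t(1) h2x tx by (auto simp: partials_on_def at_within_open_NO_MATCH)
    then show "(ht t has_real_derivative htx t x) (at x)" "(hx t has_real_derivative hxx t x) (at x)"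
      using tx inner
      by (auto elim!: has_field_derivative_transform_within_open[of _ _ _ "{0<..<L}"])
  qed
  \<comment> \<open>The second derivative is obtained for each time separately and only then
    assembled into a function of t and x.\<close>
  have "\<exists>vxx. \<forall>x\<in>{0<..<L}. (vx t has_real_derivative vxx x) (at x)" if t: "t > 0" for t
  proof -
    note reg(7)[OF t]
    then obtain vx' where vx': "\<And>x. x \<in> {0<..<L} \<Longrightarrow> (v t has_real_derivative vx' x) (at x within {0<..<L})"
      and "C1_on {0<..<L} vx'"
      unfolding C2_on_def by blast
    then obtain vxx where vxx: "\<And>x. x \<in> {0<..<L} \<Longrightarrow> (vx' has_real_derivative vxx x) (at x within {0<..<L})"
      unfolding C1_on_def by blast
    have "vx' x = vx t x" if "x \<in> {0<..<L}" for x
      using vx'[OF that] v_x[OF t, of x] that DERIV_unique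
      by (auto simp: at_within_Icc_at at_within_open_NO_MATCH)
    then have "(vx t has_real_derivative vxx x) (at x)" if "x \<in> {0<..<L}" for x
      using that vxx[OF that]
      by (auto simp: at_within_open_NO_MATCH elim!: has_field_derivative_transform_within_open[of _ _ _ "{0<..<L}"])
    then show ?thesis by blast
  qed
  then obtain vxx where vx_x: "\<And>t x. t > 0 \<Longrightarrow> x \<in> {0<..<L} \<Longrightarrow> (vx t has_real_derivative vxx t x) (at x)"
    by metis
  have cont_h0: "C0_rect {0..} {0..L} h"
    by (rule C0_rect_if_partials[OF h cont_h(2)]) simp
  have mass: "ht t x = - (hx t x * v t x + h t x * vx t x)" if tx: "t > 0" "x \<in> {0..L}" for t x
  proof -
    have "Dt h t x + Dx L (\<lambda>t x. h t x * v t x) t x = 0" using model tx unfolding tank_liquid_model_def by blast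
    moreover have "Dt h t x = ht t x" by (intro Dt_eq h_t tx)
    moreover have "Dx L (\<lambda>t x. h t x * v t x) t x = hx t x * v t x + h t x * vx t x"
      using tx by (intro Dx_eq pos) (auto intro!: derivative_eq_intros h_x v_x)
    ultimately show ?thesis by linarith
  qed
  have momentum: "ht t x * v t x + h t x * vt t x + hx t x * (v t x)\<^sup>2 + 2 * h t x * v t x * vx t x + g * h t x * hx t x
      = \<mu> * (hx t x * vx t x + h t x * vxx t x) + h t x * f t" if tx: "t > 0" "x \<in> {0<..<L}" for t x
  proof -
    have x: "x \<in> {0..L}" "t \<ge> 0" using tx by auto
    have at: "at x within {0..L} = at x" using tx by (auto simp: at_within_Icc_at)
    have "Dt (\<lambda>t x. h t x * v t x) t x
        + Dx L (\<lambda>t x. h t x * (v t x)\<^sup>2 + 1 / 2 * g * (h t x)\<^sup>2) t x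
        = \<mu> * Dx L (\<lambda>t x. h t x * Dx L v t x) t x + h t x * f t"
      using model tx unfolding tank_liquid_model_def by blast
    moreover have "Dt (\<lambda>t x. h t x * v t x) t x = ht t x * v t x + h t x * vt t x"
      using tx x by (intro Dt_eq) (auto intro!: derivative_eq_intros h_t v_t)
    moreover have "Dx L (\<lambda>t x. h t x * (v t x)\<^sup>2 + 1 / 2 * g * (h t x)\<^sup>2) t x
        = hx t x * (v t x)\<^sup>2 + 2 * h t x * v t x * vx t x + g * h t x * hx t x"
      by (rule Dx_eq[OF pos(1) x(1)])
        (rule derivative_eq_intros h_x v_x tx x refl | simp)+
    moreover have "Dx L (\<lambda>t x. h t x * Dx L v t x) t x = hx t x * vx t x + h t x * vxx t x"
    proof (rule Dx_eq[OF pos(1) x(1)])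
      have "((\<lambda>x. h t x * vx t x) has_real_derivative hx t x * vx t x + h t x * vxx t x) (at x)"
        using h_x[OF x(2,1)] vx_x[OF tx] unfolding at by (auto intro!: derivative_eq_intros)
      then have "((\<lambda>x. h t x * Dx L v t x) has_real_derivative hx t x * vx t x + h t x * vxx t x) (at x)"
        by (rule has_field_derivative_transform_within_open[of _ _ _ "{0<..<L}"])
          (use tx v_x in \<open>auto intro!: Dx_eq[symmetric] pos\<close>)
      then show "((\<lambda>x. h t x * Dx L v t x) has_real_derivative hx t x * vx t x + h t x * vxx t x) (at x within {0..L})"
        unfolding at .
    qed
    ultimately show ?thesis by simp
  qed
  have total_mass: "integral {0..L} (h t) = m" if "t \<ge> 0" for t
    using model that LINT_continuous[OF C0_rect_slice_x[OF cont_h0, of t "{0..L}"]]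
    by (auto simp: tank_liquid_model_def)
  have no_flow: "\<And>t. t \<ge> 0 \<Longrightarrow> v t 0 = 0" "\<And>t. t \<ge> 0 \<Longrightarrow> v t L = 0"
    and tank_odes: "\<And>t. t > 0 \<Longrightarrow> (\<xi> has_real_derivative w t) (at t)"
      "\<And>t. t > 0 \<Longrightarrow> (w has_real_derivative - f t) (at t)"
    using model by (auto simp: tank_liquid_model_def)
  have "closed_loop L g \<mu> m hs h v ht hx vt vx htx hxx vxx f \<xi> w \<xi>h wh z \<sigma> q k \<gamma> \<beta> lam"
    by unfold_locales
      (fact pos gains hs reg cont_h0 cont_h cont_v h2t(2) h_t h_x v_t v_x ht_x hx_x vx_x mass momentum
        total_mass ode_cont no_flow tank_odes
        odes(1)[unfolded observer_def, THEN conjunct1, rule_format]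
        odes(1)[unfolded observer_def, THEN conjunct2, rule_format]
        odes(2)[unfolded momentum_filter_def, rule_format] odes(3)[unfolded feedback_law_def, rule_format])+
  then show ?thesis by blast
qed

text \<open>The shape covers two uses: the functional W with weight 1/h, \<open>b = h * v\<close>
  and \<open>c = \<mu>\<close>, and the L2 norm of the weak derivative with weight 1,
  \<open>b = 0\<close> and \<open>c = 1\<close>.\<close>

lemma LINT_weak_deriv_quadratic:
  assumes "L > 0" and der: "\<And>x. x \<in> {0..L} \<Longrightarrow> (u has_real_derivative u' x) (at x within {0..L})"
    and cont: "continuous_on {0..L} u'" and a: "continuous_on {0..L} a" and b: "continuous_on {0..L} b"
  shows "(LINT x|lebesgue_on {0..L}. a x * (b x + c * weak_deriv L u x)\<^sup>2)
    = integral {0..L} (\<lambda>x. a x * (b x + c * u' x)\<^sup>2)"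
proof -
  have meas: "y \<in> borel_measurable (lebesgue_on {0..L})" if "continuous_on {0..L} y" for y :: "real \<Rightarrow> real"
    by (intro borel_measurable_integrable continuous_imp_integrable_real that)
  note m = weak_deriv_classical(1)[OF assms(1-3)] meas[OF cont] meas[OF a] meas[OF b]
  have "(LINT x|lebesgue_on {0..L}. a x * (b x + c * weak_deriv L u x)\<^sup>2)
    = (LINT x|lebesgue_on {0..L}. a x * (b x + c * u' x)\<^sup>2)"
  proof (rule integral_cong_AE)
    show "AE x in lebesgue_on {0..L}. a x * (b x + c * weak_deriv L u x)\<^sup>2 = a x * (b x + c * u' x)\<^sup>2"
      by (rule eventually_mono[OF weak_deriv_classical(2)[OF assms(1-3)]]) auto
  qed (use m in measurable)
  also have "\<dots> = integral {0..L} (\<lambda>x. a x * (b x + c * u' x)\<^sup>2)"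
    by (intro LINT_continuous continuous_intros a b cont)
  finally show ?thesis .
qed

section \<open>Identification of the functionals along a solution\<close>

context closed_loop
begin

text \<open>A sum of squares in place of the sum of norms in \<open>total_deviation\<close>, so that
  it can be compared term by term with the quadratic functional \<open>Lyap\<close>.\<close>

definition deviation_sq :: "real \<Rightarrow> real" where
  "deviation_sq t = (\<xi> t)\<^sup>2 + (w t)\<^sup>2 + h_sq t + hx_sq t + v_sq t + (pos_err t)\<^sup>2 + (wh t - w t)\<^sup>2 + lam * (filt_err t)\<^sup>2"

lemma filter_error_eq: "t \<ge> 0 \<Longrightarrow> filter_error L \<mu> (h t) (v t) (z t) = filt_err t"
  by (simp add: filter_error_def filt_err_def momentum_int_def level_jump_def LINT_continuous
      continuous_on_mult continuous_slice)

lemma V_fun_eq: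
  assumes "t \<ge> 0"
  shows "V_fun L g \<mu> hs q k (\<xi> t, w t, h t, v t) = energy t + q * k\<^sup>2 / 2 * (\<xi> t)\<^sup>2 + q / 2 * (comb_vel t)\<^sup>2"
proof -
  note c = continuous_slice[OF assms]
  have hp: "h t x > 0" if "x \<in> {0..L}" for x by (rule h_pos[OF assms that])
  have "(LINT x|lebesgue_on {0..L}. inverse (h t x) * (h t x * v t x + \<mu> * weak_deriv L (h t) x)\<^sup>2)
    = integral {0..L} (\<lambda>x. inverse (h t x) * (h t x * v t x + \<mu> * hx t x)\<^sup>2)"
    using hp by (intro LINT_weak_deriv_quadratic pos h_x assms continuous_intros c) force+
  then have "W_fun L g \<mu> hs (h t) (v t) + E_fun L g hs (h t) (v t)
    = 1 / 2 * integral {0..L} (\<lambda>x. inverse (h t x) * (h t x * v t x + \<mu> * hx t x)\<^sup>2)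
      + 1 / 2 * integral {0..L} (\<lambda>x. h t x * (v t x)\<^sup>2) + g * h_sq t"
    unfolding W_fun_def E_fun_def h_sq_def
    by (simp add: LINT_continuous continuous_intros c)
  also have "((\<lambda>x. 1 / 2 * (inverse (h t x) * (h t x * v t x + \<mu> * hx t x)\<^sup>2)
      + 1 / 2 * (h t x * (v t x)\<^sup>2) + g * (h t x - hs)\<^sup>2) has_integral \<dots>) {0..L}"
    unfolding h_sq_def using hp
    by (intro has_integral_add has_integral_mult_right integrable_integral
          integrable_continuous_real continuous_intros c) force+
  then have "1 / 2 * integral {0..L} (\<lambda>x. inverse (h t x) * (h t x * v t x + \<mu> * hx t x)\<^sup>2)
      + 1 / 2 * integral {0..L} (\<lambda>x. h t x * (v t x)\<^sup>2) + g * h_sq t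
    = integral {0..L} (\<lambda>x. 1 / 2 * (inverse (h t x) * (h t x * v t x + \<mu> * hx t x)\<^sup>2)
      + 1 / 2 * (h t x * (v t x)\<^sup>2) + g * (h t x - hs)\<^sup>2)"
    by (rule integral_unique[symmetric])
  also have "\<dots> = energy t"
    unfolding energy_def energy_density_def by (simp add: field_simps)
  finally show ?thesis by (simp add: V_fun_def comb_vel_def)
qed

lemma Phi_fun_eq:
  assumes "t \<ge> 0"
  shows "Phi_fun L g \<mu> hs \<sigma> q k \<gamma> lam (\<xi> t, w t, h t, v t) (\<xi>h t) (wh t) (z t) = Lyap t"
  using V_fun_eq[OF assms] filter_error_eq[OF assms]
  by (simp add: Phi_fun_def Lyap_def pos_err_def vel_err_def)

lemma in_X_set:
  assumes "t \<ge> 0" "Lyap t < R_const g \<mu> hs Hmax"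
  shows "(\<xi> t, w t, h t, v t) \<in> X_set L g \<mu> m Hmax q k"
proof -
  note c = continuous_slice[OF assms(1)]
  have "has_weak_derivative L (h t) (hx t)"
    by (intro classical_imp_weak_derivative pos h_x c assms(1))
  then have "in_H1 L (h t)" using in_L2_continuous[OF c(1)] by (auto simp: in_H1_def)
  then have "(\<xi> t, w t, h t, v t) \<in> state_space L m"
    using c h_pos[OF assms(1)] no_flow[OF assms(1)] total_mass[OF assms(1)]
    by (simp add: state_space_def LINT_continuous)
  moreover have "V_fun L g \<mu> hs q k (\<xi> t, w t, h t, v t) \<le> Lyap t"
    unfolding V_fun_eq[OF assms(1)] Lyap_def using gains by (simp add: add.assoc)
  ultimately show ?thesis using assms(2) by (simp add: X_set_def flip: hs_eq)
qed

lemma total_deviation_eq: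
  assumes "t \<ge> 0"
  shows "total_deviation L \<mu> hs lam (\<xi> t, w t, h t, v t) (\<xi>h t) (wh t) (z t)
    = sqrt ((\<xi> t)\<^sup>2 + (w t)\<^sup>2 + h_sq t + hx_sq t + v_sq t) + \<bar>pos_err t\<bar> + \<bar>wh t - w t\<bar> + sqrt lam * \<bar>filt_err t\<bar>"
proof -
  note c = continuous_slice[OF assms]
  let ?u = "\<lambda>x. h t x - hs * indicat_real {0..L} x"
  have der: "(?u has_real_derivative hx t x) (at x within {0..L})" if x: "x \<in> {0..L}" for x
  proof (rule has_field_derivative_transform_within[OF _ zero_less_one x])
    show "((\<lambda>x. h t x - hs) has_real_derivative hx t x) (at x within {0..L})"
      using h_x[OF assms x] by (auto intro!: derivative_eq_intros)
  qed simp
  have "(LINT x|lebesgue_on {0..L}. (?u x)\<^sup>2) = (LINT x|lebesgue_on {0..L}. (h t x - hs)\<^sup>2)"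
    by (intro Bochner_Integration.integral_cong) auto
  also have "\<dots> = h_sq t"
    unfolding h_sq_def by (intro LINT_continuous continuous_intros c)
  finally have "(L2_norm L ?u)\<^sup>2 = h_sq t"
    using sq_nonneg[OF assms] by (simp add: L2_norm_def)
  moreover have "(L2_norm L (weak_deriv L ?u))\<^sup>2 = hx_sq t"
    using LINT_weak_deriv_quadratic[OF pos(1) der c(2), of "\<lambda>x. 1" "\<lambda>x. 0" 1] sq_nonneg[OF assms]
    by (simp add: L2_norm_def hx_sq_def)
  moreover have "(L2_norm L (v t))\<^sup>2 = v_sq t"
    using sq_nonneg[OF assms] by (simp add: L2_norm_def v_sq_def LINT_continuous continuous_intros c)
  ultimately show ?thesis
    by (simp add: total_deviation_def X_norm_def filter_error_eq[OF assms] pos_err_def)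
qed

text \<open>\<open>total_deviation\<close> is the sum of four nonnegative numbers whose squares add
  up to \<open>deviation_sq\<close>; the factor 2 is the square root of 4.\<close>

lemma total_deviation_bounds:
  assumes "t \<ge> 0"
  shows "sqrt (deviation_sq t) \<le> total_deviation L \<mu> hs lam (\<xi> t, w t, h t, v t) (\<xi>h t) (wh t) (z t)"
    and "total_deviation L \<mu> hs lam (\<xi> t, w t, h t, v t) (\<xi>h t) (wh t) (z t) \<le> 2 * sqrt (deviation_sq t)"
proof -
  define a b c d where "a = sqrt ((\<xi> t)\<^sup>2 + (w t)\<^sup>2 + h_sq t + hx_sq t + v_sq t)" and "b = \<bar>pos_err t\<bar>"
    and "c = \<bar>wh t - w t\<bar>" and "d = sqrt lam * \<bar>filt_err t\<bar>"
  have nn: "a \<ge> 0" "b \<ge> 0" "c \<ge> 0" "d \<ge> 0"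
    using sq_nonneg[OF assms] gains by (auto simp: a_def b_def c_def d_def)
  have sq: "deviation_sq t = a\<^sup>2 + b\<^sup>2 + c\<^sup>2 + d\<^sup>2"
    using sq_nonneg[OF assms] gains
    by (simp add: deviation_sq_def a_def b_def c_def d_def power_mult_distrib)
  have dev: "total_deviation L \<mu> hs lam (\<xi> t, w t, h t, v t) (\<xi>h t) (wh t) (z t) = a + b + c + d"
    using total_deviation_eq[OF assms] by (simp add: a_def b_def c_def d_def)
  have "a\<^sup>2 + b\<^sup>2 + c\<^sup>2 + d\<^sup>2 \<le> (a + b + c + d)\<^sup>2"
    using nn by (simp add: power2_eq_square algebra_simps)
  then show "sqrt (deviation_sq t) \<le> total_deviation L \<mu> hs lam (\<xi> t, w t, h t, v t) (\<xi>h t) (wh t) (z t)"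
    unfolding dev sq using nn by (intro real_le_lsqrt) auto
  have "4 * (a\<^sup>2 + b\<^sup>2 + c\<^sup>2 + d\<^sup>2) - (a + b + c + d)\<^sup>2
    = (a - b)\<^sup>2 + (a - c)\<^sup>2 + (a - d)\<^sup>2 + (b - c)\<^sup>2 + (b - d)\<^sup>2 + (c - d)\<^sup>2"
    by (simp add: power2_eq_square algebra_simps)
  also have "\<dots> \<ge> 0" by simp
  finally have "(a + b + c + d)\<^sup>2 \<le> (2 * sqrt (a\<^sup>2 + b\<^sup>2 + c\<^sup>2 + d\<^sup>2))\<^sup>2"
    by (simp add: power_mult_distrib)
  then show "total_deviation L \<mu> hs lam (\<xi> t, w t, h t, v t) (\<xi>h t) (wh t) (z t) \<le> 2 * sqrt (deviation_sq t)"
    unfolding dev sq by (rule power2_le_imp_le) simp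
qed

end

section \<open>Comparison of the Lyapunov functional with its decay and with the deviation\<close>

lemma square_add_le: "(x + y)\<^sup>2 \<le> 2 * x\<^sup>2 + 2 * (y::real)\<^sup>2"
  using zero_le_power2[of "x - y"] by (simp add: power2_eq_square algebra_simps)

text \<open>Finitely many smallness conditions on the decay rate can be met together through a
  filter, which spares an explicit minimum.\<close>

lemma eventually_small_multiple_le:
  fixes c d :: real
  assumes "d > 0"
  shows "\<forall>\<^sub>F \<kappa> in at_right 0. \<kappa> * c \<le> d"
proof -
  have "((\<lambda>\<kappa>. \<kappa> * c) \<longlongrightarrow> 0 * c) (at_right 0)" by (intro tendsto_intros)
  then have "\<forall>\<^sub>F \<kappa> in at_right 0. \<kappa> * c < d" by (rule order_tendstoD) (use assms in simp)
  then show ?thesis by eventually_elim simp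
qed

lemma eventually_large_multiple_ge:
  fixes c d :: real
  assumes "d > 0"
  shows "\<forall>\<^sub>F a in at_top. c \<le> a * d"
  using eventually_ge_at_top[of "c / d"] by eventually_elim (use assms in \<open>simp add: field_simps\<close>)

context closed_loop
begin

lemma Lyap'_le_Lyap:
  assumes "t > 0" and le: "\<And>x. x \<in> {0..L} \<Longrightarrow> lo \<le> h t x \<and> h t x \<le> hi"
    and "lo > 0" "hi > 0" "\<beta> \<ge> 4 * \<sigma>" "\<kappa> > 0"
    and \<kappa>: "\<kappa> * (3 / 2 * hi * (L\<^sup>2 / (pi\<^sup>2 * lo))) \<le> \<mu> - m * hi * L\<^sup>2 / (pi\<^sup>2 * lo) * (\<beta> / 2 + 2 * \<sigma>)"
      "\<kappa> * (\<mu>\<^sup>2 / lo + g * L\<^sup>2) \<le> \<mu> * g - \<sigma> * \<mu>\<^sup>2 * L / 2"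
      "\<kappa> * (q * k\<^sup>2 / 2) \<le> q * k ^ 3" "\<kappa> * (q / 2) \<le> \<sigma> * q\<^sup>2 / 8 - q * k"
      "\<kappa> * (\<sigma> * q\<^sup>2 / (2 * \<gamma>)) \<le> \<sigma> * q\<^sup>2" "\<kappa> * (\<sigma> * q\<^sup>2 / \<gamma>) \<le> \<sigma> * q\<^sup>2"
      "\<kappa> * (1 / 2) \<le> (\<beta> - 4 * \<sigma>) / 4"
  shows "Lyap' t \<le> - \<kappa> * Lyap t"
proof -
  have t: "t \<ge> 0" using assms(1) by simp
  have nn: "lam * (filt_err t)\<^sup>2 \<ge> 0" using gains by simp
  define K where "K = L\<^sup>2 / (pi\<^sup>2 * lo)"
  \<comment> \<open>Neither \<open>v_sq\<close> nor \<open>h_sq\<close> is dissipated directly: the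
    first is absorbed by the viscous dissipation, the second by \<open>hx_sq\<close>.\<close>
  have "v_sq t \<le> K * dissipation t" "h_sq t \<le> L\<^sup>2 * hx_sq t"
    using v_sq_le[OF assms(1)] h_sq_le[OF t hs_eq] le assms(3) by (auto simp: K_def)
  then have "3 / 2 * hi * v_sq t \<le> 3 / 2 * hi * (K * dissipation t)"
    "g * h_sq t \<le> g * (L\<^sup>2 * hx_sq t)"
    using pos assms(4) by (intro mult_left_mono; simp)+
  then have "Lyap t \<le> (3 / 2 * hi * K) * dissipation t + (\<mu>\<^sup>2 / lo + g * L\<^sup>2) * hx_sq t
      + q * k\<^sup>2 / 2 * (\<xi> t)\<^sup>2 + q / 2 * (comb_vel t)\<^sup>2 + \<sigma> * q\<^sup>2 / (2 * \<gamma>) * (pos_err t)\<^sup>2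
      + \<sigma> * q\<^sup>2 / \<gamma> * (vel_err t)\<^sup>2 + 1 / 2 * (lam * (filt_err t)\<^sup>2)"
    using Lyap_le[OF t le assms(3,4)] by (simp add: algebra_simps)
  then have "\<kappa> * Lyap t \<le> \<kappa> * ((3 / 2 * hi * K) * dissipation t + (\<mu>\<^sup>2 / lo + g * L\<^sup>2) * hx_sq t
      + q * k\<^sup>2 / 2 * (\<xi> t)\<^sup>2 + q / 2 * (comb_vel t)\<^sup>2 + \<sigma> * q\<^sup>2 / (2 * \<gamma>) * (pos_err t)\<^sup>2
      + \<sigma> * q\<^sup>2 / \<gamma> * (vel_err t)\<^sup>2 + 1 / 2 * (lam * (filt_err t)\<^sup>2))"
    using \<open>\<kappa> > 0\<close> by (intro mult_left_mono) auto
  also have "\<dots> = \<kappa> * (3 / 2 * hi * K) * dissipation t + \<kappa> * (\<mu>\<^sup>2 / lo + g * L\<^sup>2) * hx_sq t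
      + \<kappa> * (q * k\<^sup>2 / 2) * (\<xi> t)\<^sup>2 + \<kappa> * (q / 2) * (comb_vel t)\<^sup>2 + \<kappa> * (\<sigma> * q\<^sup>2 / (2 * \<gamma>)) * (pos_err t)\<^sup>2
      + \<kappa> * (\<sigma> * q\<^sup>2 / \<gamma>) * (vel_err t)\<^sup>2 + \<kappa> * (1 / 2) * (lam * (filt_err t)\<^sup>2)"
    by (simp add: algebra_simps)
  also have "\<dots> \<le> (\<mu> - m * hi * L\<^sup>2 / (pi\<^sup>2 * lo) * (\<beta> / 2 + 2 * \<sigma>)) * dissipation t
      + (\<mu> * g - \<sigma> * \<mu>\<^sup>2 * L / 2) * hx_sq t + q * k ^ 3 * (\<xi> t)\<^sup>2 + (\<sigma> * q\<^sup>2 / 8 - q * k) * (comb_vel t)\<^sup>2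
      + \<sigma> * q\<^sup>2 * (pos_err t)\<^sup>2 + \<sigma> * q\<^sup>2 * (vel_err t)\<^sup>2 + (\<beta> - 4 * \<sigma>) / 4 * (lam * (filt_err t)\<^sup>2)"
    by (intro add_mono mult_right_mono \<kappa>[folded K_def] dissipation_nonneg[OF assms(1)] sq_nonneg(3)[OF t] nn
        zero_le_power2)
  also have "\<dots> \<le> - Lyap' t"
    using Lyap'_le[OF assms(1) le assms(3-5)] by (simp add: algebra_simps)
  finally show ?thesis by simp
qed

text \<open>The velocities \<open>w\<close> and \<open>wh - w\<close> are recovered from
  \<open>comb_vel\<close> and \<open>vel_err\<close> at the price of multiples of \<xi> and
  \<open>pos_err\<close>; hence the constants 1 + 2 k^2 and 1 + 2 \<gamma>^2.\<close>

lemma deviation_sq_le_Lyap: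
  assumes "t \<ge> 0" and le: "\<And>x. x \<in> {0..L} \<Longrightarrow> lo \<le> h t x \<and> h t x \<le> hi" and "lo > 0" "a > 0"
    and a: "1 \<le> a * (\<mu>\<^sup>2 / (8 * hi))" "1 \<le> a * (lo / 4)" "1 \<le> a * g" "1 + 2 * k\<^sup>2 \<le> a * (q * k\<^sup>2 / 2)"
      "2 \<le> a * (q / 2)" "1 + 2 * \<gamma>\<^sup>2 \<le> a * (\<sigma> * q\<^sup>2 / (2 * \<gamma>))" "2 \<le> a * (\<sigma> * q\<^sup>2 / \<gamma>)" "1 \<le> a * (1 / 2)"
  shows "deviation_sq t \<le> a * Lyap t"
proof -
  have nn: "lam * (filt_err t)\<^sup>2 \<ge> 0" using gains by simp
  have "(w t)\<^sup>2 \<le> 2 * (comb_vel t)\<^sup>2 + 2 * k\<^sup>2 * (\<xi> t)\<^sup>2"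
    using square_add_le[of "comb_vel t" "- k * \<xi> t"] by (simp add: comb_vel_def power_mult_distrib)
  moreover have "(wh t - w t)\<^sup>2 \<le> 2 * (vel_err t)\<^sup>2 + 2 * \<gamma>\<^sup>2 * (pos_err t)\<^sup>2"
    using square_add_le[of "vel_err t" "\<gamma> * pos_err t"] by (simp add: pos_err_def vel_err_def power_mult_distrib)
  ultimately have "deviation_sq t \<le> 1 * hx_sq t + 1 * v_sq t + 1 * h_sq t + (1 + 2 * k\<^sup>2) * (\<xi> t)\<^sup>2 + 2 * (comb_vel t)\<^sup>2
      + (1 + 2 * \<gamma>\<^sup>2) * (pos_err t)\<^sup>2 + 2 * (vel_err t)\<^sup>2 + 1 * (lam * (filt_err t)\<^sup>2)"
    unfolding deviation_sq_def by (simp add: algebra_simps)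
  also have "\<dots> \<le> a * (\<mu>\<^sup>2 / (8 * hi)) * hx_sq t + a * (lo / 4) * v_sq t + a * g * h_sq t
      + a * (q * k\<^sup>2 / 2) * (\<xi> t)\<^sup>2 + a * (q / 2) * (comb_vel t)\<^sup>2 + a * (\<sigma> * q\<^sup>2 / (2 * \<gamma>)) * (pos_err t)\<^sup>2
      + a * (\<sigma> * q\<^sup>2 / \<gamma>) * (vel_err t)\<^sup>2 + a * (1 / 2) * (lam * (filt_err t)\<^sup>2)"
    by (intro add_mono mult_right_mono a sq_nonneg[OF assms(1)] nn zero_le_power2)
  also have "\<dots> = a * (\<mu>\<^sup>2 / (8 * hi) * hx_sq t + lo / 4 * v_sq t + g * h_sq t
      + q * k\<^sup>2 / 2 * (\<xi> t)\<^sup>2 + q / 2 * (comb_vel t)\<^sup>2 + \<sigma> * q\<^sup>2 / (2 * \<gamma>) * (pos_err t)\<^sup>2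
      + \<sigma> * q\<^sup>2 / \<gamma> * (vel_err t)\<^sup>2 + 1 / 2 * (lam * (filt_err t)\<^sup>2))"
    by (simp only: distrib_left mult.assoc)
  also have "\<dots> \<le> a * Lyap t"
    using Lyap_ge[OF assms(1) le assms(3)] \<open>a > 0\<close> by (intro mult_left_mono) auto
  finally show ?thesis .
qed

lemma Lyap_le_deviation_sq:
  assumes "t \<ge> 0" and le: "\<And>x. x \<in> {0..L} \<Longrightarrow> lo \<le> h t x \<and> h t x \<le> hi" and "lo > 0" "hi > 0"
    and b: "3 / 2 * hi \<le> b" "\<mu>\<^sup>2 / lo \<le> b" "g \<le> b" "q * k\<^sup>2 / 2 + q * k\<^sup>2 \<le> b" "q \<le> b"
      "\<sigma> * q\<^sup>2 / (2 * \<gamma>) + \<sigma> * q\<^sup>2 / \<gamma> * (2 * \<gamma>\<^sup>2) \<le> b" "\<sigma> * q\<^sup>2 / \<gamma> * 2 \<le> b" "1 / 2 \<le> b"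
  shows "Lyap t \<le> b * deviation_sq t"
proof -
  have nn: "lam * (filt_err t)\<^sup>2 \<ge> 0" using gains by simp
  have "(comb_vel t)\<^sup>2 \<le> 2 * (w t)\<^sup>2 + 2 * k\<^sup>2 * (\<xi> t)\<^sup>2"
    using square_add_le[of "w t" "k * \<xi> t"] by (simp add: comb_vel_def power_mult_distrib)
  then have 1: "q / 2 * (comb_vel t)\<^sup>2 \<le> q / 2 * (2 * (w t)\<^sup>2 + 2 * k\<^sup>2 * (\<xi> t)\<^sup>2)"
    using gains by (intro mult_left_mono) auto
  have "(vel_err t)\<^sup>2 \<le> 2 * (wh t - w t)\<^sup>2 + 2 * \<gamma>\<^sup>2 * (pos_err t)\<^sup>2"
    using square_add_le[of "wh t - w t" "- \<gamma> * pos_err t"] by (simp add: pos_err_def vel_err_def power_mult_distrib)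
  then have 2: "\<sigma> * q\<^sup>2 / \<gamma> * (vel_err t)\<^sup>2 \<le> \<sigma> * q\<^sup>2 / \<gamma> * (2 * (wh t - w t)\<^sup>2 + 2 * \<gamma>\<^sup>2 * (pos_err t)\<^sup>2)"
    using gains by (intro mult_left_mono) auto
  have "Lyap t \<le> 3 / 2 * hi * v_sq t + \<mu>\<^sup>2 / lo * hx_sq t + g * h_sq t + (q * k\<^sup>2 / 2 + q * k\<^sup>2) * (\<xi> t)\<^sup>2
      + q * (w t)\<^sup>2 + (\<sigma> * q\<^sup>2 / (2 * \<gamma>) + \<sigma> * q\<^sup>2 / \<gamma> * (2 * \<gamma>\<^sup>2)) * (pos_err t)\<^sup>2
      + \<sigma> * q\<^sup>2 / \<gamma> * 2 * (wh t - w t)\<^sup>2 + 1 / 2 * (lam * (filt_err t)\<^sup>2)"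
    using Lyap_le[OF assms(1) le assms(3,4)] 1 2 by (simp add: algebra_simps)
  also have "\<dots> \<le> b * v_sq t + b * hx_sq t + b * h_sq t + b * (\<xi> t)\<^sup>2 + b * (w t)\<^sup>2 + b * (pos_err t)\<^sup>2
      + b * (wh t - w t)\<^sup>2 + b * (lam * (filt_err t)\<^sup>2)"
    by (intro add_mono mult_right_mono b sq_nonneg[OF assms(1)] nn zero_le_power2)
  also have "\<dots> = b * deviation_sq t" unfolding deviation_sq_def by (simp add: algebra_simps)
  finally show ?thesis .
qed

end

theorem theorem1:
  fixes L g \<mu> m Hmax hs r \<sigma> q k \<gamma> \<beta> lam :: real
  assumes "L > 0" "g > 0" "\<mu> > 0" "m > 0" "Hmax > 0"
    and "hs = m / L" and "hs < Hmax"
    and "0 \<le> r" "r < R_const g \<mu> hs Hmax"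
    and "\<sigma> > 0" "q > 0" "k > 0" "\<gamma> > 0" "\<beta> > 0"
    and "0 \<le> lam" "lam \<le> 1"
    and "2 * g / (\<mu> * L) > \<sigma>" "\<sigma> > 8 * k / q"
    and "2 * pi\<^sup>2 * \<mu> * G_inv hs (- c_const g \<mu> * r) / (m * L\<^sup>2 * G_inv hs (c_const g \<mu> * r)) > \<beta> + 4 * \<sigma>"
    and "\<beta> + 4 * \<sigma> > 8 * \<sigma>"
  shows "\<exists>M \<phi> :: real. M > 0 \<and> \<phi> > 0 \<and>
    (\<forall>\<xi> w h v f \<xi>h wh z.
       closed_loop_solution L g \<mu> m \<sigma> q k \<gamma> \<beta> lam \<xi> w h v f \<xi>h wh z \<longrightarrow>
       Phi_fun L g \<mu> hs \<sigma> q k \<gamma> lam (\<xi> 0, w 0, h 0, v 0) (\<xi>h 0) (wh 0) (z 0) \<le> r \<longrightarrow>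
       (\<forall>t\<ge>0.
          (\<xi> t, w t, h t, v t) \<in> X_set L g \<mu> m Hmax q k \<and>
          total_deviation L \<mu> hs lam (\<xi> t, w t, h t, v t) (\<xi>h t) (wh t) (z t)
          \<le> M * exp (- \<phi> * t) *
             total_deviation L \<mu> hs lam (\<xi> 0, w 0, h 0, v 0) (\<xi>h 0) (wh 0) (z 0)))"
proof -
  have "hs > 0" using assms by simp
  define c where "c = c_const g \<mu>"
  have "c > 0" using assms by (simp add: c_def c_const_def)
  \<comment> \<open>The minimum in R is at most 0, so r < R keeps -c r inside the range of G and
    \<open>G_inv\<close> is meaningful there.\<close>
  have "R_const g \<mu> hs Hmax \<le> 2 * \<mu> * sqrt g / 3 * (2 * hs * sqrt hs)"
    unfolding R_const_def using assms by (intro mult_left_mono) (auto simp: mult_nonneg_nonpos)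
  also have "\<dots> = \<mu> * sqrt g * (4 / 3 * hs * sqrt hs)" by simp
  finally have "r < \<mu> * sqrt g * (4 / 3 * hs * sqrt hs)" using assms(9) by simp
  then have cr: "c * r < 4 / 3 * hs * sqrt hs"
    using assms(2,3) by (simp add: c_def c_const_def field_simps)
  define A B where "A = m * L\<^sup>2" and "B = 2 * pi\<^sup>2 * \<mu>"
  have AB: "A > 0" "B > 0" using assms by (auto simp: A_def B_def)
  \<comment> \<open>The gain condition, solved for the ratio of the extreme levels allowed by
    \<bar>G\<bar> \<le> c r.\<close>
  have "(\<beta> + 4 * \<sigma>) * (A / B) < B * G_inv hs (- c * r) / (A * G_inv hs (c * r)) * (A / B)"
    using assms(19) AB by (intro mult_strict_right_mono) (auto simp: A_def B_def c_def)
  also have "\<dots> = G_inv hs (- (c * r)) / G_inv hs (c * r)" using AB by simp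
  finally have "(\<beta> + 4 * \<sigma>) * (m * L\<^sup>2) / (2 * pi\<^sup>2 * \<mu>) < G_inv hs (- (c * r)) / G_inv hs (c * r)"
    by (simp add: A_def B_def)
  then obtain lo hi lvl where lohi: "0 < lo" "lo \<le> hi" "c * r < lvl"
    "(\<beta> + 4 * \<sigma>) * (m * L\<^sup>2) / (2 * pi\<^sup>2 * \<mu>) < lo / hi"
    and lvl: "\<And>h. h > 0 \<Longrightarrow> \<bar>G_fun hs h\<bar> \<le> lvl \<Longrightarrow> lo \<le> h \<and> h \<le> hi"
    using G_inv_relax[OF \<open>hs > 0\<close> _ cr] \<open>c > 0\<close> assms(8) by (metis mult_nonneg_nonneg less_imp_le)
  have "hi > 0" using lohi by linarith
  \<comment> \<open>The energy level at which c times the energy reaches the raised bound for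
    \<bar>G\<bar>.\<close>
  define r' where "r' = lvl / c"
  have "r < r'" using lohi(3) \<open>c > 0\<close> by (simp add: r'_def field_simps)
  have "\<mu> - m * hi * L\<^sup>2 / (pi\<^sup>2 * lo) * (\<beta> / 2 + 2 * \<sigma>) > 0"
    using lohi(1,4) \<open>hi > 0\<close> assms(3) by (simp add: field_simps)
  moreover have "\<mu> * g - \<sigma> * \<mu>\<^sup>2 * L / 2 > 0"
    using assms(1-3,17) by (simp add: field_simps power2_eq_square)
  moreover have "\<sigma> * q\<^sup>2 / 8 - q * k > 0"
    using assms(11,18) by (simp add: field_simps power2_eq_square)
  moreover have "(\<beta> - 4 * \<sigma>) / 4 > 0" using assms(20) by simp
  moreover have "q * k ^ 3 > 0" "\<sigma> * q\<^sup>2 > 0" using assms by auto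
  \<comment> \<open>All left-hand sides tend to 0 with \<kappa>. They involve only the parameters
    and \<open>lo\<close>, \<open>hi\<close>, so the rate is fixed before any solution is
    considered.\<close>
  ultimately have "\<forall>\<^sub>F \<kappa> in at_right 0. \<kappa> > 0
      \<and> \<kappa> * (3 / 2 * hi * (L\<^sup>2 / (pi\<^sup>2 * lo))) \<le> \<mu> - m * hi * L\<^sup>2 / (pi\<^sup>2 * lo) * (\<beta> / 2 + 2 * \<sigma>)
      \<and> \<kappa> * (\<mu>\<^sup>2 / lo + g * L\<^sup>2) \<le> \<mu> * g - \<sigma> * \<mu>\<^sup>2 * L / 2
      \<and> \<kappa> * (q * k\<^sup>2 / 2) \<le> q * k ^ 3 \<and> \<kappa> * (q / 2) \<le> \<sigma> * q\<^sup>2 / 8 - q * k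
      \<and> \<kappa> * (\<sigma> * q\<^sup>2 / (2 * \<gamma>)) \<le> \<sigma> * q\<^sup>2 \<and> \<kappa> * (\<sigma> * q\<^sup>2 / \<gamma>) \<le> \<sigma> * q\<^sup>2
      \<and> \<kappa> * (1 / 2) \<le> (\<beta> - 4 * \<sigma>) / 4"
    by (intro eventually_conj eventually_small_multiple_le eventually_at_right_less)
  from eventually_happens'[OF _ this] obtain \<kappa> where "\<kappa> > 0"
    and \<kappa>: "\<kappa> * (3 / 2 * hi * (L\<^sup>2 / (pi\<^sup>2 * lo))) \<le> \<mu> - m * hi * L\<^sup>2 / (pi\<^sup>2 * lo) * (\<beta> / 2 + 2 * \<sigma>)"
      "\<kappa> * (\<mu>\<^sup>2 / lo + g * L\<^sup>2) \<le> \<mu> * g - \<sigma> * \<mu>\<^sup>2 * L / 2"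
      "\<kappa> * (q * k\<^sup>2 / 2) \<le> q * k ^ 3" "\<kappa> * (q / 2) \<le> \<sigma> * q\<^sup>2 / 8 - q * k"
      "\<kappa> * (\<sigma> * q\<^sup>2 / (2 * \<gamma>)) \<le> \<sigma> * q\<^sup>2" "\<kappa> * (\<sigma> * q\<^sup>2 / \<gamma>) \<le> \<sigma> * q\<^sup>2"
      "\<kappa> * (1 / 2) \<le> (\<beta> - 4 * \<sigma>) / 4"
    by auto
  have "\<mu>\<^sup>2 / (8 * hi) > 0" "lo / 4 > 0" "q * k\<^sup>2 / 2 > 0" "q / 2 > 0" "\<sigma> * q\<^sup>2 / (2 * \<gamma>) > 0"
    "\<sigma> * q\<^sup>2 / \<gamma> > 0" "1 / (2::real) > 0"
    using assms lohi \<open>hi > 0\<close> by auto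
  note d = this \<open>g > 0\<close>
  have "\<forall>\<^sub>F a in at_top. a > 0 \<and> 1 \<le> a * (\<mu>\<^sup>2 / (8 * hi)) \<and> 1 \<le> a * (lo / 4) \<and> 1 \<le> a * g
      \<and> 1 + 2 * k\<^sup>2 \<le> a * (q * k\<^sup>2 / 2) \<and> 2 \<le> a * (q / 2) \<and> 1 + 2 * \<gamma>\<^sup>2 \<le> a * (\<sigma> * q\<^sup>2 / (2 * \<gamma>))
      \<and> 2 \<le> a * (\<sigma> * q\<^sup>2 / \<gamma>) \<and> 1 \<le> a * (1 / 2)"
    by (intro eventually_conj eventually_large_multiple_ge eventually_gt_at_top d)
  from eventually_happens'[OF _ this] obtain a where "a > 0"
    and a: "1 \<le> a * (\<mu>\<^sup>2 / (8 * hi))" "1 \<le> a * (lo / 4)" "1 \<le> a * g" "1 + 2 * k\<^sup>2 \<le> a * (q * k\<^sup>2 / 2)"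
      "2 \<le> a * (q / 2)" "1 + 2 * \<gamma>\<^sup>2 \<le> a * (\<sigma> * q\<^sup>2 / (2 * \<gamma>))" "2 \<le> a * (\<sigma> * q\<^sup>2 / \<gamma>)" "1 \<le> a * (1 / 2)"
    by auto
  have "\<forall>\<^sub>F b in at_top. 3 / 2 * hi \<le> b \<and> \<mu>\<^sup>2 / lo \<le> b \<and> g \<le> b \<and> q * k\<^sup>2 / 2 + q * k\<^sup>2 \<le> b \<and> q \<le> b
      \<and> \<sigma> * q\<^sup>2 / (2 * \<gamma>) + \<sigma> * q\<^sup>2 / \<gamma> * (2 * \<gamma>\<^sup>2) \<le> b \<and> \<sigma> * q\<^sup>2 / \<gamma> * 2 \<le> b \<and> 1 / 2 \<le> b"
    by (intro eventually_conj eventually_ge_at_top)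
  from eventually_happens'[OF _ this] obtain b where
    b: "3 / 2 * hi \<le> b" "\<mu>\<^sup>2 / lo \<le> b" "g \<le> b" "q * k\<^sup>2 / 2 + q * k\<^sup>2 \<le> b" "q \<le> b"
      "\<sigma> * q\<^sup>2 / (2 * \<gamma>) + \<sigma> * q\<^sup>2 / \<gamma> * (2 * \<gamma>\<^sup>2) \<le> b" "\<sigma> * q\<^sup>2 / \<gamma> * 2 \<le> b" "1 / 2 \<le> b"
    by auto
  have "b > 0" using b(8) by linarith
  show ?thesis
  \<comment> \<open>\<open>Lyap\<close> is quadratic in the deviation, so taking roots halves the
    rate and gives \<open>sqrt (a * b)\<close>; the factor 2 comes from
    \<open>total_deviation_bounds\<close>.\<close>
  proof (rule exI[of _ "2 * sqrt (a * b)"], rule exI[of _ "\<kappa> / 2"], intro conjI allI impI)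
    show "2 * sqrt (a * b) > 0" "\<kappa> / 2 > 0" using \<open>a > 0\<close> \<open>b > 0\<close> \<open>\<kappa> > 0\<close> by auto
  next
    fix \<xi> w h v f \<xi>h wh z and t :: real
    assume sol: "closed_loop_solution L g \<mu> m \<sigma> q k \<gamma> \<beta> lam \<xi> w h v f \<xi>h wh z"
      and init: "Phi_fun L g \<mu> hs \<sigma> q k \<gamma> lam (\<xi> 0, w 0, h 0, v 0) (\<xi>h 0) (wh 0) (z 0) \<le> r"
      and "t \<ge> 0"
    obtain ht hx vt vx htx hxx vxx where
      "closed_loop L g \<mu> m hs h v ht hx vt vx htx hxx vxx f \<xi> w \<xi>h wh z \<sigma> q k \<gamma> \<beta> lam"
      using closed_loop_solution_imp_closed_loop[OF sol] assms by blast
    then interpret closed_loop L g \<mu> m hs h v ht hx vt vx htx hxx vxx f \<xi> w \<xi>h wh z \<sigma> q k \<gamma> \<beta> lam .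
    have bounds: "lo \<le> h t x \<and> h t x \<le> hi" if "t \<ge> 0" "Lyap t \<le> r'" "x \<in> {0..L}" for t x
    proof (rule lvl)
      show "h t x > 0" using h_pos that by simp
      have "\<bar>G_fun hs (h t x)\<bar> \<le> c * energy t"
        unfolding c_def by (rule G_fun_le_energy[OF that(1) hs_eq that(3)])
      also have "\<dots> \<le> c * r'"
        using energy_le_Lyap[of t] that(2) \<open>c > 0\<close> by (intro mult_left_mono) auto
      also have "\<dots> = lvl" using \<open>c > 0\<close> by (simp add: r'_def)
      finally show "\<bar>G_fun hs (h t x)\<bar> \<le> lvl" .
    qed
    have init': "Lyap 0 \<le> r" using init Phi_fun_eq[of 0] by simp
    have decr: "Lyap' t \<le> - \<kappa> * Lyap t" if "t > 0" "Lyap t \<le> r'" for t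
      by (rule Lyap'_le_Lyap[OF that(1) bounds \<open>0 < lo\<close> \<open>hi > 0\<close> _ \<open>\<kappa> > 0\<close> \<kappa>])
        (use that assms(20) in auto)
    note decay = exponential_decay_below_level[OF Lyap_continuous Lyap_deriv Lyap_nonneg init' \<open>r < r'\<close>
        \<open>\<kappa> > 0\<close> decr \<open>t \<ge> 0\<close>]
    show "(\<xi> t, w t, h t, v t) \<in> X_set L g \<mu> m Hmax q k"
      using in_X_set[OF \<open>t \<ge> 0\<close>] decay(1) assms(9) by simp
    let ?dev = "\<lambda>t. total_deviation L \<mu> hs lam (\<xi> t, w t, h t, v t) (\<xi>h t) (wh t) (z t)"
    have "deviation_sq t \<le> a * Lyap t"
      by (rule deviation_sq_le_Lyap[OF \<open>t \<ge> 0\<close> bounds \<open>0 < lo\<close> \<open>a > 0\<close> a])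
        (use \<open>t \<ge> 0\<close> decay(1) \<open>r < r'\<close> in auto)
    also have "\<dots> \<le> a * (exp (- \<kappa> * t) * Lyap 0)"
      using decay(2) \<open>a > 0\<close> by (intro mult_left_mono) auto
    also have "Lyap 0 \<le> b * deviation_sq 0"
      by (rule Lyap_le_deviation_sq[OF order_refl bounds \<open>0 < lo\<close> \<open>hi > 0\<close> b])
        (use init' \<open>r < r'\<close> in auto)
    then have "a * (exp (- \<kappa> * t) * Lyap 0) \<le> a * (exp (- \<kappa> * t) * (b * deviation_sq 0))"
      using \<open>a > 0\<close> by (intro mult_left_mono) auto
    also have "\<dots> = (a * b) * (exp (- (\<kappa> / 2) * t))\<^sup>2 * deviation_sq 0"
      by (simp add: power2_eq_square flip: exp_add)
    finally have "sqrt (deviation_sq t) \<le> sqrt ((a * b) * (exp (- (\<kappa> / 2) * t))\<^sup>2 * deviation_sq 0)"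
      by (rule real_sqrt_le_mono)
    also have "\<dots> = sqrt (a * b) * exp (- (\<kappa> / 2) * t) * sqrt (deviation_sq 0)"
      by (simp add: real_sqrt_mult)
    also have "\<dots> \<le> sqrt (a * b) * exp (- (\<kappa> / 2) * t) * ?dev 0"
      using total_deviation_bounds(1)[of 0] \<open>a > 0\<close> \<open>b > 0\<close> by (intro mult_left_mono) auto
    finally have "2 * sqrt (deviation_sq t) \<le> 2 * sqrt (a * b) * exp (- (\<kappa> / 2) * t) * ?dev 0"
      by simp
    then show "?dev t \<le> 2 * sqrt (a * b) * exp (- (\<kappa> / 2) * t) * ?dev 0"
      using total_deviation_bounds(2)[OF \<open>t \<ge> 0\<close>] by linarith
  qed
qed

end
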